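(* Suppose $E=\bigcup_{k=1}^{n}[a_k,b_k]$, where $-1=a_1<b_1<a_2<b_2<\cdots<a_n<b_n=1$ and $n\geq 2$. Write $\theta(x)=\arccos(x)$. Then \[ \mathrm{cap}\,E\;\geq\;\frac{1}{2}\,\max\,\prod_{k=1}^{n}\left\{\frac{1}{2}\left[\cos\frac{\pi(\theta(b_k)-\theta(\delta_k))}{\theta(\delta_{k-1})-\theta(\delta_k)}-\cos\frac{\pi(\theta(a_k)-\theta(\delta_k))}{\theta(\delta_{k-1})-\theta(\delta_k)}\right]\right\}^{(\theta(\delta_k)-\theta(\delta_{k-1}))^2/\pi^2}, \] where $\delta_0=-1$, $\delta_n=1$ and the maximum is taken over all $\delta_k$ satisfying $b_k<\delta_k<a_{k+1}$, $k=1,\ldots,n-1$. The equality is attained for $E=E(l,2(n-1))$, $0<l<2\pi$, and the values $\delta_k=\cos(\pi(n-k)/n)$, $k=0,1,\ldots,n$.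
   Context: Logarithmic capacity: for a compact set $E\subset\mathbb{C}$, let $B$ be the connected component of the complement of $E$ containing the point at infinity and let $g_B(z,\infty)$ be its Green function with pole at infinity. Then \[ \mathrm{cap}\,E=\exp\Big\{\lim_{z\to\infty}\big[\log|z|-g_B(z,\infty)\big]\Big\}, \] and $\mathrm{cap}\,E=0$ if $B$ does not admit a Green function. Let $\Gamma=\{z\in\mathbb{C}:|z|=1\}$. For $0<l<2\pi$ and a positive integer $s$ let $F(l,s)=\{z\in\Gamma:|\arg(z^s)|\leq l/2\}$, where $\arg$ takes values in $(-\pi,\pi]$, and let $E(l,s)\subset[-1,1]$ be the orthogonal projection of $F(l,s)$ onto the real axis.
   Formalization: The values δ_k=cos(π(n-k)/n) fail for n≥3 (n=3, small l: product differs from 2 cap E); equality is proved for δ_0=-1, δ_n=1, δ_k=cos(π(2(n-k)-1)/(2(n-1))), 1≤k≤n-1, the same for n=2. The maximum, not always attained, is read as a supremum. *)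

theory Defs
  imports "HOL-Analysis.Analysis"
begin

text \<open>Harmonic: twice continuously differentiable with vanishing Laplacian.\<close>

definition harmonic_on :: "(complex \<Rightarrow> real) \<Rightarrow> complex set \<Rightarrow> bool" where
  "harmonic_on u S \<longleftrightarrow> open S \<and>
     (\<exists>ux uy uxx uxy uyx uyy.
        continuous_on S uxx \<and> continuous_on S uxy \<and> continuous_on S uyx \<and> continuous_on S uyy \<and>
        (\<forall>z\<in>S.
           (u has_derivative (\<lambda>h. ux z * Re h + uy z * Im h)) (at z) \<and>
           (ux has_derivative (\<lambda>h. uxx z * Re h + uxy z * Im h)) (at z) \<and>
           (uy has_derivative (\<lambda>h. uyx z * Re h + uyy z * Im h)) (at z) \<and>
           uxx z + uyy z = 0))"

text \<open>
  For compact \<open>E\<close>, the set \<open>outside E\<close> is the finite part of the component \<open>B\<close> of the complement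
  of \<open>E\<close> in the Riemann sphere that contains the point at infinity. The Green function of \<open>B\<close> with
  pole at infinity is the least positive harmonic function on \<open>outside E\<close> such that
  \<open>g z - ln (norm z)\<close> has a finite limit at infinity (hence is harmonic there as well). It is unique
  on \<open>outside E\<close>; its values elsewhere are irrelevant.
\<close>

definition log_pole_at_infinity :: "complex set \<Rightarrow> (complex \<Rightarrow> real) \<Rightarrow> bool" where
  "log_pole_at_infinity E g \<longleftrightarrow>
     harmonic_on g (outside E) \<and> (\<forall>z\<in>outside E. 0 < g z) \<and>
     (\<exists>L. ((\<lambda>z. g z - ln (norm z)) \<longlongrightarrow> L) at_infinity)"

definition is_green_at_infinity :: "complex set \<Rightarrow> (complex \<Rightarrow> real) \<Rightarrow> bool" where
  "is_green_at_infinity E g \<longleftrightarrow> log_pole_at_infinity E g \<and>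
     (\<forall>h. log_pole_at_infinity E h \<longrightarrow> (\<forall>z\<in>outside E. g z \<le> h z))"

definition green_at_infinity :: "complex set \<Rightarrow> complex \<Rightarrow> real" where
  "green_at_infinity E = (SOME g. is_green_at_infinity E g)"

definition log_capacity :: "complex set \<Rightarrow> real" where
  "log_capacity E =
     (if \<exists>g. is_green_at_infinity E g
      then exp (Lim at_infinity (\<lambda>z. ln (norm z) - green_at_infinity E z))
      else 0)"

definition interval_system :: "nat \<Rightarrow> (nat \<Rightarrow> real) \<Rightarrow> (nat \<Rightarrow> real) \<Rightarrow> bool" where
  "interval_system n a b \<longleftrightarrow>
     a 1 = -1 \<and> b n = 1 \<and> (\<forall>k\<in>{1..n}. a k < b k) \<and> (\<forall>k\<in>{1..<n}. b k < a (Suc k))"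

definition interval_union :: "nat \<Rightarrow> (nat \<Rightarrow> real) \<Rightarrow> (nat \<Rightarrow> real) \<Rightarrow> complex set" where
  "interval_union n a b = (\<Union>k\<in>{1..n}. complex_of_real ` {a k..b k})"

definition cuts :: "nat \<Rightarrow> (nat \<Rightarrow> real) \<Rightarrow> (nat \<Rightarrow> real) \<Rightarrow> (nat \<Rightarrow> real) set" where
  "cuts n a b = {\<delta>. \<delta> 0 = -1 \<and> \<delta> n = 1 \<and> (\<forall>k\<in>{1..<n}. b k < \<delta> k \<and> \<delta> k < a (Suc k))}"

definition cut_product :: "nat \<Rightarrow> (nat \<Rightarrow> real) \<Rightarrow> (nat \<Rightarrow> real) \<Rightarrow> (nat \<Rightarrow> real) \<Rightarrow> real" where
  "cut_product n a b \<delta> =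
     (\<Prod>k=1..n.
        (1/2 * (cos (pi * (arccos (b k) - arccos (\<delta> k)) / (arccos (\<delta> (k - 1)) - arccos (\<delta> k)))
              - cos (pi * (arccos (a k) - arccos (\<delta> k)) / (arccos (\<delta> (k - 1)) - arccos (\<delta> k)))))
        powr ((arccos (\<delta> k) - arccos (\<delta> (k - 1)))\<^sup>2 / pi\<^sup>2))"

definition arc_set :: "real \<Rightarrow> nat \<Rightarrow> complex set" where
  "arc_set l s = {z. norm z = 1 \<and> \<bar>Arg (z ^ s)\<bar> \<le> l / 2}"

definition arc_projection :: "real \<Rightarrow> nat \<Rightarrow> complex set" where
  "arc_projection l s = (\<lambda>z. complex_of_real (Re z)) ` arc_set l s"

text \<open>
  The intervals of \<open>arc_projection l (2 * (n - 1))\<close> are the cosines of angular intervals centred at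
  \<open>pi * (n - k) / (n - 1)\<close>, \<open>k = 1..n\<close>; the interior cuts below are the cosines of the midpoints
  between consecutive centres. The equally spaced values \<open>cos (pi * (n - k) / n)\<close> agree with them
  only for \<open>n = 2\<close>: for \<open>n = 3\<close>, \<open>l = 3 * pi / 2\<close>, for instance, \<open>cos (2 * pi / 3)\<close> lies inside
  the second interval.
\<close>

definition extremal_cut :: "nat \<Rightarrow> nat \<Rightarrow> real" where
  "extremal_cut n k =
     (if k = 0 then -1
      else if k < n then cos (pi * (2 * (real n - real k) - 1) / (2 * (real n - 1)))
      else 1)"

end

theory Submission
  imports Defs "HOL-Complex_Analysis.Complex_Analysis"
begin

text \<open>
  In the coordinate \<open>z = cos \<zeta>\<close> the Green function of \<open>E\<close> becomes a harmonic function \<open>V\<close> on the half-strip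
  \<open>0 < Re \<zeta> < pi\<close>, \<open>Im \<zeta> > 0\<close> whose normal derivative vanishes on the sides and for which
  \<open>V \<zeta> - Im \<zeta>\<close> tends to \<open>- ln (2 * cap E)\<close>. Cut the half-strip along the lines \<open>Re \<zeta> = arccos (\<delta> k)\<close> and let
  \<open>U k\<close> solve the same problem in the piece of width \<open>\<alpha> k\<close>; it comes from the Green function of a single
  segment, so its constant \<open>d k\<close> at infinity is explicit. Green's formula evaluates the sum of the Dirichlet
  integrals of \<open>V - U k\<close> as the sum of \<open>\<alpha> k * (d k + ln (2 * cap E))\<close>, and its nonnegativity is the inequality.

  The Green function of \<open>E\<close> is the real part of a primitive of \<open>q z / sqrt (\<Prod>k. (z - a k) * (z - b k))\<close>,
  where the monic polynomial \<open>q\<close> of degree \<open>n - 1\<close> is chosen such that this real part takes the same value on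
  all intervals. The extremal sets are the preimages of \<open>[cos (l / 2), 1]\<close> under Chebyshev polynomials, and
  their Green functions are explicit.
\<close>

section \<open>Harmonic functions and the minimum principle\<close>

text \<open>The obstacle is the bottom of the half-strip, where the gradients of \<open>V\<close>
  and \<open>U k\<close> may blow up like inverse square roots. Green's formula is therefore used
  only on slices of positive height, as monotonicity of an energy in that height, and a low slice is
  estimated. There \<open>V * U_y\<close> should vanish because \<open>V\<close> is 0 on one part of
  the bottom and \<open>U_y\<close> on the rest; for this to hold uniformly, the segment behind
  \<open>U k\<close> is shrunk a little, and the loss is removed at the end by continuity. The
  products \<open>V * V_y\<close> and \<open>U * U_y\<close> are simply dropped as nonnegative,
  which requires all these functions to increase in the vertical direction. A reflection argument
  provides that. One factor \<open>\<alpha> k\<close> of the exponent is the weight in the energy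
  sum, the other comes from rescaling a strip of width \<open>\<alpha> k\<close> to width
  \<open>pi\<close>; the remaining \<open>pi\<close> is the total width. For the extremal sets the
  cut lines are symmetry axes of \<open>V\<close>, so \<open>V\<close> agrees with
  \<open>U k\<close> on each piece and nothing is lost. This case is verified by computing both
  sides instead.\<close>

definition complex_gradient :: "(complex \<Rightarrow> real) \<Rightarrow> (complex \<Rightarrow> complex) \<Rightarrow> complex set \<Rightarrow> bool" where
  "complex_gradient g f S \<longleftrightarrow> open S \<and> f holomorphic_on S \<and>
     (\<forall>z\<in>S. (g has_derivative (\<lambda>h. Re (f z * h))) (at z))"

text \<open>The gradient \<open>f\<close> is \<open>g_x - \<i> * g_y\<close>, twice the Wirtinger
  derivative of \<open>g\<close>. Its Cauchy-Riemann equations turn holomorphy into a vanishing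
  Laplacian.\<close>

lemma harmonic_on_complex_gradient:
  assumes "complex_gradient g f S"
  shows "harmonic_on g S"
proof -
  have S: "open S" and f: "f holomorphic_on S"
    and g: "\<And>z. z \<in> S \<Longrightarrow> (g has_derivative (\<lambda>h. Re (f z * h))) (at z)"
    using assms by (auto simp: complex_gradient_def)
  have f': "(f has_derivative (\<lambda>h. deriv f z * h)) (at z)" if "z \<in> S" for z
    using holomorphic_derivI[OF f S that] by (simp add: has_field_derivative_def)
  have cf': "continuous_on S (deriv f)"
    using f S holomorphic_deriv holomorphic_on_imp_continuous_on by blast
  show ?thesis
    unfolding harmonic_on_def
  proof (rule conjI[OF S], rule exI[of _ "\<lambda>z. Re (f z)"], rule exI[of _ "\<lambda>z. - Im (f z)"],
      rule exI[of _ "\<lambda>z. Re (deriv f z)"], rule exI[of _ "\<lambda>z. - Im (deriv f z)"],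
      rule exI[of _ "\<lambda>z. - Im (deriv f z)"], rule exI[of _ "\<lambda>z. - Re (deriv f z)"], intro conjI ballI)
    fix z assume z: "z \<in> S"
    show "(g has_derivative (\<lambda>h. Re (f z) * Re h + - Im (f z) * Im h)) (at z)"
      using g[OF z] by simp
    show "((\<lambda>z. Re (f z)) has_derivative (\<lambda>h. Re (deriv f z) * Re h + - Im (deriv f z) * Im h)) (at z)"
      using has_derivative_Re[OF f'[OF z]] by simp
    show "((\<lambda>z. - Im (f z)) has_derivative (\<lambda>h. - Im (deriv f z) * Re h + - Re (deriv f z) * Im h)) (at z)"
      using has_derivative_minus[OF has_derivative_Im[OF f'[OF z]]] by (simp add: algebra_simps)
  qed (use S cf' in \<open>auto intro!: continuous_intros\<close>)
qed

lemma complex_gradient_subset: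
  "complex_gradient g f S \<Longrightarrow> open T \<Longrightarrow> T \<subseteq> S \<Longrightarrow> complex_gradient g f T"
  unfolding complex_gradient_def using holomorphic_on_subset by blast

lemma complex_gradient_diff:
  assumes "complex_gradient u f S" "complex_gradient v g S"
  shows "complex_gradient (\<lambda>z. u z - v z) (\<lambda>z. f z - g z) S"
  using assms unfolding complex_gradient_def
  by (auto intro!: holomorphic_intros has_derivative_eq_rhs[OF has_derivative_diff] simp: fun_eq_iff algebra_simps)

lemma harmonic_on_scaled_diff:
  assumes u: "harmonic_on u S" and v: "harmonic_on v S"
  shows "harmonic_on (\<lambda>z. c * u z - v z) S"
proof -
  from u obtain ux uy uxx uxy uyx uyy where S: "open S"
    and 1: "continuous_on S uxx" "continuous_on S uxy" "continuous_on S uyx" "continuous_on S uyy"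
    "\<And>z. z \<in> S \<Longrightarrow> (u has_derivative (\<lambda>h. ux z * Re h + uy z * Im h)) (at z)"
    "\<And>z. z \<in> S \<Longrightarrow> (ux has_derivative (\<lambda>h. uxx z * Re h + uxy z * Im h)) (at z)"
    "\<And>z. z \<in> S \<Longrightarrow> (uy has_derivative (\<lambda>h. uyx z * Re h + uyy z * Im h)) (at z)"
    "\<And>z. z \<in> S \<Longrightarrow> uxx z + uyy z = 0"
    unfolding harmonic_on_def by blast
  from v obtain vx vy vxx vxy vyx vyy where
     2: "continuous_on S vxx" "continuous_on S vxy" "continuous_on S vyx" "continuous_on S vyy"
    "\<And>z. z \<in> S \<Longrightarrow> (v has_derivative (\<lambda>h. vx z * Re h + vy z * Im h)) (at z)"
    "\<And>z. z \<in> S \<Longrightarrow> (vx has_derivative (\<lambda>h. vxx z * Re h + vxy z * Im h)) (at z)"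
    "\<And>z. z \<in> S \<Longrightarrow> (vy has_derivative (\<lambda>h. vyx z * Re h + vyy z * Im h)) (at z)"
    "\<And>z. z \<in> S \<Longrightarrow> vxx z + vyy z = 0"
    unfolding harmonic_on_def by blast
  show ?thesis
    unfolding harmonic_on_def
  proof (rule conjI[OF S], rule exI[of _ "\<lambda>z. c * ux z - vx z"], rule exI[of _ "\<lambda>z. c * uy z - vy z"],
      rule exI[of _ "\<lambda>z. c * uxx z - vxx z"], rule exI[of _ "\<lambda>z. c * uxy z - vxy z"],
      rule exI[of _ "\<lambda>z. c * uyx z - vyx z"], rule exI[of _ "\<lambda>z. c * uyy z - vyy z"], intro conjI ballI)
    fix z assume z: "z \<in> S"
    show "((\<lambda>z. c * u z - v z) has_derivative (\<lambda>h. (c * ux z - vx z) * Re h + (c * uy z - vy z) * Im h)) (at z)"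
      by (rule has_derivative_eq_rhs[OF has_derivative_diff[OF has_derivative_mult_right[OF 1(5)[OF z]] 2(5)[OF z]]])
         (simp add: fun_eq_iff algebra_simps)
    show "((\<lambda>z. c * ux z - vx z) has_derivative (\<lambda>h. (c * uxx z - vxx z) * Re h + (c * uxy z - vxy z) * Im h)) (at z)"
      by (rule has_derivative_eq_rhs[OF has_derivative_diff[OF has_derivative_mult_right[OF 1(6)[OF z]] 2(6)[OF z]]])
         (simp add: fun_eq_iff algebra_simps)
    show "((\<lambda>z. c * uy z - vy z) has_derivative (\<lambda>h. (c * uyx z - vyx z) * Re h + (c * uyy z - vyy z) * Im h)) (at z)"
      by (rule has_derivative_eq_rhs[OF has_derivative_diff[OF has_derivative_mult_right[OF 1(7)[OF z]] 2(7)[OF z]]])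
         (simp add: fun_eq_iff algebra_simps)
    have "c * uxx z - vxx z + (c * uyy z - vyy z) = c * (uxx z + uyy z) - (vxx z + vyy z)"
      by (simp add: algebra_simps)
    then show "c * uxx z - vxx z + (c * uyy z - vyy z) = 0"
      using 1(8)[OF z] 2(8)[OF z] by simp
  qed (use 1 2 in \<open>auto intro!: continuous_intros\<close>)
qed

lemma harmonic_on_imp_continuous_on: "harmonic_on u S \<Longrightarrow> continuous_on S u"
  unfolding harmonic_on_def
  by (meson continuous_at_imp_continuous_on has_derivative_continuous)

lemma second_derivative_nonneg_at_local_min:
  fixes h :: "real \<Rightarrow> real"
  assumes h: "eventually (\<lambda>t. (h has_real_derivative h' t) (at t)) (nhds t0)"
    and h': "(h' has_real_derivative d) (at t0)"
    and le: "eventually (\<lambda>t. h t0 \<le> h t) (nhds t0)"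
  shows "0 \<le> d"
proof (rule ccontr)
  assume "\<not> 0 \<le> d"
  then obtain e where e: "e > 0" "\<And>s. 0 < s \<Longrightarrow> s < e \<Longrightarrow> h' (t0 + s) < h' t0"
    using DERIV_neg_dec_right[OF h'] by auto
  obtain r where r: "r > 0" "\<And>t. dist t t0 < r \<Longrightarrow> (h has_real_derivative h' t) (at t)"
       "\<And>t. dist t t0 < r \<Longrightarrow> h t0 \<le> h t"
    using eventually_conj[OF h le] by (auto simp: eventually_nhds_metric)
  have "h' t0 = 0"
    by (rule DERIV_local_min[OF r(2) r(1)]) (use r in \<open>auto simp: dist_real_def\<close>)
  define s where "s = min e r / 2"
  have s: "0 < s" "s < e" "s < r" using e r by (auto simp: s_def)
  obtain z where z: "t0 < z" "z < t0 + s" "h (t0 + s) - h t0 = (t0 + s - t0) * h' z"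
    using MVT2[of t0 "t0 + s" h h'] s r(2) by (auto simp: dist_real_def)
  have "h' z < 0" using e(2)[of "z - t0"] z s \<open>h' t0 = 0\<close> by auto
  then have "h (t0 + s) < h t0" using z s using mult_pos_neg[of s "h' z"] by simp
  moreover have "h t0 \<le> h (t0 + s)" using s by (intro r(3)) (auto simp: dist_real_def)
  ultimately show False by simp
qed

text \<open>At a local minimum both pure second derivatives are nonnegative, whereas the perturbed
  function has Laplacian \<open>- 2 * \<delta>\<close>. Restricting to the horizontal and the
  vertical line through \<open>z\<close> needs only the definition of harmonicity, in particular no
  mean value property.\<close>

lemma harmonic_on_no_perturbed_local_min:
  assumes D: "harmonic_on D S" and z: "z \<in> S" and \<delta>: "\<delta> > 0"
    and le: "eventually (\<lambda>w. D z - \<delta> * (Im z)\<^sup>2 \<le> D w - \<delta> * (Im w)\<^sup>2) (nhds z)"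
  shows False
proof -
  from D obtain ux uy uxx uxy uyx uyy where S: "open S"
    and D': "\<And>z. z \<in> S \<Longrightarrow> (D has_derivative (\<lambda>h. ux z * Re h + uy z * Im h)) (at z)"
    "\<And>z. z \<in> S \<Longrightarrow> (ux has_derivative (\<lambda>h. uxx z * Re h + uxy z * Im h)) (at z)"
    "\<And>z. z \<in> S \<Longrightarrow> (uy has_derivative (\<lambda>h. uyx z * Re h + uyy z * Im h)) (at z)"
    "\<And>z. z \<in> S \<Longrightarrow> uxx z + uyy z = 0"
    unfolding harmonic_on_def by blast
  have ev: "eventually P (nhds z) \<Longrightarrow> eventually (\<lambda>t. P (z + of_real t * c)) (nhds 0)" for P c
  proof -
    assume "eventually P (nhds z)"
    moreover have "((\<lambda>t::real. z + of_real t * c) \<longlongrightarrow> z) (nhds 0)"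
    proof -
      have "isCont (\<lambda>t::real. z + of_real t * c) 0" by (intro continuous_intros)
      then show ?thesis
        using tendsto_at_iff_tendsto_nhds[of "\<lambda>t::real. z + of_real t * c" 0] by (simp add: isCont_def)
    qed
    ultimately show ?thesis by (simp add: filterlim_iff)
  qed
  have evS: "eventually (\<lambda>w. w \<in> S) (nhds z)" using S z by (rule eventually_nhds_in_open)
  have line: "((\<lambda>t. U (z + of_real t * c)) has_real_derivative a * Re c + b * Im c) (at t)"
    if "(U has_derivative (\<lambda>h. a * Re h + b * Im h)) (at (z + of_real t * c))" for U :: "complex \<Rightarrow> real" and a b c t
  proof -
    have "((\<lambda>t. U (z + of_real t * c)) has_derivative (\<lambda>h. a * Re (of_real h * c) + b * Im (of_real h * c))) (at t)"
      by (rule has_derivative_compose[of "\<lambda>t. z + of_real t * c" "\<lambda>h. of_real h * c" t UNIV U, OF _ that])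
         (auto intro!: derivative_eq_intros)
    then show ?thesis
      unfolding has_field_derivative_def by (rule has_derivative_eq_rhs) (auto simp: fun_eq_iff algebra_simps)
  qed
  have "0 \<le> uxx z"
  proof (rule second_derivative_nonneg_at_local_min)
    show "\<forall>\<^sub>F t in nhds 0. ((\<lambda>t. D (z + of_real t * 1)) has_real_derivative ux (z + of_real t * 1)) (at t)"
      using ev[OF evS, of 1] by eventually_elim (use line[of D _ _ _ 1, OF D'(1)] in force)
    show "((\<lambda>t. ux (z + of_real t * 1)) has_real_derivative uxx z) (at 0)"
      using line[of ux "uxx z" "uxy z" 0 1] D'(2)[OF z] by simp
    show "\<forall>\<^sub>F t in nhds 0. D (z + of_real 0 * 1) \<le> D (z + of_real t * 1)"
      using ev[OF le, of 1] by eventually_elim simp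
  qed
  moreover have "0 \<le> uyy z - 2 * \<delta>"
  proof (rule second_derivative_nonneg_at_local_min)
    show "\<forall>\<^sub>F t in nhds 0. ((\<lambda>t. D (z + of_real t * \<i>) - \<delta> * (Im z + t)\<^sup>2) has_real_derivative uy (z + of_real t * \<i>) - 2 * \<delta> * (Im z + t)) (at t)"
      using ev[OF evS, of \<i>]
    proof eventually_elim
      case (elim t)
      show ?case
        using line[of D _ _ t \<i>, OF D'(1)[OF elim]] by (auto intro!: derivative_eq_intros)
    qed
    show "((\<lambda>t. uy (z + of_real t * \<i>) - 2 * \<delta> * (Im z + t)) has_real_derivative uyy z - 2 * \<delta>) (at 0)"
      using line[of uy "uyx z" "uyy z" 0 \<i>] D'(3)[OF z] by (auto intro!: derivative_eq_intros)
    show "\<forall>\<^sub>F t in nhds 0. D (z + of_real 0 * \<i>) - \<delta> * (Im z + 0)\<^sup>2 \<le> D (z + of_real t * \<i>) - \<delta> * (Im z + t)\<^sup>2"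
      using ev[OF le, of \<i>] by eventually_elim simp
  qed
  ultimately show False using D'(4)[OF z] \<delta> by linarith
qed

text \<open>The set \<open>K\<close> stands for the part of \<open>{D \<le> -\<eta>}\<close> that matters: all of it if that is compact, one
  period of it if \<open>D\<close> is periodic in the real direction.\<close>

lemma weak_minimum_principle:
  assumes D: "harmonic_on D S"
    and K: "\<And>\<eta>. \<eta> > 0 \<Longrightarrow> \<exists>K. compact K \<and> K \<subseteq> S \<and>
              (\<forall>z\<in>S. D z \<le> - \<eta> \<longrightarrow> (\<exists>w\<in>K. D w = D z \<and> Im w = Im z))"
    and z0: "z0 \<in> S"
  shows "0 \<le> D z0"
proof (rule ccontr)
  assume "\<not> 0 \<le> D z0"
  define \<eta> where "\<eta> = - D z0 / 2"
  have \<eta>: "\<eta> > 0" "D z0 = - 2 * \<eta>" using \<open>\<not> 0 \<le> D z0\<close> by (auto simp: \<eta>_def)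
  obtain K where K: "compact K" "K \<subseteq> S"
    "\<And>z. z \<in> S \<Longrightarrow> D z \<le> - \<eta> \<Longrightarrow> \<exists>w\<in>K. D w = D z \<and> Im w = Im z"
    using K[OF \<eta>(1)] by metis
  obtain w0 where w0: "w0 \<in> K" "D w0 = D z0" using K(3)[OF z0] \<eta> by auto
  have cD: "continuous_on S D" by (rule harmonic_on_imp_continuous_on[OF D])
  obtain B where B: "B > 0" "\<And>z. z \<in> K \<Longrightarrow> norm z \<le> B"
    using compact_imp_bounded[OF K(1)] bounded_pos by blast
  \<comment> \<open>The perturbation changes values on \<open>K\<close> by at most
    \<open>\<eta> / 2\<close>, less than the gap between \<open>D w0 = - 2 * \<eta>\<close> and
    \<open>- \<eta>\<close>. Hence the minimum point \<open>z1\<close> of \<open>H\<close> on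
    \<open>K\<close> satisfies \<open>D z1 < - \<eta>\<close> strictly, and every nearby point of
    \<open>S\<close> has a representative in \<open>K\<close>.\<close>
  define \<delta> where "\<delta> = \<eta> / (2 * B\<^sup>2)"
  have \<delta>: "\<delta> > 0" "\<delta> * B\<^sup>2 = \<eta> / 2" using \<eta> B by (auto simp: \<delta>_def)
  define H where "H = (\<lambda>w. D w - \<delta> * (Im w)\<^sup>2)"
  have "continuous_on K H" unfolding H_def
    by (intro continuous_intros continuous_on_subset[OF cD K(2)])
  then obtain z1 where z1: "z1 \<in> K" "\<And>w. w \<in> K \<Longrightarrow> H z1 \<le> H w"
    using continuous_attains_inf[OF K(1), of H] w0(1) by blast
  have "(Im z1)\<^sup>2 \<le> B\<^sup>2"
    using B(2)[OF z1(1)] abs_Im_le_cmod[of z1] by (intro abs_le_square_iff[THEN iffD1]) auto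
  then have "\<delta> * (Im z1)\<^sup>2 \<le> \<eta> / 2" using \<delta> by (metis mult_le_cancel_left_pos)
  moreover have "0 \<le> \<delta> * (Im w0)\<^sup>2" using \<delta> by simp
  ultimately have "D z1 < - \<eta>" using z1(2)[OF w0(1)] w0(2) \<eta> by (simp add: H_def)
  have z1S: "z1 \<in> S" using z1 K by auto
  have S: "open S" using D by (simp add: harmonic_on_def)
  have "(D \<longlongrightarrow> D z1) (nhds z1)"
    using cD S z1S continuous_on_eq_continuous_at isCont_def tendsto_at_iff_tendsto_nhds by blast
  then have "eventually (\<lambda>w. D w < - \<eta>) (nhds z1)"
    using \<open>D z1 < - \<eta>\<close> by (rule order_tendstoD)
  then have "eventually (\<lambda>w. H z1 \<le> H w) (nhds z1)"
    using eventually_nhds_in_open[OF S z1S]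
  proof eventually_elim
    case (elim w)
    then obtain w' where "w' \<in> K" "D w' = D w" "Im w' = Im w" using K(3)[of w] by auto
    then show ?case using z1(2)[of w'] by (simp add: H_def)
  qed
  then show False
    using harmonic_on_no_perturbed_local_min[OF D z1S \<delta>(1)] by (simp add: H_def)
qed


section \<open>Green function and logarithmic capacity\<close>

lemma filterlim_ln_norm_at_infinity:
  "filterlim (\<lambda>z::'a::real_normed_vector. ln (norm z)) at_top at_infinity"
  by (rule filterlim_compose[OF ln_at_top filterlim_norm_at_top])

text \<open>A competitor \<open>h\<close> has no known boundary values on \<open>E\<close> and the
  same growth as \<open>g\<close>. The factor \<open>1 + e\<close> makes
  \<open>(1 + e) * h - g\<close> tend to infinity at infinity; near \<open>E\<close> this difference
  is controlled from below by \<open>h > 0\<close> and the continuous decay of \<open>g\<close> to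
  0. The minimum principle applies, and then \<open>e\<close> tends to 0.\<close>

lemma is_green_at_infinityI:
  assumes E: "compact E" "outside E = - E"
    and g: "continuous_on UNIV g" "\<And>z. z \<in> E \<Longrightarrow> g z = 0"
      "harmonic_on g (- E)" "\<And>z. z \<notin> E \<Longrightarrow> 0 < g z"
    and lim: "((\<lambda>z. g z - ln (norm z)) \<longlongrightarrow> \<gamma>) at_infinity"
  shows "is_green_at_infinity E g"
  unfolding is_green_at_infinity_def
proof (intro conjI allI impI ballI)
  show "log_pole_at_infinity E g"
    using assms by (auto simp: log_pole_at_infinity_def)
  fix h z assume h: "log_pole_at_infinity E h" and z: "z \<in> outside E"
  obtain L where L: "((\<lambda>z. h z - ln (norm z)) \<longlongrightarrow> L) at_infinity"
    using h by (auto simp: log_pole_at_infinity_def)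
  have harm: "harmonic_on h (- E)" and pos: "\<And>z. z \<notin> E \<Longrightarrow> 0 < h z"
    using h E by (auto simp: log_pole_at_infinity_def)
  have le: "g z \<le> (1 + e) * h z" if e: "e > 0" for e
  proof -
    define D where "D = (\<lambda>z. (1 + e) * h z - g z)"
    have D: "harmonic_on D (- E)"
      unfolding D_def by (rule harmonic_on_scaled_diff[OF harm g(3)])
    have "filterlim (\<lambda>z. ((1 + e) * (h z - ln (norm z)) - (g z - ln (norm z))) + e * ln (norm z)) at_top at_infinity"
      by (rule filterlim_tendsto_add_at_top[OF tendsto_diff[OF tendsto_mult_left[OF L] lim]])
         (rule filterlim_tendsto_pos_mult_at_top[OF tendsto_const e filterlim_ln_norm_at_infinity])
    then have "filterlim D at_top at_infinity"
      by (rule filterlim_cong[THEN iffD1, rotated -1]) (auto simp: D_def algebra_simps)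
    then have "eventually (\<lambda>z. D z > 0) at_infinity"
      by (simp add: filterlim_at_top_dense)
    then obtain R where R: "\<And>z. R \<le> norm z \<Longrightarrow> D z > 0"
      by (auto simp: eventually_at_infinity)
    have "0 \<le> D z"
    proof (rule weak_minimum_principle[OF D])
      show "z \<in> - E" using z E by auto
      fix \<eta> :: real assume \<eta>: "\<eta> > 0"
      \<comment> \<open>A point with \<open>D z \<le> - \<eta>\<close> has
        \<open>g z \<ge> \<eta>\<close> since \<open>h\<close> is positive, and it lies in the ball
        of radius \<open>R\<close>. So the sublevel set stays in a compact part of the complement,
        whatever \<open>h\<close> does near \<open>E\<close>.\<close>
      define C where "C = {z. \<eta> \<le> g z} \<inter> cball 0 R"
      have "closed C" unfolding C_def
        by (intro closed_Int closed_cball closed_Collect_le continuous_on_const g(1))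
      moreover have "bounded C" by (rule bounded_subset[OF bounded_cball[of 0 R]]) (auto simp: C_def)
      ultimately have C: "compact C" by (simp add: compact_eq_bounded_closed)
      have CE: "C \<subseteq> - E" using g(2) \<eta> by (force simp: C_def)
      have "closed {z \<in> C. D z \<le> - \<eta>}"
        by (intro continuous_on_closed_Collect_le compact_imp_closed[OF C]
            continuous_on_const continuous_on_subset[OF harmonic_on_imp_continuous_on[OF D] CE])
      moreover have "bounded {z \<in> C. D z \<le> - \<eta>}"
        by (rule bounded_subset[OF compact_imp_bounded[OF C]]) auto
      ultimately have "compact {z \<in> C. D z \<le> - \<eta>}" by (simp add: compact_eq_bounded_closed)
      moreover have "z \<in> C" if "z \<notin> E" "D z \<le> - \<eta>" for z
      proof -
        have "norm z \<le> R" using R[of z] that \<eta> by force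
        moreover have "(1 + e) * h z > 0" using pos[OF that(1)] e by simp
        then have "\<eta> \<le> g z" using that(2) by (simp add: D_def)
        ultimately show ?thesis by (simp add: C_def)
      qed
      ultimately show "\<exists>K. compact K \<and> K \<subseteq> - E \<and> (\<forall>z\<in>- E. D z \<le> - \<eta> \<longrightarrow> (\<exists>w\<in>K. D w = D z \<and> Im w = Im z))"
        using CE by (intro exI[of _ "{z \<in> C. D z \<le> - \<eta>}"]) auto
    qed
    then show ?thesis by (simp add: D_def)
  qed
  show "g z \<le> h z"
  proof (rule field_le_epsilon)
    fix d :: real assume "d > 0"
    moreover have "h z > 0" using pos z E by auto
    ultimately have "g z \<le> (1 + d / h z) * h z" by (intro le) auto
    also have "\<dots> = h z + d" using \<open>h z > 0\<close> by (simp add: field_simps)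
    finally show "g z \<le> h z + d" .
  qed
qed

text \<open>The function chosen by \<open>SOME\<close> and the given \<open>g\<close> each lie below
  the other by minimality, so they agree off \<open>E\<close>. As \<open>E\<close> is bounded, they
  have the same limit at infinity.\<close>

lemma log_capacity_eq_exp:
  assumes E: "compact E" "outside E = - E"
    and g: "is_green_at_infinity E g"
    and lim: "((\<lambda>z. g z - ln (norm z)) \<longlongrightarrow> \<gamma>) at_infinity"
  shows "log_capacity E = exp (- \<gamma>)"
proof -
  have "is_green_at_infinity E (green_at_infinity E)"
    unfolding green_at_infinity_def by (rule someI[of "is_green_at_infinity E", OF g])
  then have eq: "green_at_infinity E z = g z" if "z \<notin> E" for z
    using g that E unfolding is_green_at_infinity_def by (simp add: order_antisym)
  obtain B where B: "\<And>z. z \<in> E \<Longrightarrow> norm z \<le> B"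
    using compact_imp_bounded[OF E(1)] by (auto simp: bounded_iff)
  have "((\<lambda>z. ln (norm z) - g z) \<longlongrightarrow> - \<gamma>) at_infinity"
    using tendsto_minus[OF lim] by simp
  moreover have "eventually (\<lambda>z. ln (norm z) - g z = ln (norm z) - green_at_infinity E z) at_infinity"
    unfolding eventually_at_infinity
  proof (intro exI[of _ "B + 1"] allI impI)
    fix z :: complex assume "B + 1 \<le> norm z"
    then have "z \<notin> E" using B[of z] by auto
    then show "ln (norm z) - g z = ln (norm z) - green_at_infinity E z" by (simp add: eq)
  qed
  ultimately have "((\<lambda>z. ln (norm z) - green_at_infinity E z) \<longlongrightarrow> - \<gamma>) at_infinity"
    by (rule Lim_transform_eventually)
  then have "Lim at_infinity (\<lambda>z. ln (norm z) - green_at_infinity E z) = - \<gamma>"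
    by (rule tendsto_Lim[OF trivial_limit_at_infinity])
  then show ?thesis using g by (auto simp: log_capacity_def)
qed

text \<open>A vertical ray from \<open>z\<close> pointing away from the real axis avoids
  \<open>E\<close> and is unbounded.\<close>

lemma outside_real_subset:
  fixes E :: "complex set"
  assumes "E \<subseteq> \<real>"
  shows "outside E = - E"
proof -
  have "z \<in> outside E" if z: "z \<notin> E" for z :: complex
  proof -
    define s where "s = (if Im z \<ge> 0 then \<i> else - \<i>)"
    define T where "T = (\<lambda>t. z + of_real t * s) ` {0..}"
    have "connected T" unfolding T_def
      by (intro connected_continuous_image continuous_intros) auto
    moreover have "T \<subseteq> - E"
    proof -
      have "z + of_real t * s \<notin> E" if "t \<ge> 0" for t
      proof (cases "t = 0")
        case False
        then have "Im (z + of_real t * s) \<noteq> 0" using that by (auto simp: s_def)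
        then show ?thesis using assms complex_is_Real_iff by blast
      qed (use z in auto)
      then show ?thesis by (auto simp: T_def)
    qed
    moreover have "z \<in> T" by (auto simp: T_def intro!: image_eqI[of _ _ 0])
    ultimately have sub: "T \<subseteq> connected_component_set (- E) z"
      using connected_component_maximal by blast
    have "\<not> bounded T"
    proof
      assume "bounded T"
      then obtain B where B: "\<And>w. w \<in> T \<Longrightarrow> norm w \<le> B" by (auto simp: bounded_iff)
      define t where "t = \<bar>B\<bar> + norm z + 1"
      have "z + of_real t * s \<in> T" unfolding T_def by (rule imageI) (simp add: t_def)
      then have "norm (z + of_real t * s) \<le> B" by (rule B)
      moreover have "norm (of_real t * s) \<le> norm (z + of_real t * s) + norm z"
        using norm_triangle_ineq4[of "z + of_real t * s" z] by simp
      moreover have "t \<ge> 0" by (simp add: t_def)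
      then have "norm (of_real t * s) = t" by (simp add: s_def norm_mult)
      ultimately show False by (simp add: t_def)
    qed
    then have "\<not> bounded (connected_component_set (- E) z)" using sub bounded_subset by blast
    then show ?thesis using z by (simp add: outside_def)
  qed
  then show ?thesis by (auto simp: outside_def)
qed

text \<open>Strong minimum principle through the open mapping theorem: near a zero, \<open>g\<close>
  is up to a constant the real part of a primitive \<open>P\<close> of \<open>f\<close>. The point
  \<open>w\<close> excludes \<open>f = 0\<close> on the connected set \<open>S\<close>, so
  \<open>P\<close> is open and \<open>g\<close> would take negative values.\<close>

lemma complex_gradient_nonneg_imp_pos:
  assumes gf: "complex_gradient g f S" and S: "connected S"
    and nonneg: "\<And>z. z \<in> S \<Longrightarrow> 0 \<le> g z"
    and nz: "w \<in> S" "f w \<noteq> 0" and z: "z \<in> S"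
  shows "0 < g z"
proof (rule ccontr)
  assume "\<not> 0 < g z"
  then have gz: "g z = 0" using nonneg[OF z] by simp
  have o: "open S" and f: "f holomorphic_on S"
    and g: "\<And>z. z \<in> S \<Longrightarrow> (g has_derivative (\<lambda>h. Re (f z * h))) (at z)"
    using gf by (auto simp: complex_gradient_def)
  obtain r where r: "r > 0" "ball z r \<subseteq> S" using o z openE by blast
  obtain P where P: "\<And>x. x \<in> ball z r \<Longrightarrow> (P has_field_derivative f x) (at x within ball z r)"
    using holomorphic_convex_primitive'[OF convex_ball open_ball holomorphic_on_subset[OF f r(2)]] by metis
  then have P': "(P has_field_derivative f x) (at x)" if "x \<in> ball z r" for x
    using that by (metis at_within_open open_ball)
  have const: "g x - Re (P x) = g z - Re (P z)" if "x \<in> ball z r" for x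
  proof (rule has_derivative_zero_unique_connected[OF open_ball connected_ball, of z r])
    fix y assume y: "y \<in> ball z r"
    have "((\<lambda>x. g x - Re (P x)) has_derivative (\<lambda>h. Re (f y * h) - Re (f y * h))) (at y)"
      by (intro has_derivative_diff g has_derivative_Re P'[OF y, unfolded has_field_derivative_def])
         (use y r in auto)
    then show "((\<lambda>x. g x - Re (P x)) has_derivative (\<lambda>h. 0)) (at y)" by simp
  qed (use that r in auto)
  have holP: "P holomorphic_on ball z r"
    using P' holomorphic_on_open[OF open_ball] by blast
  have "\<not> P constant_on ball z r"
  proof
    assume "P constant_on ball z r"
    then obtain c where c: "\<And>x. x \<in> ball z r \<Longrightarrow> P x = c" by (auto simp: constant_on_def)
    have "f x = 0" if x: "x \<in> ball z r" for x
    proof -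
      have "(P has_field_derivative 0) (at x)"
        by (rule has_field_derivative_transform_within_open[of "\<lambda>_. c", OF _ open_ball x]) (use c in auto)
      then show ?thesis using P'[OF x] DERIV_unique by blast
    qed
    then have "f w = 0"
      by (intro analytic_continuation[OF f o S r(2) z, of w])
         (use r nz in \<open>auto simp: islimpt_ball\<close>)
    then show False using nz by simp
  qed
  then have "open (P ` ball z r)"
    using open_mapping_thm[OF holP open_ball connected_ball open_ball subset_refl] by simp
  then obtain e where e: "e > 0" "ball (P z) e \<subseteq> P ` ball z r"
    using r by (metis centre_in_ball image_eqI openE)
  have "P z - of_real (e / 2) \<in> ball (P z) e" using e by (simp add: dist_norm)
  then obtain x where x: "x \<in> ball z r" "P x = P z - of_real (e / 2)" using e by (metis image_iff subset_iff)
  have "g x = - (e / 2)" using const[OF x(1)] x(2) gz by simp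
  then show False using nonneg[of x] x r e by auto
qed


section \<open>Complex gradients\<close>

lemma complex_gradient_add_const:
  "complex_gradient g f S \<Longrightarrow> complex_gradient (\<lambda>z. g z + c) f S"
  unfolding complex_gradient_def by (auto intro!: derivative_eq_intros)

lemma complex_gradient_cong:
  assumes eq: "\<And>z. z \<in> S \<Longrightarrow> u z = v z" "\<And>z. z \<in> S \<Longrightarrow> f z = g z"
  shows "complex_gradient u f S \<longleftrightarrow> complex_gradient v g S"
proof -
  have "complex_gradient v g S"
    if "complex_gradient u f S" "\<And>z. z \<in> S \<Longrightarrow> u z = v z" "\<And>z. z \<in> S \<Longrightarrow> f z = g z" for u v f g
    unfolding complex_gradient_def
  proof (intro conjI ballI)
    show S: "open S" using that by (simp add: complex_gradient_def)
    have "f holomorphic_on S" using that by (simp add: complex_gradient_def)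
    then show "g holomorphic_on S" by (rule holomorphic_transform) (use that in auto)
    fix z assume z: "z \<in> S"
    then have "(u has_derivative (\<lambda>h. Re (g z * h))) (at z)" using that by (auto simp: complex_gradient_def)
    then show "(v has_derivative (\<lambda>h. Re (g z * h))) (at z)"
      by (rule has_derivative_transform_within_open[OF _ S z]) (use that in auto)
  qed
  from this[of u f v g] this[of v g u f] show ?thesis using eq by auto
qed

lemma complex_gradient_Re:
  assumes "open S" "f holomorphic_on S" "\<And>z. z \<in> S \<Longrightarrow> (F has_field_derivative f z) (at z)"
  shows "complex_gradient (\<lambda>z. Re (F z)) f S"
  using assms unfolding complex_gradient_def has_field_derivative_def
  by (intro conjI ballI has_derivative_Re)

lemma complex_gradient_compose:
  assumes g: "complex_gradient g f S" and T: "open T" "p holomorphic_on T" "p ` T \<subseteq> S"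
  shows "complex_gradient (\<lambda>z. g (p z)) (\<lambda>z. f (p z) * deriv p z) T"
  unfolding complex_gradient_def
proof (intro conjI ballI T(1))
  have "f holomorphic_on S" using g by (simp add: complex_gradient_def)
  then show "(\<lambda>z. f (p z) * deriv p z) holomorphic_on T"
    using holomorphic_on_compose_gen[OF T(2) _ T(3), of f] holomorphic_deriv[OF T(2,1)]
    by (auto intro!: holomorphic_intros simp: o_def)
  fix z assume z: "z \<in> T"
  have "(p has_derivative (\<lambda>h. deriv p z * h)) (at z)"
    using holomorphic_derivI[OF T(2,1) z] by (simp add: has_field_derivative_def)
  moreover have "(g has_derivative (\<lambda>h. Re (f (p z) * h))) (at (p z))"
    using g T z by (auto simp: complex_gradient_def)
  ultimately have "((\<lambda>z. g (p z)) has_derivative (\<lambda>h. Re (f (p z) * (deriv p z * h)))) (at z)"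
    by (rule has_derivative_compose)
  then show "((\<lambda>z. g (p z)) has_derivative (\<lambda>h. Re (f (p z) * deriv p z * h))) (at z)"
    by (simp add: mult.assoc)
qed

lemma complex_gradient_cmult:
  "complex_gradient g f S \<Longrightarrow> complex_gradient (\<lambda>z. c * g z) (\<lambda>z. of_real c * f z) S"
  unfolding complex_gradient_def
  by (auto intro!: holomorphic_intros derivative_eq_intros simp: fun_eq_iff algebra_simps)

lemma complex_gradient_eq_imp_const_diff:
  assumes "complex_gradient u f S" "complex_gradient v f S" "connected S" "x \<in> S" "y \<in> S"
  shows "u x - v x = u y - v y"
proof (rule has_derivative_zero_unique_connected[of S "\<lambda>x. u x - v x"])
  fix z assume "z \<in> S"
  then have "((\<lambda>x. u x - v x) has_derivative (\<lambda>h. Re (f z * h) - Re (f z * h))) (at z)"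
    using assms(1,2) unfolding complex_gradient_def by (intro has_derivative_diff) blast+
  then show "((\<lambda>x. u x - v x) has_derivative (\<lambda>h. 0)) (at z)" by simp
qed (use assms in \<open>auto simp: complex_gradient_def\<close>)

lemma complex_gradient_ln_norm: "complex_gradient (\<lambda>z. ln (norm z)) (\<lambda>z. 1 / z) (- {0})"
  unfolding complex_gradient_def
proof (intro conjI ballI)
  fix w :: complex assume w: "w \<in> - {0}"
  have "((\<lambda>w. ln (norm w)) has_derivative (\<lambda>h. inverse (norm w) * (h \<bullet> sgn w))) (at w)"
    using w has_derivative_norm[of w] by (auto intro!: derivative_eq_intros)
  also have "(\<lambda>h. inverse (norm w) * (h \<bullet> sgn w)) = (\<lambda>h. Re (1 / w * h))"
  proof
    fix h
    have "Re (1 / w * h) = (h \<bullet> w) / (norm w)\<^sup>2"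
      by (simp add: Re_divide inner_complex_def cmod_power2 algebra_simps)
    then show "inverse (norm w) * (h \<bullet> sgn w) = Re (1 / w * h)"
      by (simp add: sgn_div_norm divide_simps power2_eq_square)
  qed
  finally show "((\<lambda>w. ln (norm w)) has_derivative (\<lambda>h. Re (1 / w * h))) (at w)" .
qed (auto intro!: holomorphic_intros)

lemma complex_gradient_ln_norm_compose:
  assumes "open T" "p holomorphic_on T" "\<And>z. z \<in> T \<Longrightarrow> p z \<noteq> 0"
  shows "complex_gradient (\<lambda>z. ln (norm (p z))) (\<lambda>z. deriv p z / p z) T"
proof -
  have "p ` T \<subseteq> - {0}" using assms(3) by auto
  from complex_gradient_compose[OF complex_gradient_ln_norm assms(1,2) this] show ?thesis by simp
qed

text \<open>In the coordinate \<open>w = 1 / z\<close> the function \<open>g - ln \<bar>z\<bar>\<close> has gradient \<open>(1 - z * f z) / w\<close>,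
  whose singularity at \<open>w = 0\<close> is removable.\<close>

lemma log_pole_expansion:
  assumes gf: "complex_gradient g f {z. R < norm z}"
    and lim: "((\<lambda>z. z * f z) \<longlongrightarrow> 1) at_infinity"
  obtains \<gamma> C M where "((\<lambda>z. g z - ln (norm z)) \<longlongrightarrow> \<gamma>) at_infinity"
    "\<And>z. M \<le> norm z \<Longrightarrow> norm (z * f z - 1) \<le> C / norm z"
proof -
  define r where "r = 1 / (\<bar>R\<bar> + 1)"
  have r: "r > 0" by (simp add: r_def)
  have inv: "R < norm (1 / w)" if "w \<in> ball 0 r - {0}" for w :: complex
  proof -
    have "0 < norm w" "norm w < r" using that by (auto simp: dist_norm)
    then have "1 / norm w > 1 / r" using r by (intro divide_strict_left_mono) auto
    then show ?thesis by (simp add: r_def norm_divide)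
  qed
  have f: "f holomorphic_on {z. R < norm z}" using gf by (simp add: complex_gradient_def)
  define F where "F = (\<lambda>w. if w = 0 then 1 else f (1 / w) / w)"
  have F0: "F holomorphic_on ball 0 r - {0}"
  proof (rule holomorphic_transform)
    have "(\<lambda>w. f (1 / w)) holomorphic_on ball 0 r - {0}"
      by (rule holomorphic_on_compose_gen[OF _ f, of "\<lambda>w. 1 / w", unfolded o_def])
         (use inv in \<open>auto intro!: holomorphic_intros\<close>)
    then show "(\<lambda>w. f (1 / w) / w) holomorphic_on ball 0 r - {0}"
      by (auto intro!: holomorphic_intros)
  qed (auto simp: F_def)
  have F: "F holomorphic_on ball 0 r"
  proof (rule no_isolated_singularity'[of "{0}"])
    have "((\<lambda>w. inverse w * f (inverse w)) \<longlongrightarrow> 1) (at 0)"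
      using filterlim_compose[OF lim filterlim_inverse_at_infinity] .
    then have "(F \<longlongrightarrow> 1) (at 0)"
      by (rule Lim_transform_eventually) (auto simp: eventually_at_filter F_def field_simps)
    then show "(F \<longlongrightarrow> F z) (at z within ball 0 r)" if "z \<in> {0}" for z
      using that by (auto simp: F_def intro: tendsto_within_subset)
  qed (use F0 in auto)
  \<comment> \<open>\<open>k\<close> is the difference quotient of \<open>F\<close> at 0. It has a
    primitive across 0, which yields the limit, and it is bounded near 0, which yields the rate:
    \<open>z * f z - 1 = k (1 / z) / z\<close>.\<close>
  define k where "k = (\<lambda>z. if z = 0 then deriv F 0 else (F z - F 0) / (z - 0))"
  have k: "k holomorphic_on ball 0 r"
    unfolding k_def by (rule pole_lemma_open[OF F open_ball])
  obtain K where K: "\<And>x. x \<in> ball 0 r \<Longrightarrow> (K has_field_derivative k x) (at x within ball 0 r)"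
    using holomorphic_convex_primitive'[OF convex_ball open_ball k] by metis
  have K': "(K has_field_derivative k x) (at x)" if "x \<in> ball 0 r" for x
    using K[OF that] that by (metis at_within_open open_ball)
  have gr: "complex_gradient (\<lambda>w. - Re (K w)) (\<lambda>w. - k w) (ball 0 r - {0})"
  proof (rule complex_gradient_Re[of _ _ "\<lambda>w. - K w", unfolded uminus_complex.sel])
    show "(\<lambda>w. - k w) holomorphic_on ball 0 r - {0}"
      by (intro holomorphic_intros holomorphic_on_subset[OF k]) auto
    show "((\<lambda>w. - K w) has_field_derivative - k z) (at z)" if "z \<in> ball 0 r - {0}" for z
      using K'[of z] that by (intro DERIV_minus) auto
  qed auto
  have gr': "complex_gradient (\<lambda>w. g (1 / w) + ln (norm w)) (\<lambda>w. - k w) (ball 0 r - {0})"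
    unfolding complex_gradient_def
  proof (intro conjI ballI)
    show "(\<lambda>w. - k w) holomorphic_on ball 0 r - {0}"
      by (intro holomorphic_intros holomorphic_on_subset[OF k]) auto
    fix w :: complex assume w: "w \<in> ball 0 r - {0}"
    have "((\<lambda>w. 1 / w) has_derivative (\<lambda>h. - (1 / w\<^sup>2) * h)) (at w)"
      using w by (auto intro!: derivative_eq_intros simp: power2_eq_square)
    moreover have "(g has_derivative (\<lambda>h. Re (f (1 / w) * h))) (at (1 / w))"
      using gf inv[OF w] by (auto simp: complex_gradient_def)
    ultimately have 1: "((\<lambda>w. g (1 / w)) has_derivative (\<lambda>h. Re (f (1 / w) * (- (1 / w\<^sup>2) * h)))) (at w)"
      by (rule has_derivative_compose)
    have 2: "((\<lambda>w. ln (norm w)) has_derivative (\<lambda>h. Re (1 / w * h))) (at w)"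
      using complex_gradient_ln_norm w by (auto simp: complex_gradient_def)
    have "((\<lambda>w. g (1 / w) + ln (norm w)) has_derivative
        (\<lambda>h. Re (f (1 / w) * (- (1 / w\<^sup>2) * h)) + Re (1 / w * h))) (at w)"
      by (intro has_derivative_add 1 2)
    also have "(\<lambda>h. Re (f (1 / w) * (- (1 / w\<^sup>2) * h)) + Re (1 / w * h)) = (\<lambda>h. Re (- k w * h))"
    proof
      fix h
      have "f (1 / w) * (- (1 / w\<^sup>2) * h) + 1 / w * h = - k w * h"
        using w by (simp add: k_def F_def field_simps power2_eq_square)
      then show "Re (f (1 / w) * (- (1 / w\<^sup>2) * h)) + Re (1 / w * h) = Re (- k w * h)"
        by (metis plus_complex.sel(1))
    qed
    finally show "((\<lambda>w. g (1 / w) + ln (norm w)) has_derivative (\<lambda>h. Re (- k w * h))) (at w)" .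
  qed (auto)
  have conn: "connected (ball (0::complex) r - {0})"
    by (rule connected_punctured_ball) simp
  define w0 where "w0 = (of_real (r / 2) :: complex)"
  define \<gamma> where "\<gamma> = g (1 / w0) + ln (norm w0) + Re (K w0) - Re (K 0)"
  have w0: "w0 \<in> ball 0 r - {0}" using r by (simp add: w0_def)
  have eq: "g (1 / w) + ln (norm w) = \<gamma> + Re (K 0) - Re (K w)" if "w \<in> ball 0 r - {0}" for w
    using complex_gradient_eq_imp_const_diff[OF gr' gr conn that w0] by (simp add: \<gamma>_def)
  have "((\<lambda>z. K (inverse z)) \<longlongrightarrow> K 0) at_infinity"
    using isCont_tendsto_compose[OF DERIV_isCont[OF K'[of 0]] tendsto_inverse_0] r by simp
  then have "((\<lambda>z. \<gamma> + Re (K 0) - Re (K (inverse z))) \<longlongrightarrow> \<gamma> + Re (K 0) - Re (K 0)) at_infinity"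
    by (intro tendsto_intros)
  then have 1: "((\<lambda>z. g z - ln (norm z)) \<longlongrightarrow> \<gamma>) at_infinity"
  proof (rule Lim_transform_eventually[rotated, OF _ tendsto_eq_rhs, rotated])
    show "\<forall>\<^sub>F z in at_infinity. \<gamma> + Re (K 0) - Re (K (inverse z)) = g z - ln (norm z)"
      unfolding eventually_at_infinity
    proof (intro exI[of _ "1 / r + 1"] allI impI)
      fix z :: complex assume z: "1 / r + 1 \<le> norm z"
      moreover have "1 / r > 0" using r by simp
      ultimately have nz: "norm z > 1 / r" "norm z > 0" by linarith+
      then have "1 / norm z < r" using r by (simp add: field_simps)
      then have "inverse z \<in> ball 0 r - {0}" using nz by (auto simp: norm_inverse inverse_eq_divide[of "norm z"])
      from eq[OF this] show "\<gamma> + Re (K 0) - Re (K (inverse z)) = g z - ln (norm z)"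
        using nz by (simp add: norm_inverse ln_inverse divide_inverse)
    qed
  qed auto
  have "compact (k ` cball 0 (r / 2))"
    using r by (intro compact_continuous_image continuous_on_subset[OF holomorphic_on_imp_continuous_on[OF k]]) auto
  then obtain C where "\<forall>x\<in>k ` cball 0 (r / 2). norm x \<le> C"
    using compact_imp_bounded bounded_iff by metis
  then have C: "\<And>w. w \<in> cball 0 (r / 2) \<Longrightarrow> norm (k w) \<le> C" by blast
  have "norm (z * f z - 1) \<le> C / norm z" if z: "2 / r \<le> norm z" for z
  proof -
    have z0: "norm z > 0" using z r by (auto intro: less_le_trans[of _ "2 / r"])
    have "inverse z \<in> cball 0 (r / 2)" using z z0 r by (simp add: norm_inverse pos_divide_le_eq inverse_eq_divide[of "norm z"] mult.commute)
    from C[OF this] have "norm (k (inverse z)) \<le> C" .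
    moreover have "1 / inverse z = z" "f z / inverse z = z * f z" by (simp_all add: divide_inverse)
    then have "z * f z - 1 = k (inverse z) / z" using z0 by (simp add: k_def F_def)
    ultimately show ?thesis using z0 by (simp add: norm_divide divide_right_mono)
  qed
  with 1 show ?thesis using that by blast
qed


section \<open>The Green function of a segment\<close>

definition real_segment :: "real \<Rightarrow> real \<Rightarrow> complex set" where
  "real_segment a b = complex_of_real ` {a..b}"

text \<open>The branch of the square root of \<open>(z - a) * (z - b)\<close> off \<open>[a, b]\<close> that behaves like \<open>z\<close> at infinity;
  on \<open>(a, b)\<close> the principal branch picks its boundary values from the upper half-plane.\<close>

definition segment_root :: "real \<Rightarrow> real \<Rightarrow> complex \<Rightarrow> complex" where
  "segment_root a b z = (z - of_real a) * csqrt ((z - of_real b) / (z - of_real a))"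

section \<open>Square root with branch points at the ends of a segment\<close>

lemma real_segment_endpoints: "a \<le> b \<Longrightarrow> of_real a \<in> real_segment a b" "a \<le> b \<Longrightarrow> of_real b \<in> real_segment a b"
  by (auto simp: real_segment_def)

lemma compact_real_segment: "compact (real_segment a b)"
  unfolding real_segment_def by (intro compact_continuous_image continuous_intros) auto

text \<open>Solving \<open>(z - b) / (z - a) = - t\<close> with \<open>t \<ge> 0\<close> gives the
  convex combination \<open>(b + t * a) / (1 + t)\<close>. Hence off the segment the principal
  square root is never evaluated on its cut.\<close>

lemma real_segment_quotient_notin:
  assumes "a < b" "z \<notin> real_segment a b"
  shows "(z - of_real b) / (z - of_real a) \<notin> \<real>\<^sub>\<le>\<^sub>0"
proof
  assume "(z - of_real b) / (z - of_real a) \<in> \<real>\<^sub>\<le>\<^sub>0"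
  then obtain t where t: "(z - of_real b) / (z - of_real a) = of_real (- t)" "t \<ge> 0"
    by (metis nonpos_Reals_cases neg_0_le_iff_le minus_minus)
  have "z \<noteq> of_real a" using real_segment_endpoints[of a b] assms by auto
  then have "z - of_real b = of_real (- t) * (z - of_real a)" using t by (simp add: field_simps)
  then have "z * of_real (1 + t) = of_real (b + t * a)" by (simp add: algebra_simps)
  then have "z = of_real ((b + t * a) / (1 + t))" using t(2)
    by (metis add_nonneg_eq_0_iff less_eq_real_def nonzero_mult_div_cancel_right of_real_divide of_real_eq_0_iff zero_neq_one zero_less_one)
  moreover have "a \<le> (b + t * a) / (1 + t)" "(b + t * a) / (1 + t) \<le> b"
    using t assms mult_left_mono[of a b t] by (auto simp: field_simps)
  ultimately have "z \<in> real_segment a b"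
    unfolding real_segment_def by (metis atLeastAtMost_iff imageI)
  then show False using assms by simp
qed

lemma segment_root_holomorphic:
  assumes "a < b" shows "segment_root a b holomorphic_on (- real_segment a b)"
  unfolding segment_root_def
  by (intro holomorphic_intros real_segment_quotient_notin[OF assms])
     (use real_segment_endpoints[of a b] assms in auto)

lemma norm_segment_root: "norm (segment_root a b z) ^ 2 = norm (z - of_real a) * norm (z - of_real b)"
  by (cases "z = of_real a")
     (simp_all add: segment_root_def norm_mult norm_divide power_mult_distrib, simp add: power2_eq_square)

lemma segment_root_eq_0_iff: "segment_root a b z = 0 \<longleftrightarrow> z = of_real a \<or> z = of_real b"
  by (auto simp: segment_root_def)

lemma segment_root_cnj:
  assumes "a < b" "z \<notin> real_segment a b"
  shows "segment_root a b (cnj z) = cnj (segment_root a b z)"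
  using cnj_csqrt[OF real_segment_quotient_notin[OF assms]] by (simp add: segment_root_def)

lemma segment_root_real_outside:
  assumes "x < a \<or> b < x" "a < b"
  shows "Im (segment_root a b (of_real x)) = 0"
proof -
  have "(x - b) / (x - a) \<ge> 0" using assms by (auto simp: divide_simps)
  then have "csqrt (of_real ((x - b) / (x - a))) = of_real (sqrt ((x - b) / (x - a)))"
    by (simp only: of_real_sqrt)
  then show ?thesis by (simp add: segment_root_def)
qed

lemma segment_root_real_inside:
  assumes "a < x" "x < b"
  shows "Re (segment_root a b (of_real x)) = 0"
proof -
  have "(x - b) / (x - a) \<le> 0" using assms by (auto simp: divide_simps)
  then have "csqrt (of_real ((x - b) / (x - a))) = \<i> * sqrt \<bar>(x - b) / (x - a)\<bar>"
    by (subst csqrt_of_real_nonpos) auto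
  then have "segment_root a b (of_real x) = \<i> * of_real ((x - a) * sqrt \<bar>(x - b) / (x - a)\<bar>)"
    by (simp add: segment_root_def)
  then show ?thesis by simp
qed

text \<open>The sign factor in the definition of \<open>csqrt\<close> is 1 on the closed upper
  half-plane, so its values on the negative axis are the limits from above.\<close>

lemma continuous_on_csqrt_upper: "continuous_on {z. 0 \<le> Im z} csqrt"
proof -
  have "continuous_on {z. 0 \<le> Im z} (\<lambda>z. Complex (sqrt ((cmod z + Re z) / 2)) (sqrt ((cmod z - Re z) / 2)))"
    by (intro continuous_intros) auto
  then show ?thesis
    by (rule continuous_on_eq) (auto simp: complex_eq_iff sgn_if)
qed

text \<open>For \<open>a < b\<close> the quotient under the root maps the closed upper half-plane
  without \<open>a\<close> into itself, where \<open>csqrt\<close> is continuous.\<close>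

lemma continuous_on_segment_root_upper:
  assumes "a < b"
  shows "continuous_on ({z. 0 \<le> Im z} - {of_real a}) (segment_root a b)"
proof -
  have "continuous_on ({z. 0 \<le> Im z} - {of_real a}) (\<lambda>z. csqrt ((z - of_real b) / (z - of_real a)))"
  proof (rule continuous_on_compose2[OF continuous_on_csqrt_upper])
    show "(\<lambda>z. (z - of_real b) / (z - of_real a)) ` ({z. 0 \<le> Im z} - {of_real a}) \<subseteq> {z. 0 \<le> Im z}"
    proof clarify
      fix z :: complex assume z: "0 \<le> Im z" "z \<noteq> of_real a"
      have "(z - of_real b) / (z - of_real a) = 1 - of_real (b - a) / (z - of_real a)"
        using z by (simp add: field_simps)
      also have "Im \<dots> = (b - a) * Im z / ((Re z - a)\<^sup>2 + (Im z)\<^sup>2)"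
        by (simp add: Im_divide)
      also have "\<dots> \<ge> 0" using assms z by simp
      finally show "0 \<le> Im ((z - of_real b) / (z - of_real a))" .
    qed
  qed (auto intro!: continuous_intros)
  then show ?thesis unfolding segment_root_def by (intro continuous_intros)
qed

lemma tendsto_quotient_at_infinity:
  "((\<lambda>z::complex. (z - b) / (z - a)) \<longlongrightarrow> 1) at_infinity"
proof -
  have "((\<lambda>z. (1 - b * inverse z) / (1 - a * inverse z)) \<longlongrightarrow> (1 - b * 0) / (1 - a * 0)) at_infinity"
    by (intro tendsto_intros tendsto_inverse_0) auto
  then have "((\<lambda>z. (1 - b * inverse z) / (1 - a * inverse z)) \<longlongrightarrow> 1) at_infinity" by simp
  then show ?thesis
  proof (rule Lim_transform_eventually)
    show "\<forall>\<^sub>F z in at_infinity. (1 - b * inverse z) / (1 - a * inverse z) = (z - b) / (z - a)"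
      unfolding eventually_at_infinity
    proof (intro exI[of _ 1] allI impI)
      fix z :: complex assume "1 \<le> norm z"
      then have "z \<noteq> 0" by auto
      then have "1 - b * inverse z = (z - b) / z" "1 - a * inverse z = (z - a) / z"
        by (auto simp: field_simps)
      then show "(1 - b * inverse z) / (1 - a * inverse z) = (z - b) / (z - a)"
        using \<open>z \<noteq> 0\<close> by simp
    qed
  qed
qed

lemma tendsto_csqrt_quotient_at_infinity:
  "((\<lambda>z::complex. csqrt ((z - b) / (z - a))) \<longlongrightarrow> 1) at_infinity"
  using isCont_tendsto_compose[OF continuous_at_csqrt[of 1] tendsto_quotient_at_infinity] by simp

lemma tendsto_segment_root_at_infinity:
  "((\<lambda>z. z / segment_root a b z) \<longlongrightarrow> 1) at_infinity"
  using tendsto_divide[OF tendsto_quotient_at_infinity[of 0 "of_real a"] tendsto_csqrt_quotient_at_infinity[of "of_real b" "of_real a"]]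
  by (simp add: segment_root_def)

text \<open>With the Joukowski variable \<open>w\<close>, given by
  \<open>z = (a + b) / 2 + (b - a) / 4 * (w + 1 / w)\<close> and
  \<open>\<bar>w\<bar> \<ge> 1\<close>, the value is \<open>ln \<bar>w\<bar>\<close>; the level
  lines are ellipses with foci \<open>a\<close> and \<open>b\<close>. In this form continuity across
  the segment is immediate.\<close>

definition segment_green :: "real \<Rightarrow> real \<Rightarrow> complex \<Rightarrow> real" where
  "segment_green a b z = arcosh ((norm (z - of_real a) + norm (z - of_real b)) / (b - a))"

context
  fixes a b :: real
  assumes ab: "a < b"
begin

lemma segment_green_arg_ge_1: "1 \<le> (norm (z - of_real a :: complex) + norm (z - of_real b)) / (b - a)" for z
proof -
  have "b - a = norm (of_real b - of_real a :: complex)" using ab by (simp flip: of_real_diff)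
  also have "\<dots> \<le> norm (z - of_real a) + norm (z - of_real b)"
    using norm_triangle_ineq4[of "z - of_real a" "z - of_real b"] by simp
  finally show ?thesis using ab by simp
qed

lemma continuous_on_segment_green: "continuous_on UNIV (segment_green a b)"
  unfolding segment_green_def
  by (rule continuous_on_compose2[OF continuous_on_arcosh[OF order.refl]])
     (use ab segment_green_arg_ge_1 in \<open>auto intro!: continuous_intros\<close>)

lemma segment_green_eq_0:
  assumes "z \<in> real_segment a b" shows "segment_green a b z = 0"
proof -
  obtain x where "z = of_real x" "a \<le> x" "x \<le> b" using assms by (auto simp: real_segment_def)
  then have "norm (z - of_real a) + norm (z - of_real b) = b - a"
    by (simp flip: of_real_diff)
  then show ?thesis using ab by (simp add: segment_green_def)
qed

text \<open>The Joukowski variable is \<open>(1 + m) / (1 - m)\<close>. The parallelogram law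
  computes \<open>cosh\<close> of the logarithm of its modulus, and \<open>0 < Re m\<close> selects
  the branch with modulus at least 1.\<close>

lemma segment_green_eq:
  assumes z: "z \<notin> real_segment a b"
  defines "m \<equiv> csqrt ((z - of_real b) / (z - of_real a))"
  shows "0 < Re m" "1 + m \<noteq> 0" "1 - m \<noteq> 0" "1 - m\<^sup>2 = of_real (b - a) / (z - of_real a)"
    "segment_green a b z = ln (norm (1 + m)) - ln (norm (1 - m))"
proof -
  have za: "z \<noteq> of_real a" "z \<noteq> of_real b" using z real_segment_endpoints[of a b] ab by auto
  have q: "(z - of_real b) / (z - of_real a) \<notin> \<real>\<^sub>\<le>\<^sub>0" by (rule real_segment_quotient_notin[OF ab z])
  show Re: "0 < Re m"
  proof (rule ccontr)
    assume "\<not> 0 < Re m"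
    then have "Re m = 0" using Re_csqrt by (simp add: m_def order_antisym)
    then have "m = \<i> * of_real (Im m)" by (simp add: complex_eq_iff)
    then have "m\<^sup>2 = (\<i> * of_real (Im m))\<^sup>2" by simp
    then have "m\<^sup>2 = of_real (- ((Im m)\<^sup>2))" by (simp add: power_mult_distrib)
    moreover have "of_real (- ((Im m)\<^sup>2)) \<in> (\<real>\<^sub>\<le>\<^sub>0 :: complex set)"
      by (simp only: nonpos_Reals_of_real_iff) simp
    ultimately show False using q by (simp add: m_def)
  qed
  have m2: "m\<^sup>2 = (z - of_real b) / (z - of_real a)" by (simp add: m_def)
  show m2': "1 - m\<^sup>2 = of_real (b - a) / (z - of_real a)"
    using za by (simp add: m2 field_simps)
  then have "1 - m\<^sup>2 \<noteq> 0" using za ab by simp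
  moreover have "1 - m\<^sup>2 = (1 - m) * (1 + m)" by (simp add: algebra_simps power2_eq_square)
  ultimately have "(1 - m) * (1 + m) \<noteq> 0" by simp
  then show nz: "1 + m \<noteq> 0" "1 - m \<noteq> 0" by auto
  have sq: "(norm (1 + m))\<^sup>2 = 1 + 2 * Re m + (norm m)\<^sup>2" "(norm (1 - m))\<^sup>2 = 1 - 2 * Re m + (norm m)\<^sup>2"
    unfolding cmod_power2 by (auto simp: power2_eq_square algebra_simps)
  then have "(norm (1 - m))\<^sup>2 \<le> (norm (1 + m))\<^sup>2" using Re by linarith
  then have le: "norm (1 - m) \<le> norm (1 + m)" by (rule power2_le_imp_le) simp
  define r where "r = norm (1 + m) / norm (1 - m)"
  have r: "r \<ge> 1" "r > 0" using le nz by (auto simp: r_def)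
  have "cosh (ln r) = ((norm (1 + m))\<^sup>2 + (norm (1 - m))\<^sup>2) / (2 * (norm (1 - m) * norm (1 + m)))"
    unfolding cosh_ln_real[OF r(2)] using nz by (simp add: r_def field_simps power2_eq_square)
  also have "norm (1 - m) * norm (1 + m) = norm (1 - m\<^sup>2)"
    by (simp flip: norm_mult add: algebra_simps power2_eq_square)
  also have "norm (1 - m\<^sup>2) = (b - a) / norm (z - of_real a)"
    unfolding m2' norm_divide norm_of_real using ab by simp
  also have "(norm (1 + m))\<^sup>2 + (norm (1 - m))\<^sup>2 = 2 + 2 * (norm m)\<^sup>2" using sq by simp
  also have "(norm m)\<^sup>2 = norm (z - of_real b) / norm (z - of_real a)"
    using m2 by (metis norm_divide norm_power)
  finally have "cosh (ln r) = (norm (z - of_real a) + norm (z - of_real b)) / (b - a)"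
  proof -
    assume c: "cosh (ln r) = (2 + 2 * (norm (z - of_real b) / norm (z - of_real a))) / (2 * ((b - a) / norm (z - of_real a)))"
    have "(2 + 2 * (y / x)) / (2 * (L / x)) = (x + y) / L" if "x > 0" "L > 0" for x y L :: real
      using that by (simp add: field_simps)
    from this[of "norm (z - of_real a)" "b - a"] show ?thesis unfolding c using za ab by simp
  qed
  then have "segment_green a b z = ln r"
    using arcosh_cosh_real[of "ln r"] r by (simp add: segment_green_def)
  also have "\<dots> = ln (norm (1 + m)) - ln (norm (1 - m))"
    using nz by (simp add: r_def ln_div)
  finally show "segment_green a b z = ln (norm (1 + m)) - ln (norm (1 - m))" .
qed

lemma segment_green_pos:
  assumes "z \<notin> real_segment a b" shows "0 < segment_green a b z"
proof -
  define m where "m = csqrt ((z - of_real b) / (z - of_real a))"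
  note * = segment_green_eq[OF assms, folded m_def]
  have "(norm (1 - m))\<^sup>2 < (norm (1 + m))\<^sup>2"
    using *(1) unfolding cmod_power2 by (simp add: power2_eq_square algebra_simps)
  then have "norm (1 - m) < norm (1 + m)" by (rule power2_less_imp_less) simp
  then show ?thesis using * by simp
qed

text \<open>The logarithmic derivative is
  \<open>m' / (1 + m) + m' / (1 - m) = 2 * m' / (1 - m^2)\<close>, and
  \<open>1 - m^2 = (b - a) / (z - a)\<close> cancels against the derivative of the quotient under
  the root.\<close>

lemma complex_gradient_segment_green:
  "complex_gradient (segment_green a b) (\<lambda>z. 1 / segment_root a b z) (- real_segment a b)"
proof -
  let ?S = "- real_segment a b"
  define m where "m = (\<lambda>z. csqrt ((z - of_real b) / (z - of_real a)))"
  have S: "open ?S" using compact_imp_closed[OF compact_real_segment] by auto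
  have holm: "m holomorphic_on ?S"
    unfolding m_def by (intro holomorphic_intros real_segment_quotient_notin[OF ab])
      (use real_segment_endpoints[of a b] ab in auto)
  have A: "complex_gradient (\<lambda>z. ln (norm (1 + m z)) - ln (norm (1 - m z)))
      (\<lambda>z. deriv (\<lambda>z. 1 + m z) z / (1 + m z) - deriv (\<lambda>z. 1 - m z) z / (1 - m z)) ?S"
    by (intro complex_gradient_diff complex_gradient_ln_norm_compose S)
       (use segment_green_eq(2,3) holm in \<open>auto intro!: holomorphic_intros simp: m_def\<close>)
  have B: "deriv (\<lambda>z. 1 + m z) z / (1 + m z) - deriv (\<lambda>z. 1 - m z) z / (1 - m z) = 1 / segment_root a b z"
    if z: "z \<in> ?S" for z
  proof -
    have za: "z \<noteq> of_real a" "z \<noteq> of_real b" using z real_segment_endpoints[of a b] ab by auto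
    have mz: "csqrt ((z - of_real b) / (z - of_real a)) = m z" by (simp add: m_def)
    have nz: "z \<notin> real_segment a b" using z by simp
    note * = segment_green_eq[OF nz, unfolded mz]
    have m0: "m z \<noteq> 0" using za by (auto simp: m_def)
    have "(csqrt has_field_derivative inverse (2 * m z)) (at ((z - of_real b) / (z - of_real a)))"
      using has_field_derivative_csqrt[OF real_segment_quotient_notin[OF ab nz]] mz by argo
    moreover have "((\<lambda>z. (z - of_real b) / (z - of_real a)) has_field_derivative of_real (b - a) / (z - of_real a)\<^sup>2) (at z)"
      using za by (auto intro!: derivative_eq_intros simp: divide_simps power2_eq_square)
    ultimately have chain: "(m has_field_derivative inverse (2 * m z) * (of_real (b - a) / (z - of_real a)\<^sup>2)) (at z)"
      unfolding m_def by (rule DERIV_chain2)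
    define d where "d = inverse (2 * m z) * (of_real (b - a) / (z - of_real a)\<^sup>2)"
    have d: "(m has_field_derivative d) (at z)" unfolding d_def by (rule chain)
    have "deriv (\<lambda>z. 1 + m z) z = d" "deriv (\<lambda>z. 1 - m z) z = - d"
      using d by (auto intro!: DERIV_imp_deriv derivative_eq_intros)
    moreover have "d / (1 + M) - (- d) / (1 - M) = 2 * d / (1 - M\<^sup>2)"
      if "1 + M \<noteq> 0" "1 - M \<noteq> 0" for M :: complex
    proof -
      have "1 - M\<^sup>2 = (1 + M) * (1 - M)" by (simp add: algebra_simps power2_eq_square)
      then show ?thesis using that by (simp add: divide_simps) (simp add: algebra_simps)
    qed
    ultimately have "deriv (\<lambda>z. 1 + m z) z / (1 + m z) - deriv (\<lambda>z. 1 - m z) z / (1 - m z)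
        = 2 * d / (1 - (m z)\<^sup>2)"
      using *(2,3) by simp
    also have "\<dots> = 2 * (inverse (2 * m z) * (of_real (b - a) / (z - of_real a)\<^sup>2)) / (of_real (b - a) / (z - of_real a))"
      unfolding *(4) d_def ..
    also have "\<dots> = 1 / ((z - of_real a) * m z)"
    proof -
      have "2 * (inverse (2 * M) * (L / A\<^sup>2)) / (L / A) = 1 / (A * M)" if "L \<noteq> 0" "A \<noteq> 0" for L A M :: complex
        using that by (simp add: divide_simps power2_eq_square)
      then show ?thesis using za ab by (metis eq_iff_diff_eq_0 less_irrefl of_real_eq_0_iff)
    qed
    also have "\<dots> = 1 / segment_root a b z" by (simp add: segment_root_def m_def)
    finally show ?thesis .
  qed
  have C: "ln (norm (1 + m z)) - ln (norm (1 - m z)) = segment_green a b z" if "z \<in> ?S" for z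
    using segment_green_eq(5)[of z] that by (simp add: m_def)
  show ?thesis by (rule iffD1[OF complex_gradient_cong[OF C B] A])
qed

text \<open>Both \<open>ln (norm (1 - m z))\<close> and \<open>ln (norm z)\<close> diverge. The
  identity for \<open>1 - m^2\<close> replaces the former by
  \<open>ln (b - a) - ln (norm (z - a)) - ln (norm (1 + m z))\<close>, after which everything
  converges as \<open>m\<close> tends to 1. The constant expresses that a segment has capacity
  \<open>(b - a) / 4\<close>.\<close>

lemma segment_green_at_infinity:
  "((\<lambda>z. segment_green a b z - ln (norm z)) \<longlongrightarrow> ln (4 / (b - a))) at_infinity"
proof -
  define m where "m = (\<lambda>z. csqrt ((z - of_real b) / (z - of_real a)))"
  have "(m \<longlongrightarrow> 1) at_infinity" unfolding m_def by (rule tendsto_csqrt_quotient_at_infinity)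
  then have "((\<lambda>z. 2 * ln (norm (1 + m z)) + ln (norm ((z - of_real a) / (z - 0))) - ln (b - a)) \<longlongrightarrow>
      2 * ln (norm (1 + 1 :: complex)) + ln (norm (1 :: complex)) - ln (b - a)) at_infinity"
    by (intro tendsto_intros tendsto_quotient_at_infinity) auto
  also have "2 * ln (norm (1 + 1 :: complex)) + ln (norm (1 :: complex)) - ln (b - a) = ln (4 / (b - a))"
    using ab ln_realpow[of 2 2] by (simp add: ln_div)
  finally show ?thesis
  proof (rule Lim_transform_eventually)
    obtain B where B: "\<And>z. z \<in> real_segment a b \<Longrightarrow> norm z \<le> B"
      using compact_imp_bounded[OF compact_real_segment, of a b] by (auto simp: bounded_iff)
    show "\<forall>\<^sub>F z in at_infinity. 2 * ln (norm (1 + m z)) + ln (norm ((z - of_real a) / (z - 0))) - ln (b - a)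
        = segment_green a b z - ln (norm z)"
      unfolding eventually_at_infinity
    proof (intro exI[of _ "\<bar>B\<bar> + 1"] allI impI)
      fix z :: complex assume z: "\<bar>B\<bar> + 1 \<le> norm z"
      then have zS: "z \<notin> real_segment a b" and z0: "z \<noteq> 0" using B[of z] by auto
      have za: "z \<noteq> of_real a" "z \<noteq> of_real b" using zS real_segment_endpoints[of a b] ab by auto
      have "csqrt ((z - of_real b) / (z - of_real a)) = m z" by (simp add: m_def)
      note * = segment_green_eq[OF zS, unfolded this]
      have "ln (norm (1 + m z)) + ln (norm (1 - m z)) = ln (norm ((1 + m z) * (1 - m z)))"
        unfolding norm_mult using *(2,3) by (intro ln_mult_pos[symmetric]) auto
      also have "(1 + m z) * (1 - m z) = 1 - (m z)\<^sup>2" by (simp add: power2_eq_square algebra_simps)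
      finally have "ln (norm (1 + m z)) + ln (norm (1 - m z)) = ln (norm (1 - (m z)\<^sup>2))" .
      also have "\<dots> = ln (b - a) - ln (norm (z - of_real a))"
        unfolding *(4) using ab za by (simp add: norm_divide ln_div flip: of_real_diff)
      finally show "2 * ln (norm (1 + m z)) + ln (norm ((z - of_real a) / (z - 0))) - ln (b - a)
        = segment_green a b z - ln (norm z)"
        using *(5) za z0 by (simp add: norm_divide ln_div)
    qed
  qed
qed

end

lemma segment_green_cnj: "segment_green a b (cnj z) = segment_green a b z"
proof -
  have "norm (cnj z - of_real c) = norm (z - of_real c)" for c
    by (metis complex_cnj_complex_of_real complex_cnj_diff complex_mod_cnj)
  then show ?thesis by (simp add: segment_green_def)
qed


section \<open>Energy comparison in half-strips\<close>

abbreviation (input) upper_half_plane :: "complex set" where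
  "upper_half_plane \<equiv> {z. 0 < Im z}"

text \<open>Convergence at the infinite end of the half-strips, uniform in the real part.\<close>

abbreviation at_height_top :: "complex filter" where
  "at_height_top \<equiv> filtercomap Im at_top"

lemma complex_gradient_coordinate_derivs:
  assumes "complex_gradient V \<phi> S" "Complex x y \<in> S"
  shows "((\<lambda>x. V (Complex x y)) has_real_derivative Re (\<phi> (Complex x y))) (at x)"
    "((\<lambda>y. V (Complex x y)) has_real_derivative - Im (\<phi> (Complex x y))) (at y)"
    "((\<lambda>x. Re (\<phi> (Complex x y))) has_real_derivative Re (deriv \<phi> (Complex x y))) (at x)"
    "((\<lambda>x. Im (\<phi> (Complex x y))) has_real_derivative Im (deriv \<phi> (Complex x y))) (at x)"
    "((\<lambda>y. Re (\<phi> (Complex x y))) has_real_derivative - Im (deriv \<phi> (Complex x y))) (at y)"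
    "((\<lambda>y. Im (\<phi> (Complex x y))) has_real_derivative Re (deriv \<phi> (Complex x y))) (at y)"
proof -
  have S: "open S" "\<phi> holomorphic_on S"
    and V: "(V has_derivative (\<lambda>h. Re (\<phi> (Complex x y) * h))) (at (Complex x y))"
    using assms by (auto simp: complex_gradient_def)
  have \<phi>: "(\<phi> has_derivative (\<lambda>h. deriv \<phi> (Complex x y) * h)) (at (Complex x y))"
    using holomorphic_derivI[OF S(2,1) assms(2)] by (simp add: has_field_derivative_def)
  have X: "((\<lambda>x. Complex x y) has_derivative (\<lambda>h. of_real h)) (at x)"
    unfolding Complex_eq by (auto intro!: derivative_eq_intros)
  have Y: "((\<lambda>y. Complex x y) has_derivative (\<lambda>h. \<i> * of_real h)) (at y)"
    unfolding Complex_eq by (auto intro!: derivative_eq_intros)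
  show "((\<lambda>x. V (Complex x y)) has_real_derivative Re (\<phi> (Complex x y))) (at x)"
    unfolding has_field_derivative_def
    by (rule has_derivative_eq_rhs[OF has_derivative_compose[OF X V]]) (simp add: fun_eq_iff)
  show "((\<lambda>y. V (Complex x y)) has_real_derivative - Im (\<phi> (Complex x y))) (at y)"
    unfolding has_field_derivative_def
    by (rule has_derivative_eq_rhs[OF has_derivative_compose[OF Y V]]) (simp add: fun_eq_iff)
  show "((\<lambda>x. Re (\<phi> (Complex x y))) has_real_derivative Re (deriv \<phi> (Complex x y))) (at x)"
    unfolding has_field_derivative_def
    by (rule has_derivative_eq_rhs[OF has_derivative_Re[OF has_derivative_compose[OF X \<phi>]]]) (simp add: fun_eq_iff)
  show "((\<lambda>x. Im (\<phi> (Complex x y))) has_real_derivative Im (deriv \<phi> (Complex x y))) (at x)"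
    unfolding has_field_derivative_def
    by (rule has_derivative_eq_rhs[OF has_derivative_Im[OF has_derivative_compose[OF X \<phi>]]]) (simp add: fun_eq_iff)
  show "((\<lambda>y. Re (\<phi> (Complex x y))) has_real_derivative - Im (deriv \<phi> (Complex x y))) (at y)"
    unfolding has_field_derivative_def
    by (rule has_derivative_eq_rhs[OF has_derivative_Re[OF has_derivative_compose[OF Y \<phi>]]]) (simp add: fun_eq_iff)
  show "((\<lambda>y. Im (\<phi> (Complex x y))) has_real_derivative Re (deriv \<phi> (Complex x y))) (at y)"
    unfolding has_field_derivative_def
    by (rule has_derivative_eq_rhs[OF has_derivative_Im[OF has_derivative_compose[OF Y \<phi>]]]) (simp add: fun_eq_iff)
qed

lemma complex_gradient_continuous_on:
  assumes "complex_gradient V \<phi> S"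
  shows "continuous_on S V" "continuous_on S \<phi>" "continuous_on S (deriv \<phi>)"
proof -
  have S: "open S" "\<phi> holomorphic_on S"
    and V: "\<And>z. z \<in> S \<Longrightarrow> (V has_derivative (\<lambda>h. Re (\<phi> z * h))) (at z)"
    using assms by (auto simp: complex_gradient_def)
  show "continuous_on S \<phi>" "continuous_on S (deriv \<phi>)"
    using S holomorphic_deriv holomorphic_on_imp_continuous_on by blast+
  show "continuous_on S V"
    using V by (meson continuous_at_imp_continuous_on has_derivative_continuous)
qed

text \<open>Divergence theorem in slice form: the derivative passes under the integral,
  \<open>A'\<close> is at least \<open>- B'\<close>, and \<open>- B'\<close> integrates to the side
  values of \<open>B\<close>. Only positive heights occur, so no regularity at the bottom is
  used.\<close>

lemma has_derivative_integral_divergence: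
  fixes A A' B B' :: "real \<Rightarrow> real \<Rightarrow> real"
  assumes pq: "p \<le> q" and y0: "0 < y0"
    and A: "\<And>x y. x \<in> {p..q} \<Longrightarrow> 0 < y \<Longrightarrow> ((\<lambda>y. A x y) has_real_derivative A' x y) (at y)"
    and B: "\<And>x y. x \<in> {p..q} \<Longrightarrow> 0 < y \<Longrightarrow> ((\<lambda>x. B x y) has_real_derivative B' x y) (at x)"
    and cA: "\<And>y. 0 < y \<Longrightarrow> continuous_on {p..q} (\<lambda>x. A x y)"
    and cA': "continuous_on ({0<..} \<times> {p..q}) (\<lambda>(y, x). A' x y)"
    and ge: "\<And>x. x \<in> {p..q} \<Longrightarrow> - B' x y0 \<le> A' x y0"
  shows "\<exists>D. ((\<lambda>y. integral {p..q} (\<lambda>x. A x y)) has_real_derivative D) (at y0) \<and> B p y0 - B q y0 \<le> D"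
proof (intro exI conjI)
  have "((\<lambda>y. integral (cbox p q) (\<lambda>x. A x y)) has_real_derivative integral (cbox p q) (\<lambda>x. A' x y0)) (at y0 within {0<..})"
  proof (rule leibniz_rule_field_derivative)
    show "(\<lambda>x. A x y) integrable_on cbox p q" if "y \<in> {0<..}" for y
      using integrable_continuous_interval[OF cA] that by simp
    show "((\<lambda>y. A x y) has_real_derivative A' x y) (at y within {0<..})"
      if "y \<in> {0<..}" "x \<in> cbox p q" for x y
      using A[of x y] that has_field_derivative_at_within by auto
  qed (use y0 cA' in auto)
  then show "((\<lambda>y. integral {p..q} (\<lambda>x. A x y)) has_real_derivative integral {p..q} (\<lambda>x. A' x y0)) (at y0)"
    using at_within_open[of y0 "{0<..}"] y0 by simp
  have "((\<lambda>x. - B' x y0) has_integral (- B q y0) - (- B p y0)) {p..q}"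
  proof (rule fundamental_theorem_of_calculus[OF pq])
    fix x assume "x \<in> {p..q}"
    then show "((\<lambda>x. - B x y0) has_vector_derivative - B' x y0) (at x within {p..q})"
      using DERIV_minus[OF B[of x y0]] y0
      by (simp add: has_real_derivative_iff_has_vector_derivative has_vector_derivative_at_within)
  qed
  moreover have "continuous_on {p..q} (\<lambda>x. A' x y0)"
  proof -
    have "continuous_on {p..q} (\<lambda>x. case (y0, x) of (y, x) \<Rightarrow> A' x y)"
      by (rule continuous_on_compose2[OF cA']) (use y0 in \<open>auto intro!: continuous_intros\<close>)
    then show ?thesis by simp
  qed
  then have "((\<lambda>x. A' x y0) has_integral integral {p..q} (\<lambda>x. A' x y0)) {p..q}"
    by (intro integrable_integral integrable_continuous_interval)
  ultimately have "(- B q y0) - (- B p y0) \<le> integral {p..q} (\<lambda>x. A' x y0)"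
    by (rule has_integral_le) (use ge in auto)
  then show "B p y0 - B q y0 \<le> integral {p..q} (\<lambda>x. A' x y0)" by simp
qed

text \<open>Only \<open>U\<close> has vanishing normal derivative on the sides of this strip.
  \<open>V\<close> is one function shared by all strips, and its side terms cancel only after
  summation over the strips.\<close>

context
  fixes p q :: real and V U :: "complex \<Rightarrow> real" and \<phi> \<psi> :: "complex \<Rightarrow> complex"
  assumes pq: "p \<le> q"
    and V: "complex_gradient V \<phi> upper_half_plane" and U: "complex_gradient U \<psi> upper_half_plane"
    and sides: "\<And>z. 0 < Im z \<Longrightarrow> Re z = p \<or> Re z = q \<Longrightarrow> Re (\<psi> z) = 0"
begin

lemma compose_Complex_continuous:
  assumes "continuous_on upper_half_plane f"
  shows "continuous_on ({0<..} \<times> {p..q}) (\<lambda>(y, x). f (Complex x y))"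
proof -
  have "continuous_on ({0<..} \<times> {p..q}) (\<lambda>z. f (Complex (snd z) (fst z)))"
    by (rule continuous_on_compose2[OF assms]) (auto intro!: continuous_intros)
  then show ?thesis by (simp add: case_prod_beta')
qed

lemma slice_continuous:
  assumes "continuous_on upper_half_plane f" "0 < y"
  shows "continuous_on {p..q} (\<lambda>x. f (Complex x y))"
  by (rule continuous_on_compose2[OF assms(1)]) (use assms in \<open>auto intro!: continuous_intros\<close>)

lemmas gradient_V_continuous = complex_gradient_continuous_on[OF V]
lemmas gradient_U_continuous = complex_gradient_continuous_on[OF U]

text \<open>The divergence lemma only bounds a derivative from below. Applied to the flux and to its
  negative, with all side terms zero, it forces the derivative to be 0.\<close>

lemma strip_flux_constant:
  assumes "0 < y1" "0 < y2"
  shows "integral {p..q} (\<lambda>x. - Im (\<psi> (Complex x y1))) = integral {p..q} (\<lambda>x. - Im (\<psi> (Complex x y2)))"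
proof -
  define J where "J = (\<lambda>y. integral {p..q} (\<lambda>x. - Im (\<psi> (Complex x y))))"
  have J: "(J has_real_derivative 0) (at y)" if y: "0 < y" for y
  proof -
    have d: "((\<lambda>x. Re (\<psi> (Complex x y))) has_real_derivative Re (deriv \<psi> (Complex x y))) (at x)"
      "((\<lambda>y. Im (\<psi> (Complex x y))) has_real_derivative Re (deriv \<psi> (Complex x y))) (at y)"
      if "0 < y" for x y
      using complex_gradient_coordinate_derivs[OF U, of x y] that by simp_all
    have c: "continuous_on upper_half_plane (\<lambda>z. - Re (deriv \<psi> z))" "continuous_on upper_half_plane (\<lambda>z. Re (deriv \<psi> z))"
      "continuous_on upper_half_plane (\<lambda>z. - Im (\<psi> z))" "continuous_on upper_half_plane (\<lambda>z. Im (\<psi> z))"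
      by (intro continuous_intros gradient_U_continuous)+
    have "\<exists>D. ((\<lambda>y. integral {p..q} (\<lambda>x. - Im (\<psi> (Complex x y)))) has_real_derivative D) (at y) \<and>
      Re (\<psi> (Complex p y)) - Re (\<psi> (Complex q y)) \<le> D"
    proof (rule has_derivative_integral_divergence[OF pq y])
      show "((\<lambda>y. - Im (\<psi> (Complex x y))) has_real_derivative - Re (deriv \<psi> (Complex x y))) (at y)" if "0 < y" for x y
        by (rule DERIV_minus[OF d(2)[OF that]])
      show "((\<lambda>x. Re (\<psi> (Complex x y))) has_real_derivative Re (deriv \<psi> (Complex x y))) (at x)" if "0 < y" for x y
        by (rule d(1)[OF that])
      show "continuous_on {p..q} (\<lambda>x. - Im (\<psi> (Complex x y)))" if "0 < y" for y
        by (rule slice_continuous[OF c(3) that])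
      show "continuous_on ({0<..} \<times> {p..q}) (\<lambda>(y, x). - Re (deriv \<psi> (Complex x y)))"
        by (rule compose_Complex_continuous[OF c(1)])
    qed simp
    then obtain D where D: "(J has_real_derivative D) (at y)"
      "Re (\<psi> (Complex p y)) - Re (\<psi> (Complex q y)) \<le> D"
      unfolding J_def by blast
    have "\<exists>D. ((\<lambda>y. integral {p..q} (\<lambda>x. Im (\<psi> (Complex x y)))) has_real_derivative D) (at y) \<and>
      - Re (\<psi> (Complex p y)) - - Re (\<psi> (Complex q y)) \<le> D"
    proof (rule has_derivative_integral_divergence[OF pq y])
      show "((\<lambda>y. Im (\<psi> (Complex x y))) has_real_derivative Re (deriv \<psi> (Complex x y))) (at y)" if "0 < y" for x y
        by (rule d(2)[OF that])
      show "((\<lambda>x. - Re (\<psi> (Complex x y))) has_real_derivative - Re (deriv \<psi> (Complex x y))) (at x)" if "0 < y" for x y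
        by (rule DERIV_minus[OF d(1)[OF that]])
      show "continuous_on {p..q} (\<lambda>x. Im (\<psi> (Complex x y)))" if "0 < y" for y
        by (rule slice_continuous[OF c(4) that])
      show "continuous_on ({0<..} \<times> {p..q}) (\<lambda>(y, x). Re (deriv \<psi> (Complex x y)))"
        by (rule compose_Complex_continuous[OF c(2)])
    qed simp
    then obtain D' where D': "((\<lambda>y. integral {p..q} (\<lambda>x. Im (\<psi> (Complex x y)))) has_real_derivative D') (at y)"
      "- Re (\<psi> (Complex p y)) - - Re (\<psi> (Complex q y)) \<le> D'"
      unfolding J_def by blast
    have "(J has_real_derivative - D') (at y)" using DERIV_minus[OF D'(1)] by (simp add: J_def)
    then have "D = - D'" using D(1) DERIV_unique by blast
    then have "D = 0" using D(2) D'(2) y by (simp add: sides)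
    then show ?thesis using D(1) by simp
  qed
  have "\<exists>c. \<forall>y\<in>{0<..}. J y = c"
    by (rule has_field_derivative_zero_constant) (auto intro!: has_field_derivative_at_within J)
  then have "J y1 = J y2" using assms by (metis greaterThan_iff)
  then show ?thesis by (simp add: J_def)
qed

text \<open>The integrand is \<open>V * V\<^sub>y + U * U\<^sub>y - 2 * V * U\<^sub>y\<close>. It is chosen such that its \<open>y\<close>-derivative is
  \<open>\<bar>grad V - grad U\<bar>\<^sup>2\<close> up to an \<open>x\<close>-derivative.\<close>

definition strip_energy :: "real \<Rightarrow> real" where
  "strip_energy y = integral {p..q} (\<lambda>x. let z = Complex x y in
     V z * (- Im (\<phi> z)) + U z * (- Im (\<psi> z)) - 2 * V z * (- Im (\<psi> z)))"

text \<open>The symmetric cross term \<open>- V * U_y - U * V_y\<close> differs from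
  \<open>- 2 * V * U_y\<close> by a quantity whose \<open>y\<close>-derivative is an
  \<open>x\<close>-derivative, by Green's second identity. The asymmetric choice matters on the
  sides: \<open>U * V_x\<close> would survive there, and since \<open>U\<close> differs from strip
  to strip it could not telescope.\<close>

lemma strip_energy_derivative:
  assumes y: "0 < y"
  obtains D where "(strip_energy has_real_derivative D) (at y)"
    "V (Complex p y) * Re (\<phi> (Complex p y)) - V (Complex q y) * Re (\<phi> (Complex q y)) \<le> D"
proof -
  define A where "A = (\<lambda>x y. V (Complex x y) * (- Im (\<phi> (Complex x y)))
     + U (Complex x y) * (- Im (\<psi> (Complex x y))) - 2 * V (Complex x y) * (- Im (\<psi> (Complex x y))))"
  define A' where "A' = (\<lambda>z. (Im (\<phi> z))\<^sup>2 - V z * Re (deriv \<phi> z) + (Im (\<psi> z))\<^sup>2 - U z * Re (deriv \<psi> z)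
     - 2 * Im (\<phi> z) * Im (\<psi> z) + 2 * V z * Re (deriv \<psi> z))"
  \<comment> \<open>\<open>B\<close> is the horizontal counterpart of \<open>A\<close>: their
    derivatives add up to the squared length of \<open>grad V - grad U\<close>. On the sides
    \<open>Re \<psi> = 0\<close> leaves only \<open>V * Re \<phi>\<close>.\<close>
  define B where "B = (\<lambda>x y. V (Complex x y) * Re (\<phi> (Complex x y))
     + U (Complex x y) * Re (\<psi> (Complex x y)) - 2 * V (Complex x y) * Re (\<psi> (Complex x y)))"
  define B' where "B' = (\<lambda>z. (Re (\<phi> z))\<^sup>2 + V z * Re (deriv \<phi> z) + (Re (\<psi> z))\<^sup>2 + U z * Re (deriv \<psi> z)
     - 2 * Re (\<phi> z) * Re (\<psi> z) - 2 * V z * Re (deriv \<psi> z))"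
  note dV = complex_gradient_coordinate_derivs[OF V] and dU = complex_gradient_coordinate_derivs[OF U]
  have 1: "((\<lambda>y. A x y) has_real_derivative A' (Complex x y)) (at y)" if "0 < y" for x y
  proof -
    have "Complex x y \<in> upper_half_plane" using that by simp
    note dV[OF this, derivative_intros] and dU[OF this, derivative_intros]
    show ?thesis unfolding A_def A'_def
      by (rule derivative_eq_intros refl)+ (simp add: algebra_simps power2_eq_square)
  qed
  have 2: "((\<lambda>x. B x y) has_real_derivative B' (Complex x y)) (at x)" if "0 < y" for x y
  proof -
    have "Complex x y \<in> upper_half_plane" using that by simp
    note dV[OF this, derivative_intros] and dU[OF this, derivative_intros]
    show ?thesis unfolding B_def B'_def
      by (rule derivative_eq_intros refl)+ (simp add: algebra_simps power2_eq_square)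
  qed
  have sum: "A' z + B' z = (Re (\<phi> z) - Re (\<psi> z))\<^sup>2 + (Im (\<phi> z) - Im (\<psi> z))\<^sup>2" for z
    by (simp add: A'_def B'_def power2_eq_square algebra_simps)
  have 3: "- B' z \<le> A' z" for z
    using sum[of z] zero_le_power2[of "Re (\<phi> z) - Re (\<psi> z)"] zero_le_power2[of "Im (\<phi> z) - Im (\<psi> z)"] by linarith
  have "continuous_on upper_half_plane A'"
    unfolding A'_def by (intro continuous_intros gradient_V_continuous gradient_U_continuous)
  note cA' = compose_Complex_continuous[OF this]
  have cA: "continuous_on {p..q} (\<lambda>x. A x y)" if "0 < y" for y
    unfolding A_def by (intro continuous_intros slice_continuous gradient_V_continuous gradient_U_continuous that)
  have "\<exists>D. ((\<lambda>y. integral {p..q} (\<lambda>x. A x y)) has_real_derivative D) (at y) \<and> B p y - B q y \<le> D"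
  proof (rule has_derivative_integral_divergence[OF pq y])
    show "((\<lambda>y. A x y) has_real_derivative A' (Complex x y)) (at y)" if "0 < y" for x y by (rule 1[OF that])
    show "((\<lambda>x. B x y) has_real_derivative B' (Complex x y)) (at x)" if "0 < y" for x y by (rule 2[OF that])
    show "continuous_on ({0<..} \<times> {p..q}) (\<lambda>(y, x). A' (Complex x y))" by (rule cA')
  qed (use cA 3 in auto)
  moreover have "strip_energy = (\<lambda>y. integral {p..q} (\<lambda>x. A x y))"
    by (simp add: strip_energy_def A_def Let_def fun_eq_iff)
  ultimately obtain D where "(strip_energy has_real_derivative D) (at y)" "B p y - B q y \<le> D"
    by metis
  then show ?thesis using that y by (simp add: B_def sides)
qed

lemma strip_energy_integrable:
  assumes "0 < y"
  shows "(\<lambda>x. let z = Complex x y in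
     V z * (- Im (\<phi> z)) + U z * (- Im (\<psi> z)) - 2 * V z * (- Im (\<psi> z))) integrable_on {p..q}"
  unfolding Let_def
  by (intro integrable_continuous_interval continuous_intros slice_continuous gradient_V_continuous gradient_U_continuous assms)

lemma strip_energy_le:
  assumes "0 < y"
    and "\<And>z. Im z = y \<Longrightarrow> V z * (- Im (\<phi> z)) + U z * (- Im (\<psi> z)) - 2 * V z * (- Im (\<psi> z)) \<le> C"
  shows "strip_energy y \<le> (q - p) * C"
proof -
  have "strip_energy y \<le> integral {p..q} (\<lambda>x. C)"
    unfolding strip_energy_def
    by (intro integral_le strip_energy_integrable assms) (use assms(2) in \<open>auto simp: Let_def\<close>)
  then show ?thesis using pq by simp
qed

text \<open>Near the bottom \<open>U_y\<close> need not be bounded, but its integral over a slice is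
  the flux, which does not depend on the height. So \<open>V * U_y\<close> is bounded by
  \<open>\<eta> * U_y + \<eta> * M\<close>, whichever factor is small, while \<open>V * V_y\<close>
  and \<open>U * U_y\<close> are discarded as nonnegative.\<close>

lemma strip_energy_ge:
  assumes y: "0 < y" and \<eta>: "0 \<le> \<eta>" and M: "0 \<le> M"
    and V0: "\<And>z. 0 < Im z \<Longrightarrow> 0 \<le> V z" "\<And>z. 0 < Im z \<Longrightarrow> Im (\<phi> z) \<le> 0"
    and U0: "\<And>z. 0 < Im z \<Longrightarrow> 0 \<le> U z" "\<And>z. 0 < Im z \<Longrightarrow> Im (\<psi> z) \<le> 0"
    and bottom: "\<And>z. Re z \<in> {p..q} \<Longrightarrow> Im z = y \<Longrightarrow> V z \<le> \<eta> \<or> - Im (\<psi> z) \<le> \<eta>"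
    and bound: "\<And>z. Re z \<in> {p..q} \<Longrightarrow> Im z = y \<Longrightarrow> V z \<le> M"
  shows "- 2 * \<eta> * (integral {p..q} (\<lambda>x. - Im (\<psi> (Complex x y))) + M * (q - p)) \<le> strip_energy y"
proof -
  have int: "(\<lambda>x. - Im (\<psi> (Complex x y))) integrable_on {p..q}"
    by (intro integrable_continuous_interval continuous_intros slice_continuous gradient_U_continuous y)
  have "- 2 * \<eta> * (integral {p..q} (\<lambda>x. - Im (\<psi> (Complex x y))) + M * (q - p))
      = integral {p..q} (\<lambda>x. - 2 * \<eta> * (- Im (\<psi> (Complex x y))) + - 2 * \<eta> * M)"
  proof -
    have "((\<lambda>x. - 2 * \<eta> * (- Im (\<psi> (Complex x y))) + - 2 * \<eta> * M) has_integral
        (- 2 * \<eta> * integral {p..q} (\<lambda>x. - Im (\<psi> (Complex x y))) + (q - p) * (- 2 * \<eta> * M))) {p..q}"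
      using has_integral_const_real[of "- 2 * \<eta> * M" p q] pq
      by (intro has_integral_add has_integral_mult_right integrable_integral int) simp
    from integral_unique[OF this] show ?thesis by (simp only:) (simp add: algebra_simps)
  qed
  also have "\<dots> \<le> strip_energy y"
    unfolding strip_energy_def
  proof (intro integral_le strip_energy_integrable y)
    show "(\<lambda>x. - 2 * \<eta> * (- Im (\<psi> (Complex x y))) + - 2 * \<eta> * M) integrable_on {p..q}"
      by (intro integrable_continuous_interval continuous_intros slice_continuous gradient_U_continuous y)
    fix x assume x: "x \<in> {p..q}"
    define z where "z = Complex x y"
    have z: "Re z \<in> {p..q}" "Im z = y" "0 < Im z" using x y by (auto simp: z_def)
    define u v where "u = - Im (\<psi> z)" and "v = V z"
    have uv: "0 \<le> u" "0 \<le> v" "v \<le> M" "v \<le> \<eta> \<or> u \<le> \<eta>"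
      using U0(2)[OF z(3)] V0(1)[OF z(3)] bound[OF z(1,2)] bottom[OF z(1,2)] by (auto simp: u_def v_def)
    have "v * u \<le> \<eta> * u + \<eta> * M"
    proof (cases "v \<le> \<eta>")
      case True
      then have "v * u \<le> \<eta> * u" using uv by (intro mult_right_mono)
      then show ?thesis using \<eta> M by (simp add: add_increasing2)
    next
      case False
      then have "v * u \<le> M * \<eta>" using uv M by (intro mult_mono) auto
      moreover have "0 \<le> \<eta> * u" using uv \<eta> by simp
      ultimately show ?thesis by (simp add: mult.commute)
    qed
    moreover have "0 \<le> V z * (- Im (\<phi> z))" using V0[OF z(3)] by (intro mult_nonneg_nonneg) auto
    moreover have "0 \<le> U z * u" using U0(1)[OF z(3)] uv(1) by (rule mult_nonneg_nonneg)
    ultimately have "- 2 * \<eta> * u + - 2 * \<eta> * M \<le> V z * (- Im (\<phi> z)) + U z * u - 2 * v * u"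
      by (simp add: algebra_simps)
    then show "- 2 * \<eta> * (- Im (\<psi> (Complex x y))) + - 2 * \<eta> * M \<le> (let z = Complex x y in
        V z * (- Im (\<phi> z)) + U z * (- Im (\<psi> z)) - 2 * V z * (- Im (\<psi> z)))"
      unfolding Let_def by (simp add: u_def v_def z_def)
  qed
  finally show ?thesis .
qed

text \<open>The flux may be evaluated at a large height, where \<open>U_y\<close> is close to 1; the
  constant 2 is a convenient crude bound.\<close>

lemma strip_flux_le:
  assumes lim: "((\<lambda>z. \<psi> z + \<i>) \<longlongrightarrow> 0) at_height_top" and y: "0 < y"
  shows "integral {p..q} (\<lambda>x. - Im (\<psi> (Complex x y))) \<le> 2 * (q - p)"
proof -
  have "eventually (\<lambda>z. norm (\<psi> z + \<i>) < 1) at_height_top"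
    using tendstoD[OF lim, of 1] by simp
  then obtain N where N: "\<And>z. N \<le> Im z \<Longrightarrow> norm (\<psi> z + \<i>) < 1"
    by (auto simp: eventually_filtercomap_at_top_linorder)
  define Y where "Y = max N 1"
  have "integral {p..q} (\<lambda>x. - Im (\<psi> (Complex x y))) = integral {p..q} (\<lambda>x. - Im (\<psi> (Complex x Y)))"
    by (rule strip_flux_constant) (use y in \<open>auto simp: Y_def\<close>)
  also have "\<dots> \<le> integral {p..q} (\<lambda>x. 2)"
  proof (rule integral_le)
    show "(\<lambda>x. - Im (\<psi> (Complex x Y))) integrable_on {p..q}"
      by (intro integrable_continuous_interval continuous_intros slice_continuous gradient_U_continuous) (simp add: Y_def)
    fix x
    have "\<bar>Im (\<psi> (Complex x Y) + \<i>)\<bar> < 1"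
      using N[of "Complex x Y"] abs_Im_le_cmod[of "\<psi> (Complex x Y) + \<i>"] by (simp add: Y_def)
    then show "- Im (\<psi> (Complex x Y)) \<le> 2" by simp
  qed auto
  finally show ?thesis using pq by simp
qed

end

text \<open>The total energy \<open>Q\<close> does not decrease with height. On a low slice it is at
  least minus a multiple of \<open>\<eta>\<close>, on a high slice at most the claimed sum plus a
  multiple of \<open>\<eta>\<close>. The gradients are required to converge faster than
  \<open>1 / Im z\<close> because they are multiplied by \<open>V\<close> and \<open>U k\<close>,
  which grow like \<open>Im z\<close>.\<close>

lemma strip_energy_comparison:
  fixes s d :: "nat \<Rightarrow> real" and c M :: real
  assumes s: "\<And>k. k \<in> {1..n} \<Longrightarrow> s k \<le> s (k - 1)"
    and V: "complex_gradient V \<phi> upper_half_plane"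
      "\<And>z. 0 < Im z \<Longrightarrow> 0 \<le> V z" "\<And>z. 0 < Im z \<Longrightarrow> Im (\<phi> z) \<le> 0"
      "\<And>z. 0 < Im z \<Longrightarrow> Re z = s 0 \<or> Re z = s n \<Longrightarrow> Re (\<phi> z) = 0"
      "((\<lambda>z. V z - Im z) \<longlongrightarrow> c) at_height_top"
      "((\<lambda>z. of_real (Im z) * (\<phi> z + \<i>)) \<longlongrightarrow> 0) at_height_top"
      "\<And>z. 0 < Im z \<Longrightarrow> Im z \<le> 1 \<Longrightarrow> V z \<le> M"
    and U: "\<And>k. k \<in> {1..n} \<Longrightarrow> complex_gradient (U k) (\<psi> k) upper_half_plane"
      "\<And>k z. k \<in> {1..n} \<Longrightarrow> 0 < Im z \<Longrightarrow> 0 \<le> U k z"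
      "\<And>k z. k \<in> {1..n} \<Longrightarrow> 0 < Im z \<Longrightarrow> Im (\<psi> k z) \<le> 0"
      "\<And>k z. k \<in> {1..n} \<Longrightarrow> 0 < Im z \<Longrightarrow> Re z = s k \<or> Re z = s (k - 1) \<Longrightarrow> Re (\<psi> k z) = 0"
      "\<And>k. k \<in> {1..n} \<Longrightarrow> ((\<lambda>z. U k z - Im z) \<longlongrightarrow> d k) at_height_top"
      "\<And>k. k \<in> {1..n} \<Longrightarrow> ((\<lambda>z. of_real (Im z) * (\<psi> k z + \<i>)) \<longlongrightarrow> 0) at_height_top"
    and bottom: "\<And>k \<eta>. k \<in> {1..n} \<Longrightarrow> 0 < \<eta> \<Longrightarrow>
       eventually (\<lambda>y. \<forall>x\<in>{s k..s (k - 1)}. V (Complex x y) \<le> \<eta> \<or> - Im (\<psi> k (Complex x y)) \<le> \<eta>) (at_right 0)"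
  shows "0 \<le> (\<Sum>k=1..n. (s (k - 1) - s k) * (d k - c))"
proof -
  define e where "e = (\<lambda>k. strip_energy (s k) (s (k - 1)) V (U k) \<phi> (\<psi> k))"
  define Q where "Q = (\<lambda>y. \<Sum>k=1..n. e k y)"
  have Q': "\<exists>D. (Q has_real_derivative D) (at y) \<and> 0 \<le> D" if y: "0 < y" for y
  proof -
    \<comment> \<open>Neighbouring strips share a side, so the terms \<open>T k - T (k - 1)\<close>
      telescope to the two outer sides, where the normal derivative of \<open>V\<close> is
      zero.\<close>
    define T where "T = (\<lambda>k. V (Complex (s k) y) * Re (\<phi> (Complex (s k) y)))"
    have "\<exists>D. (e k has_real_derivative D) (at y) \<and> T k - T (k - 1) \<le> D" if k: "k \<in> {1..n}" for k
      using strip_energy_derivative[OF s[OF k] V(1) U(1)[OF k] _ y] U(4)[OF k] unfolding e_def T_def by metis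
    then obtain D where D: "\<And>k. k \<in> {1..n} \<Longrightarrow> (e k has_real_derivative D k) (at y)"
      "\<And>k. k \<in> {1..n} \<Longrightarrow> T k - T (k - 1) \<le> D k" by metis
    have "(Q has_real_derivative (\<Sum>k=1..n. D k)) (at y)"
      unfolding Q_def by (rule DERIV_sum) (use D in auto)
    moreover have "(\<Sum>k=1..n. T k - T (k - 1)) = T n - T 0"
      using sum_telescope''[of 0 n T] by simp
    then have "0 \<le> (\<Sum>k=1..n. D k)"
      using sum_mono[of "{1..n}" "\<lambda>k. T k - T (k - 1)" D] D(2) V(4)[of "Complex (s 0) y"] V(4)[of "Complex (s n) y"] y
      by (simp add: T_def)
    ultimately show ?thesis by blast
  qed
  have Q_mono: "Q y1 \<le> Q y2" if "0 < y1" "y1 \<le> y2" for y1 y2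
    by (rule DERIV_nonneg_imp_nondecreasing[OF that(2)]) (use Q' that in auto)
  define L where "L = s 0 - s n"
  have L: "L = (\<Sum>k=1..n. s (k - 1) - s k)"
    using sum_telescope''[of 0 n "\<lambda>k. - s k"] by (simp add: L_def)
  have lim0: "((\<lambda>z. f z + \<i>) \<longlongrightarrow> 0) at_height_top"
    if "((\<lambda>z. of_real (Im z) * (f z + \<i>)) \<longlongrightarrow> 0) at_height_top" for f :: "complex \<Rightarrow> complex"
  proof (rule Lim_null_comparison[OF _ tendsto_norm_zero[OF that]])
    show "\<forall>\<^sub>F z in at_height_top. norm (f z + \<i>) \<le> norm (of_real (Im z) * (f z + \<i>))"
      unfolding eventually_filtercomap_at_top_linorder norm_mult norm_of_real
    proof (intro exI[of _ 1] allI impI)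
      fix z assume "1 \<le> Im z"
      then show "norm (f z + \<i>) \<le> \<bar>Im z\<bar> * norm (f z + \<i>)"
        using mult_right_mono[of 1 "\<bar>Im z\<bar>" "norm (f z + \<i>)"] by simp
    qed
  qed
  have M: "0 \<le> M" using V(2)[of \<i>] V(7)[of \<i>] by simp
  \<comment> \<open>Collects all errors of order \<open>\<eta>\<close>:
    \<open>2 * (2 + M) * L\<close> from the low slice, where the inner 2 is the flux bound, and
    \<open>L\<close> from the high slice.\<close>
  define K where "K = 2 * (2 + M) * L + L"
  have "L \<ge> 0" unfolding L by (rule sum_nonneg) (use s in auto)
  then have K: "0 \<le> K" using M by (simp add: K_def)
  have main: "0 \<le> (\<Sum>k=1..n. (s (k - 1) - s k) * (d k - c)) + \<eta> * K" if \<eta>: "0 < \<eta>" for \<eta>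
  proof -
    have "eventually (\<lambda>y. 0 < y \<and> y < 1 \<and> (\<forall>k\<in>{1..n}. \<forall>x\<in>{s k..s (k - 1)}. V (Complex x y) \<le> \<eta> \<or> - Im (\<psi> k (Complex x y)) \<le> \<eta>)) (at_right (0::real))"
      by (intro eventually_conj eventually_at_right_less eventually_ball_finite ballI bottom \<eta>)
         (auto simp: eventually_at_right_field intro!: exI[of _ 1])
    then obtain \<epsilon> where \<epsilon>: "0 < \<epsilon>" "\<epsilon> < 1" and bot: "\<And>k x. k \<in> {1..n} \<Longrightarrow> x \<in> {s k..s (k - 1)} \<Longrightarrow>
        V (Complex x \<epsilon>) \<le> \<eta> \<or> - Im (\<psi> k (Complex x \<epsilon>)) \<le> \<eta>"
      using eventually_happens[of _ "at_right (0::real)"] trivial_limit_at_right_real by blast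
    have low: "- 2 * \<eta> * (2 + M) * (s (k - 1) - s k) \<le> e k \<epsilon>" if k: "k \<in> {1..n}" for k
    proof -
      define F where "F = integral {s k..s (k - 1)} (\<lambda>x. - Im (\<psi> k (Complex x \<epsilon>)))"
      have "F \<le> 2 * (s (k - 1) - s k)"
        unfolding F_def
        by (rule strip_flux_le[OF s[OF k] V(1) U(1)[OF k] U(4)[OF k] lim0[OF U(6)[OF k]] \<epsilon>(1)])
      then have "2 * \<eta> * (F + M * (s (k - 1) - s k)) \<le> 2 * \<eta> * (2 * (s (k - 1) - s k) + M * (s (k - 1) - s k))"
        using \<eta> by (intro mult_left_mono) auto
      moreover have "- 2 * \<eta> * (F + M * (s (k - 1) - s k)) \<le> e k \<epsilon>"
        unfolding e_def F_def
      proof (rule strip_energy_ge[OF s[OF k] V(1) U(1)[OF k] U(4)[OF k] \<epsilon>(1)])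
        fix z assume z: "Re z \<in> {s k..s (k - 1)}" "Im z = \<epsilon>"
        then have "z = Complex (Re z) \<epsilon>" by (simp add: complex_eq_iff)
        then show "V z \<le> \<eta> \<or> - Im (\<psi> k z) \<le> \<eta>" using bot[OF k z(1)] by simp
        show "V z \<le> M" using V(7)[of z] z \<epsilon> by simp
      qed (use \<eta> M V U k in auto)
      ultimately show ?thesis by (simp add: algebra_simps)
    qed
    have "eventually (\<lambda>z. V z * (- Im (\<phi> z)) + U k z * (- Im (\<psi> k z)) - 2 * V z * (- Im (\<psi> k z)) < d k - c + \<eta>) at_height_top"
      if k: "k \<in> {1..n}" for k
    proof -
      have W: "((\<lambda>z. W z * Im (f z + \<i>)) \<longlongrightarrow> 0) at_height_top"
        if "((\<lambda>z. W z - Im z) \<longlongrightarrow> a) at_height_top" "((\<lambda>z. of_real (Im z) * (f z + \<i>)) \<longlongrightarrow> 0) at_height_top"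
        for W :: "complex \<Rightarrow> real" and f a
      proof -
        have "((\<lambda>z. (W z - Im z) * Im (f z + \<i>) + Im (of_real (Im z) * (f z + \<i>))) \<longlongrightarrow> a * Im 0 + Im 0) at_height_top"
          by (intro tendsto_intros that lim0)
        then show ?thesis by (simp add: algebra_simps)
      qed
      \<comment> \<open>Writing \<open>Im \<phi> = Im (\<phi> + \<i>) - 1\<close>, and likewise for
        \<open>\<psi> k\<close>, the main terms add up to \<open>V + U k - 2 * V = U k - V\<close>;
        the rest tends to 0.\<close>
      have "((\<lambda>z. - (V z * Im (\<phi> z + \<i>)) - U k z * Im (\<psi> k z + \<i>) + 2 * (V z * Im (\<psi> k z + \<i>)) + (U k z - Im z) - (V z - Im z))
         \<longlongrightarrow> - 0 - 0 + 2 * 0 + d k - c) at_height_top"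
        by (intro tendsto_intros W[OF V(5,6)] W[OF U(5,6)[OF k]] W[OF V(5) U(6)[OF k]] V(5) U(5)[OF k])
      then have "((\<lambda>z. V z * (- Im (\<phi> z)) + U k z * (- Im (\<psi> k z)) - 2 * V z * (- Im (\<psi> k z))) \<longlongrightarrow> d k - c) at_height_top"
        by (simp add: algebra_simps)
      then show ?thesis by (rule order_tendstoD) (use \<eta> in simp)
    qed
    then have "eventually (\<lambda>z. \<forall>k\<in>{1..n}. V z * (- Im (\<phi> z)) + U k z * (- Im (\<psi> k z)) - 2 * V z * (- Im (\<psi> k z)) < d k - c + \<eta>) at_height_top"
      by (intro eventually_ball_finite ballI) auto
    then obtain N where N: "\<And>z k. N \<le> Im z \<Longrightarrow> k \<in> {1..n} \<Longrightarrow>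
        V z * (- Im (\<phi> z)) + U k z * (- Im (\<psi> k z)) - 2 * V z * (- Im (\<psi> k z)) < d k - c + \<eta>"
      unfolding eventually_filtercomap_at_top_linorder by blast
    define Y where "Y = max N 1"
    have up: "e k Y \<le> (s (k - 1) - s k) * (d k - c + \<eta>)" if k: "k \<in> {1..n}" for k
      unfolding e_def
      by (rule strip_energy_le[OF s[OF k] V(1) U(1)[OF k] U(4)[OF k]])
         (use N[OF _ k] in \<open>auto simp: Y_def less_imp_le\<close>)
    have "(\<Sum>k=1..n. - 2 * \<eta> * (2 + M) * (s (k - 1) - s k)) \<le> Q \<epsilon>"
      unfolding Q_def by (rule sum_mono) (use low in auto)
    also have "\<dots> \<le> Q Y" by (rule Q_mono) (use \<epsilon> in \<open>auto simp: Y_def\<close>)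
    also have "\<dots> \<le> (\<Sum>k=1..n. (s (k - 1) - s k) * (d k - c + \<eta>))"
      unfolding Q_def by (rule sum_mono) (use up in auto)
    also have "\<dots> = (\<Sum>k=1..n. (s (k - 1) - s k) * (d k - c)) + \<eta> * L"
      unfolding L sum_distrib_left sum.distrib[symmetric] by (intro sum.cong) (auto simp: algebra_simps)
    also have "(\<Sum>k=1..n. - 2 * \<eta> * (2 + M) * (s (k - 1) - s k)) = - 2 * \<eta> * (2 + M) * L"
      unfolding L sum_distrib_left ..
    finally show ?thesis by (simp add: K_def algebra_simps)
  qed
  show ?thesis
  proof (rule field_le_epsilon)
    fix r :: real assume r: "0 < r"
    have "r / (K + 1) * K \<le> r" using K r by (simp add: field_simps)
    moreover have "0 < r / (K + 1)" using K r by simp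
    note main[OF this]
    ultimately show "0 \<le> (\<Sum>k=1..n. (s (k - 1) - s k) * (d k - c)) + r"
      by linarith
  qed
qed


section \<open>Transplantation by the cosine\<close>

text \<open>Neither positivity nor minimality is included; both follow below from the zero boundary
  values and the pole. Symmetry under conjugation makes \<open>f\<close> real on the real axis
  outside \<open>E\<close>.\<close>

definition green_data :: "complex set \<Rightarrow> (complex \<Rightarrow> real) \<Rightarrow> (complex \<Rightarrow> complex) \<Rightarrow> real \<Rightarrow> bool" where
  "green_data E g f \<gamma> \<longleftrightarrow> compact E \<and> E \<subseteq> real_segment (-1) 1 \<and> complex_gradient g f (- E) \<and>
     continuous_on UNIV g \<and> (\<forall>z\<in>E. g z = 0) \<and> (\<forall>z. g (cnj z) = g z) \<and>
     ((\<lambda>z. z * f z) \<longlongrightarrow> 1) at_infinity \<and> ((\<lambda>z. g z - ln (norm z)) \<longlongrightarrow> \<gamma>) at_infinity"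

text \<open>If \<open>cos z\<close> is real and \<open>Im z \<noteq> 0\<close>, then
  \<open>sin (Re z) = 0\<close> and \<open>\<bar>cos z\<bar> = cosh (Im z) > 1\<close>.\<close>

lemma cos_notin_unit_segment:
  assumes "Im z \<noteq> 0"
  shows "cos z \<notin> real_segment (-1) 1"
proof
  assume "cos z \<in> real_segment (-1) 1"
  then obtain t where t: "cos z = of_real t" "-1 \<le> t" "t \<le> 1" by (auto simp: real_segment_def)
  have "Im (cos z) = 0" "Re (cos z) = t" by (simp_all only: t Im_complex_of_real Re_complex_of_real)
  then have *: "sin (Re z) * sinh (Im z) = 0" "cos (Re z) * cosh (Im z) = t"
    by (auto simp: Im_cos Re_cos sinh_def cosh_def)
  have "sin (Re z) = 0" using * assms by (metis mult_eq_0_iff sinh_real_zero_iff)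
  then have "(cos (Re z))\<^sup>2 = 1" using sin_cos_squared_add[of "Re z"] by simp
  then have "t\<^sup>2 = (cosh (Im z))\<^sup>2" using *(2) by (metis mult_1 power_mult_distrib)
  moreover have "1 < cosh (Im z)"
    using cosh_real_ge_1[of "Im z"] cosh_real_one_iff[of "Im z"] assms by linarith
  then have "1\<^sup>2 < (cosh (Im z))\<^sup>2" by (intro power_strict_mono) auto
  moreover have "t\<^sup>2 \<le> 1\<^sup>2" using t by (intro abs_le_square_iff[THEN iffD1]) auto
  ultimately show False by simp
qed

section \<open>The cosine at the infinite end of the half-strip\<close>

lemma norm_cos_sin_bounds:
  assumes "0 \<le> Im z"
  shows "sinh (Im z) \<le> norm (cos z)" "norm (sin z) \<le> cosh (Im z)"
proof -
  have n: "norm (exp (\<i> * z)) = exp (- Im z)" "norm (exp (- (\<i> * z))) = exp (Im z)"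
    by (simp_all add: norm_exp_eq_Re)
  have "cos z = (exp (- (\<i> * z)) + exp (\<i> * z)) / 2" by (simp add: cos_exp_eq add.commute)
  then have "norm (cos z) = norm (exp (- (\<i> * z)) + exp (\<i> * z)) / 2" by (simp only: norm_divide) simp
  also have "\<dots> \<ge> (exp (Im z) - exp (- Im z)) / 2"
    using norm_diff_ineq[of "exp (- (\<i> * z))" "exp (\<i> * z)"] n by simp
  finally show "sinh (Im z) \<le> norm (cos z)" by (simp add: sinh_def)
  have "sin z = (exp (\<i> * z) - exp (- (\<i> * z))) / (2 * \<i>)" by (simp add: sin_exp_eq)
  then have "norm (sin z) = norm (exp (\<i> * z) - exp (- (\<i> * z))) / 2" by (simp only: norm_divide norm_mult) simp
  also have "\<dots> \<le> (exp (- Im z) + exp (Im z)) / 2"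
    using norm_triangle_ineq4[of "exp (\<i> * z)" "exp (- (\<i> * z))"] n by simp
  finally show "norm (sin z) \<le> cosh (Im z)" by (simp add: cosh_def add.commute)
qed

lemma at_height_top_tendstoI:
  assumes "((h :: real \<Rightarrow> real) \<longlongrightarrow> 0) at_top"
    and "\<And>z. 1 \<le> Im z \<Longrightarrow> N \<le> Im z \<Longrightarrow> norm (f z) \<le> h (Im z)"
  shows "(f \<longlongrightarrow> 0) at_height_top"
proof (rule Lim_null_comparison)
  show "((\<lambda>z. h (Im z)) \<longlongrightarrow> 0) at_height_top"
    using filterlim_compose[OF assms(1) filterlim_filtercomap] .
  show "\<forall>\<^sub>F z in at_height_top. norm (f z) \<le> h (Im z)"
    unfolding eventually_filtercomap_at_top_linorder
    by (intro exI[of _ "max 1 N"] allI impI assms(2)) auto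
qed

lemma filterlim_cos_at_height_top: "filterlim cos at_infinity at_height_top"
  unfolding filterlim_at_infinity_conv_norm_at_top
proof (rule filterlim_at_top_mono)
  have "filterlim (\<lambda>y::real. sinh y) at_top at_top" by real_asymp
  then show "filterlim (\<lambda>z. sinh (Im z)) at_top at_height_top"
    by (rule filterlim_compose[OF _ filterlim_filtercomap])
  show "\<forall>\<^sub>F z in at_height_top. sinh (Im z) \<le> norm (cos z)"
    unfolding eventually_filtercomap_at_top_linorder
    by (intro exI[of _ 0] allI impI norm_cos_sin_bounds)
qed

text \<open>\<open>cos z\<close> is \<open>exp (- \<i> * z) / 2\<close> times a factor tending to 1.
  This denominator is the source of the 2 in the constant \<open>- ln (2 * cap E)\<close>.\<close>

lemma tendsto_ln_norm_cos: "((\<lambda>z. ln (norm (cos z)) - Im z) \<longlongrightarrow> - ln 2) at_height_top"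
proof -
  have "((\<lambda>z. exp (2 * \<i> * z)) \<longlongrightarrow> 0) at_height_top"
  proof (rule at_height_top_tendstoI[of "\<lambda>y. exp (- 2 * y)"])
    show "((\<lambda>y::real. exp (- 2 * y)) \<longlongrightarrow> 0) at_top" by real_asymp
  qed (simp add: norm_exp_eq_Re)
  then have "((\<lambda>z. ln (norm (1 + exp (2 * \<i> * z))) - ln 2) \<longlongrightarrow> ln (norm (1 + 0 :: complex)) - ln 2) at_height_top"
    by (intro tendsto_intros) auto
  then have "((\<lambda>z. ln (norm (1 + exp (2 * \<i> * z))) - ln 2) \<longlongrightarrow> - ln 2) at_height_top" by simp
  then show ?thesis
  proof (rule Lim_transform_eventually)
    show "\<forall>\<^sub>F z in at_height_top. ln (norm (1 + exp (2 * \<i> * z))) - ln 2 = ln (norm (cos z)) - Im z"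
      unfolding eventually_filtercomap_at_top_linorder
    proof (intro exI[of _ 1] allI impI)
      fix z assume z: "1 \<le> Im z"
      have "0 < sinh (Im z)" using z by simp
      then have "0 < norm (cos z)" using norm_cos_sin_bounds(1)[of z] z by linarith
      have "cos z = exp (- (\<i> * z)) * (1 + exp (2 * \<i> * z)) / 2"
        by (simp add: cos_exp_eq algebra_simps flip: exp_add)
      then have eq: "norm (cos z) = exp (Im z) * norm (1 + exp (2 * \<i> * z)) / 2"
        by (simp only: norm_mult norm_divide) (simp add: norm_exp_eq_Re)
      then have "norm (1 + exp (2 * \<i> * z)) \<noteq> 0" using \<open>0 < norm (cos z)\<close> by auto
      then show "ln (norm (1 + exp (2 * \<i> * z))) - ln 2 = ln (norm (cos z)) - Im z"
        unfolding eq by (simp add: ln_mult ln_div)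
    qed
  qed
qed

context
  fixes E g f \<gamma>
  assumes G: "green_data E g f \<gamma>"
begin

lemma green_data_basics:
  shows "compact E" "E \<subseteq> real_segment (-1) 1" "complex_gradient g f (- E)" "continuous_on UNIV g"
    "\<And>z. z \<in> E \<Longrightarrow> g z = 0" "\<And>z. g (cnj z) = g z"
    "((\<lambda>z. z * f z) \<longlongrightarrow> 1) at_infinity" "((\<lambda>z. g z - ln (norm z)) \<longlongrightarrow> \<gamma>) at_infinity"
    "E \<subseteq> \<real>"
  using G by (auto simp: green_data_def real_segment_def)

lemma green_data_nonneg: "0 \<le> g z"
proof (cases "z \<in> E")
  case False
  have "filterlim (\<lambda>z. (g z - ln (norm z)) + ln (norm z)) at_top at_infinity"
    by (rule filterlim_tendsto_add_at_top[OF green_data_basics(8) filterlim_ln_norm_at_infinity])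
  then have "filterlim g at_top at_infinity" by simp
  then have "eventually (\<lambda>z. 0 < g z) at_infinity" by (simp add: filterlim_at_top_dense)
  then obtain R where R: "\<And>z. R \<le> norm z \<Longrightarrow> 0 < g z" by (auto simp: eventually_at_infinity)
  show ?thesis
  proof (rule weak_minimum_principle[OF harmonic_on_complex_gradient[OF green_data_basics(3)]])
    fix \<eta> :: real assume \<eta>: "0 < \<eta>"
    define K where "K = {z. g z \<le> - \<eta>}"
    have "closed K" unfolding K_def
      by (intro closed_Collect_le green_data_basics(4) continuous_on_const)
    moreover have "K \<subseteq> cball 0 R"
    proof
      fix z assume "z \<in> K"
      then show "z \<in> cball 0 R" using R[of z] \<eta> by (force simp: K_def)
    qed
    ultimately have "compact K" using compact_eq_bounded_closed bounded_subset[OF bounded_cball] by blast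
    moreover have "K \<subseteq> - E" using green_data_basics(5) \<eta> by (force simp: K_def)
    ultimately show "\<exists>K. compact K \<and> K \<subseteq> - E \<and> (\<forall>z\<in>- E. g z \<le> - \<eta> \<longrightarrow> (\<exists>w\<in>K. g w = g z \<and> Im w = Im z))"
      by (intro exI[of _ K]) (auto simp: K_def)
  qed (use False in auto)
qed (simp add: green_data_basics)

text \<open>As \<open>z * f z\<close> tends to 1, \<open>f\<close> is nonzero somewhere in the
  connected complement, which is what the strong minimum principle requires.\<close>

lemma green_data_pos:
  assumes "z \<notin> E" shows "0 < g z"
proof -
  have "connected (- E)"
    using connected_outside[OF compact_imp_bounded[OF green_data_basics(1)]]
      outside_real_subset[OF green_data_basics(9)] by simp
  moreover have "eventually (\<lambda>z. z * f z \<noteq> 0) at_infinity"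
    by (rule tendsto_imp_eventually_ne[OF green_data_basics(7)]) simp
  then obtain R where R: "\<And>z. R \<le> norm z \<Longrightarrow> z * f z \<noteq> 0" by (auto simp: eventually_at_infinity)
  define w where "w = complex_of_real (max R 2)"
  have "R \<le> norm w" by (simp add: w_def)
  then have "f w \<noteq> 0" using R by fastforce
  moreover have "w \<notin> real_segment (-1) 1" by (auto simp: w_def real_segment_def)
  then have "w \<in> - E" using green_data_basics(2) by auto
  ultimately show ?thesis
    using complex_gradient_nonneg_imp_pos[OF green_data_basics(3) _ green_data_nonneg] assms by blast
qed

lemma log_capacity_green_data: "log_capacity E = exp (- \<gamma>)"
proof (rule log_capacity_eq_exp)
  show E: "compact E" "outside E = - E"
    using green_data_basics(1) outside_real_subset[OF green_data_basics(9)] .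
  show "is_green_at_infinity E g"
    by (rule is_green_at_infinityI[OF E _ _ _ _ green_data_basics(8)])
      (use green_data_basics green_data_pos harmonic_on_complex_gradient in auto)
qed (rule green_data_basics)

text \<open>Differentiating \<open>g (cnj z) = g z\<close> at a real point in the direction
  \<open>\<i>\<close> shows that the vertical derivative equals its own negative.\<close>

lemma green_data_gradient_real:
  assumes "z \<in> \<real>" "z \<notin> E"
  shows "Im (f z) = 0"
proof -
  have cz: "cnj z = z" using assms by (simp add: Reals_cnj_iff)
  have d: "(g has_derivative (\<lambda>h. Re (f z * h))) (at z)"
    using green_data_basics(3) assms by (simp add: complex_gradient_def)
  have "((\<lambda>w. g (cnj w)) has_derivative (\<lambda>h. Re (f z * cnj h))) (at z)"
    by (rule has_derivative_compose[of cnj cnj z UNIV g "\<lambda>h. Re (f z * h)"])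
       (use d cz in \<open>auto intro!: bounded_linear_imp_has_derivative bounded_linear_cnj\<close>)
  then have "(g has_derivative (\<lambda>h. Re (f z * cnj h))) (at z)" by (simp add: green_data_basics(6))
  from has_derivative_unique[OF d this] have "Re (f z * \<i>) = Re (f z * cnj \<i>)" by meson
  then show ?thesis by simp
qed

definition cos_lift :: "complex \<Rightarrow> real" where "cos_lift z = g (cos z)"

definition cos_lift_gradient :: "complex \<Rightarrow> complex" where "cos_lift_gradient z = f (cos z) * (- sin z)"

lemma cos_lift_complex_gradient:
  "complex_gradient cos_lift cos_lift_gradient {z. cos z \<notin> E}"
proof -
  have "complex_gradient (\<lambda>z. g (cos z)) (\<lambda>z. f (cos z) * deriv cos z) {z. cos z \<notin> E}"
  proof (rule complex_gradient_compose[OF green_data_basics(3)])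
    have "open ((cos :: complex \<Rightarrow> complex) -` (- E))"
      by (intro open_vimage continuous_intros) (use green_data_basics(1) compact_imp_closed in auto)
    then show "open {z. cos z \<notin> E}" by (simp add: vimage_def)
  qed (auto intro!: holomorphic_intros)
  moreover have "deriv cos z = - sin z" for z :: complex
    by (rule DERIV_imp_deriv) (auto intro!: derivative_eq_intros)
  ultimately show ?thesis by (simp add: cos_lift_def[abs_def] cos_lift_gradient_def[abs_def])
qed

lemma cos_lift_complex_gradient_upper:
  "complex_gradient cos_lift cos_lift_gradient {z. 0 < Im z}"
proof (rule complex_gradient_subset[OF cos_lift_complex_gradient open_halfspace_Im_gt])
  show "{z. 0 < Im z} \<subseteq> {z. cos z \<notin> E}"
    using cos_notin_unit_segment green_data_basics(2) by force
qed

lemma cos_lift_nonneg: "0 \<le> cos_lift z"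
  by (simp add: cos_lift_def green_data_nonneg)

lemma continuous_on_cos_lift: "continuous_on UNIV cos_lift"
  unfolding cos_lift_def[abs_def]
  by (rule continuous_on_compose2[OF green_data_basics(4)]) (auto intro!: continuous_intros)

lemma cos_lift_cnj: "cos_lift (cnj z) = cos_lift z"
  by (metis cnj_cos cos_lift_def green_data_basics(6))

text \<open>Where \<open>sin (Re z) = 0\<close>, \<open>cos z\<close> is real and
  \<open>sin z\<close> is imaginary; so \<open>f (cos z)\<close> is real and the product
  imaginary.\<close>

lemma cos_lift_gradient_on_sides:
  assumes "sin (Re z) = 0" "cos z \<notin> E"
  shows "Re (cos_lift_gradient z) = 0"
proof -
  have "cos z \<in> \<real>" using assms by (simp add: complex_is_Real_iff Im_cos)
  then have "Im (f (cos z)) = 0" using green_data_gradient_real assms by blast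
  moreover have "Re (sin z) = 0" using assms by (simp add: Re_sin)
  ultimately show ?thesis by (simp add: cos_lift_gradient_def)
qed

lemma cos_lift_at_height_top: "((\<lambda>z. cos_lift z - Im z) \<longlongrightarrow> \<gamma> - ln 2) at_height_top"
proof -
  have "((\<lambda>z. (g (cos z) - ln (norm (cos z))) + (ln (norm (cos z)) - Im z)) \<longlongrightarrow> \<gamma> + - ln 2) at_height_top"
    by (intro tendsto_add tendsto_ln_norm_cos filterlim_compose[OF green_data_basics(8) filterlim_cos_at_height_top])
  then show ?thesis by (simp add: cos_lift_def)
qed

text \<open>With \<open>w = cos z\<close> the sum splits into
  \<open>- (w * f w - 1) * sin z / w\<close> and \<open>\<i> * exp (\<i> * z) / w\<close>. The first
  term is of order \<open>1 / \<bar>w\<bar>\<close> by the rate at infinity, the second is smaller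
  still, and this exponential decay absorbs the factor \<open>Im z\<close>.\<close>

lemma cos_lift_gradient_at_height_top:
  "((\<lambda>z. of_real (Im z) * (cos_lift_gradient z + \<i>)) \<longlongrightarrow> 0) at_height_top"
proof -
  have "complex_gradient g f {z. 1 < norm z}"
  proof (rule complex_gradient_subset[OF green_data_basics(3)])
    have "norm z \<le> 1" if "z \<in> E" for z
    proof -
      obtain t where "z = of_real t" "-1 \<le> t" "t \<le> 1"
        using \<open>z \<in> E\<close> green_data_basics(2) by (force simp: real_segment_def)
      then show ?thesis by simp
    qed
    then show "{z. 1 < norm z} \<subseteq> - E" by force
  qed (auto intro!: open_Collect_less continuous_intros)
  from log_pole_expansion[OF this green_data_basics(7)]
  obtain C M where CM: "\<And>z. M \<le> norm z \<Longrightarrow> norm (z * f z - 1) \<le> C / norm z" by metis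
  have "filterlim (\<lambda>z::complex. norm (cos z)) at_top at_height_top"
    using filterlim_cos_at_height_top by (simp add: filterlim_at_infinity_conv_norm_at_top)
  then have "eventually (\<lambda>z::complex. M \<le> norm (cos z)) at_height_top" by (simp add: filterlim_at_top)
  then obtain N where N: "\<And>z. N \<le> Im z \<Longrightarrow> M \<le> norm (cos z)"
    by (auto simp: eventually_filtercomap_at_top_linorder)
  show ?thesis
  proof (rule at_height_top_tendstoI[where N = N])
    show "((\<lambda>y. y * (\<bar>C\<bar> * cosh y / (sinh y)\<^sup>2 + exp (- y) / sinh y)) \<longlongrightarrow> 0) at_top" by real_asymp
    fix z assume z: "1 \<le> Im z" "N \<le> Im z"
    define w where "w = cos z"
    have sinh: "0 < sinh (Im z)" "sinh (Im z) \<le> norm w" using z norm_cos_sin_bounds(1)[of z] by (auto simp: w_def)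
    then have w0: "w \<noteq> 0" by auto
    have "sin z - \<i> * cos z = - \<i> * exp (\<i> * z)" by (simp add: exp_Euler algebra_simps)
    then have "cos_lift_gradient z + \<i> = - ((w * f w - 1) * sin z / w) + \<i> * exp (\<i> * z) / w"
      using w0 by (simp add: cos_lift_gradient_def w_def[symmetric] field_simps)
    also have "norm \<dots> \<le> norm ((w * f w - 1) * sin z / w) + norm (\<i> * exp (\<i> * z) / w)"
      using norm_triangle_ineq[of "- ((w * f w - 1) * sin z / w)"] by (simp only: norm_minus_cancel)
    also have "norm ((w * f w - 1) * sin z / w) \<le> (\<bar>C\<bar> / sinh (Im z)) * cosh (Im z) / sinh (Im z)"
      unfolding norm_mult norm_divide
    proof (intro frac_le mult_mono)
      have "norm (w * f w - 1) \<le> C / norm w" using CM[OF N[OF z(2)]] by (simp add: w_def)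
      also have "\<dots> \<le> \<bar>C\<bar> / sinh (Im z)" using sinh by (intro frac_le) auto
      finally show "norm (w * f w - 1) \<le> \<bar>C\<bar> / sinh (Im z)" .
    qed (use sinh norm_cos_sin_bounds(2)[of z] z in auto)
    also have "norm (\<i> * exp (\<i> * z) / w) \<le> exp (- Im z) / sinh (Im z)"
      using sinh by (auto simp: norm_mult norm_divide norm_exp_eq_Re intro!: divide_left_mono mult_pos_pos)
    finally have "norm (cos_lift_gradient z + \<i>) \<le> (\<bar>C\<bar> / sinh (Im z)) * cosh (Im z) / sinh (Im z) + exp (- Im z) / sinh (Im z)"
      by simp
    then have "Im z * norm (cos_lift_gradient z + \<i>) \<le> Im z * (\<bar>C\<bar> * cosh (Im z) / (sinh (Im z))\<^sup>2 + exp (- Im z) / sinh (Im z))"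
      using z by (intro mult_left_mono) (auto simp: power2_eq_square)
    then show "norm (of_real (Im z) * (cos_lift_gradient z + \<i>)) \<le> Im z * (\<bar>C\<bar> * cosh (Im z) / (sinh (Im z))\<^sup>2 + exp (- Im z) / sinh (Im z))"
      using z by (simp add: norm_mult)
  qed
qed

text \<open>\<open>z \<mapsto> z - 2 * \<i> * \<eta>\<close> composed with conjugation is the reflection in the line \<open>Im z = \<eta>\<close>,
  so the claim compares \<open>cos_lift\<close> with its mirror image.\<close>

lemma cos_lift_reflection:
  assumes \<eta>: "0 < \<eta>" and z: "\<eta> < Im z" "cos (z - 2 * \<i> * of_real \<eta>) \<notin> E"
  shows "cos_lift (z - 2 * \<i> * of_real \<eta>) \<le> cos_lift z"
proof -
  define \<tau> where "\<tau> = (\<lambda>z. z - 2 * \<i> * of_real \<eta>)"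
  define D where "D = (\<lambda>z. cos_lift z - cos_lift (\<tau> z))"
  define S where "S = {z. \<eta> < Im z} \<inter> {z. cos (\<tau> z) \<notin> E}"
  have cD: "continuous_on UNIV D"
    unfolding D_def \<tau>_def
    by (intro continuous_intros continuous_on_cos_lift continuous_on_compose2[OF continuous_on_cos_lift]) auto
  have "open ((\<lambda>z. cos (\<tau> z)) -` (- E))"
    unfolding \<tau>_def by (intro open_vimage continuous_intros) (use green_data_basics(1) compact_imp_closed in auto)
  then have S: "open S"
    unfolding S_def by (intro open_Int open_halfspace_Im_gt) (simp add: vimage_def)
  have "complex_gradient D (\<lambda>z. cos_lift_gradient z - cos_lift_gradient (\<tau> z) * deriv \<tau> z) S"
    unfolding D_def
  proof (rule complex_gradient_diff)
    show "complex_gradient cos_lift cos_lift_gradient S"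
      using complex_gradient_subset[OF cos_lift_complex_gradient_upper S] \<eta> by (force simp: S_def)
    show "complex_gradient (\<lambda>z. cos_lift (\<tau> z)) (\<lambda>z. cos_lift_gradient (\<tau> z) * deriv \<tau> z) S"
      by (rule complex_gradient_compose[OF cos_lift_complex_gradient S])
        (auto simp: S_def \<tau>_def intro!: holomorphic_intros)
  qed
  then have harm: "harmonic_on D S" by (rule harmonic_on_complex_gradient)
  have "((\<lambda>z. (cos_lift z - Im z) - (\<gamma> - ln 2)) \<longlongrightarrow> (\<gamma> - ln 2) - (\<gamma> - ln 2)) at_height_top"
    by (intro tendsto_intros cos_lift_at_height_top)
  then have "((\<lambda>z. (cos_lift z - Im z) - (\<gamma> - ln 2)) \<longlongrightarrow> 0) at_height_top" by simp
  from tendstoD[OF this \<eta>] obtain N where N: "\<And>z. N \<le> Im z \<Longrightarrow> \<bar>(cos_lift z - Im z) - (\<gamma> - ln 2)\<bar> < \<eta>"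
    by (auto simp: eventually_filtercomap_at_top_linorder dist_real_def)
  \<comment> \<open>At both points \<open>cos_lift - Im\<close> is within \<open>\<eta>\<close> of
    its limit, while their heights differ by \<open>2 * \<eta>\<close>.\<close>
  have D_pos: "0 < D z" if "N + 2 * \<eta> \<le> Im z" for z
    using N[of z] N[of "\<tau> z"] that \<eta> by (auto simp: D_def \<tau>_def)
  have "0 \<le> D z"
  proof (rule weak_minimum_principle[OF harm])
    show "z \<in> S" using z by (simp add: S_def \<tau>_def)
    fix e :: real assume e: "0 < e"
    \<comment> \<open>One period suffices, as \<open>D\<close> has period \<open>2 * pi\<close> in
      the real direction. The closed box part lies inside \<open>S\<close> because \<open>D\<close>
      vanishes on \<open>Im z = \<eta>\<close> by conjugation symmetry and is nonnegative wherever
      \<open>cos (\<tau> z)\<close> lies in \<open>E\<close>.\<close>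
    define K where "K = cbox (Complex 0 \<eta>) (Complex (2 * pi) (N + 2 * \<eta>)) \<inter> {z. D z \<le> - e}"
    have "compact K" unfolding K_def
      by (intro compact_Int_closed closed_Collect_le cD continuous_on_const compact_cbox)
    moreover have "K \<subseteq> S"
    proof
      fix w assume w: "w \<in> K"
      then have Dw: "D w \<le> - e" and Im: "\<eta> \<le> Im w" by (auto simp: K_def in_cbox_complex_iff)
      have "Im w \<noteq> \<eta>"
      proof
        assume "Im w = \<eta>"
        then have "\<tau> w = cnj w" by (simp add: \<tau>_def complex_eq_iff)
        then show False using Dw e by (simp add: D_def cos_lift_cnj)
      qed
      moreover have "cos (\<tau> w) \<notin> E"
      proof
        assume "cos (\<tau> w) \<in> E"
        then have "cos_lift (\<tau> w) = 0" by (simp add: cos_lift_def green_data_basics)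
        then show False using Dw e cos_lift_nonneg[of w] by (simp add: D_def)
      qed
      ultimately show "w \<in> S" using Im by (simp add: S_def)
    qed
    moreover have "\<exists>w\<in>K. D w = D z \<and> Im w = Im z" if z: "z \<in> S" "D z \<le> - e" for z
    proof -
      define m where "m = \<lfloor>Re z / (2 * pi)\<rfloor>"
      define w where "w = z - of_int m * (2 * of_real pi)"
      have per: "cos_lift (u - of_int m * (2 * of_real pi)) = cos_lift u" for u
        by (simp add: cos_lift_def cos.minus_of_int)
      have "\<tau> w = \<tau> z - of_int m * (2 * of_real pi)" by (simp add: w_def \<tau>_def)
      then have "D w = D z" using per by (simp add: D_def w_def)
      moreover have Imw: "Im w = Im z" by (simp add: w_def)
      moreover have "0 \<le> Re w" "Re w \<le> 2 * pi"
        using floor_divide_lower[of "2 * pi" "Re z"] floor_divide_upper[of "2 * pi" "Re z"]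
        by (auto simp: w_def m_def algebra_simps)
      moreover have "Im z < N + 2 * \<eta>" using D_pos[of z] z e by force
      moreover have "\<eta> < Im z" using z by (simp add: S_def)
      ultimately show ?thesis using z by (intro bexI[of _ w]) (auto simp: K_def in_cbox_complex_iff)
    qed
    ultimately show "\<exists>K. compact K \<and> K \<subseteq> S \<and> (\<forall>z\<in>S. D z \<le> - e \<longrightarrow> (\<exists>w\<in>K. D w = D z \<and> Im w = Im z))"
      by blast
  qed
  then show ?thesis by (simp add: D_def \<tau>_def)
qed

text \<open>Comparison with the mirror image in the horizontal line at height \<open>\<eta>\<close>
  says that the value at height \<open>\<eta> + t\<close> is at least the value at
  \<open>\<eta> - t\<close>. Differentiating at \<open>t = 0\<close> gives a nonnegative vertical
  derivative, which is \<open>- Im\<close> of the gradient.\<close>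

lemma cos_lift_gradient_Im_nonpos:
  assumes z: "0 < Im z" shows "Im (cos_lift_gradient z) \<le> 0"
proof (rule ccontr)
  assume neg: "\<not> Im (cos_lift_gradient z) \<le> 0"
  define x \<eta> where "x = Re z" and "\<eta> = Im z"
  define h where "h = (\<lambda>t. cos_lift (Complex x (\<eta> + t)) - cos_lift (Complex x (\<eta> - t)))"
  have "((\<lambda>y. cos_lift (Complex x y)) has_real_derivative - Im (cos_lift_gradient z)) (at \<eta>)"
    using complex_gradient_coordinate_derivs(2)[OF cos_lift_complex_gradient_upper, of x \<eta>] z
    by (simp add: x_def \<eta>_def)
  then have "(h has_real_derivative (- Im (cos_lift_gradient z)) * 1 - (- Im (cos_lift_gradient z)) * (- 1)) (at 0)"
    unfolding h_def
    by (intro DERIV_diff DERIV_chain2[where f = "\<lambda>y. cos_lift (Complex x y)"]) (auto intro!: derivative_eq_intros)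
  then have h': "(h has_real_derivative - 2 * Im (cos_lift_gradient z)) (at 0)" by simp
  obtain d where d: "0 < d" "\<And>t. 0 < t \<Longrightarrow> t < d \<Longrightarrow> h t < h 0"
    using DERIV_neg_dec_right[OF h'] neg by auto
  define t where "t = min d \<eta> / 2"
  have t: "0 < t" "t < d" "t < \<eta>" using d z by (auto simp: t_def \<eta>_def)
  define w where "w = Complex x (\<eta> + t)"
  have eq: "w - 2 * \<i> * of_real \<eta> = cnj (Complex x (\<eta> - t))" by (simp add: w_def complex_eq_iff)
  have "cos (w - 2 * \<i> * of_real \<eta>) \<notin> E"
    using cos_notin_unit_segment[of "cnj (Complex x (\<eta> - t))"] t green_data_basics(2) unfolding eq by auto
  then have "cos_lift (w - 2 * \<i> * of_real \<eta>) \<le> cos_lift w"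
    using t z by (intro cos_lift_reflection) (auto simp: w_def \<eta>_def)
  then have "0 \<le> h t" unfolding eq by (simp add: cos_lift_cnj h_def w_def)
  moreover have "h 0 = 0" by (simp add: h_def)
  ultimately show False using d(2)[OF t(1,2)] by simp
qed

end


section \<open>Potentials with inverse square root singularities\<close>

text \<open>Uniform continuity on the compact set over \<open>K\<close> turns vanishing on the axis
  into a bound uniform in \<open>x\<close>.\<close>

lemma uniformly_small_near_real_axis:
  fixes h :: "complex \<Rightarrow> real"
  assumes K: "compact K" and h: "continuous_on {z. Re z \<in> K \<and> Im z \<in> {0..1}} h"
    and zero: "\<And>x. x \<in> K \<Longrightarrow> h (of_real x) = 0" and \<eta>: "0 < \<eta>"
  shows "eventually (\<lambda>y. \<forall>x\<in>K. \<bar>h (Complex x y)\<bar> < \<eta>) (at_right 0)"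
proof -
  define S where "S = (\<lambda>(x, y). Complex x y) ` (K \<times> {0..1})"
  have S: "S = {z. Re z \<in> K \<and> Im z \<in> {0..1}}"
  proof (intro set_eqI iffI)
    fix z assume "z \<in> {z. Re z \<in> K \<and> Im z \<in> {0..1}}"
    then show "z \<in> S" unfolding S_def by (intro image_eqI[of _ _ "(Re z, Im z)"]) auto
  qed (auto simp: S_def)
  have "compact S"
    unfolding S_def case_prod_beta'
    by (intro compact_continuous_image compact_Times K continuous_intros) auto
  then have "uniformly_continuous_on S h"
    using h unfolding S by (rule compact_uniformly_continuous[rotated])
  then obtain d where d: "0 < d" "\<And>z w. z \<in> S \<Longrightarrow> w \<in> S \<Longrightarrow> dist w z < d \<Longrightarrow> dist (h w) (h z) < \<eta>"
    unfolding uniformly_continuous_on_def using \<eta> by metis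
  have "\<forall>x\<in>K. \<bar>h (Complex x y)\<bar> < \<eta>" if "0 < y" "y < min d 1" for y
  proof
    fix x assume x: "x \<in> K"
    have "Complex x y - of_real x = \<i> * of_real y" by (simp add: complex_eq_iff)
    then have "dist (Complex x y) (of_real x) = y" using that by (simp add: dist_norm norm_mult)
    then have "dist (h (Complex x y)) (h (of_real x)) < \<eta>"
      using x that by (intro d(2)) (auto simp: S)
    then show "\<bar>h (Complex x y)\<bar> < \<eta>" using zero[OF x] by (simp add: dist_real_def)
  qed
  then show ?thesis
    using d(1) by (auto simp: eventually_at_right_field intro!: exI[of _ "min d 1"])
qed

text \<open>The bound \<open>C / sqrt (Im z)\<close> is integrable along vertical lines: raising a
  point from offset \<open>s\<close> to offset \<open>t\<close> changes a primitive by at most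
  \<open>2 * \<bar>C\<bar> * sqrt t\<close>. The vertically shifted primitives are therefore
  uniformly Cauchy on bounded parts of the closed half-plane, and their limit is continuous up to
  the axis.\<close>

lemma upper_half_plane_primitive:
  assumes F: "F holomorphic_on {z. 0 < Im z}"
    and bound: "\<And>R. \<exists>C. \<forall>z. 0 < Im z \<longrightarrow> norm z \<le> R \<longrightarrow> norm (F z) \<le> C / sqrt (Im z)"
  obtains G where "continuous_on {z. 0 \<le> Im z} G"
    "\<And>z. 0 < Im z \<Longrightarrow> (G has_field_derivative F z) (at z)"
proof -
  let ?H = "{z. 0 < Im z}"
  obtain G0 where "\<And>z. z \<in> ?H \<Longrightarrow> (G0 has_field_derivative F z) (at z within ?H)"
    using holomorphic_convex_primitive'[OF convex_halfspace_Im_gt open_halfspace_Im_gt F] by metis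
  then have G0: "(G0 has_field_derivative F z) (at z)" if "0 < Im z" for z
    using that at_within_open[of z ?H] open_halfspace_Im_gt by (metis mem_Collect_eq)
  have cG0: "continuous_on ?H G0"
    using G0 by (auto intro!: continuous_at_imp_continuous_on DERIV_isCont)
  define u where "u = (\<lambda>m::nat. inverse (real (Suc m)))"
  have u: "0 < u m" "u m \<le> 1" for m by (auto simp: u_def field_simps)
  have u0: "u \<longlonglongrightarrow> 0" unfolding u_def by (rule LIMSEQ_inverse_real_of_nat)
  define Gs where "Gs = (\<lambda>m z. G0 (z + \<i> * of_real (u m)))"
  define G where "G = (\<lambda>z. lim (\<lambda>m. Gs m z))"
  define X where "X = (\<lambda>R. {z. 0 \<le> Im z} \<inter> ball (0::complex) R)"
  have diff: "\<exists>C\<ge>0. \<forall>z\<in>X R. \<forall>s t. 0 < s \<longrightarrow> s \<le> t \<longrightarrow> t \<le> 1 \<longrightarrow>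
      norm (G0 (z + \<i> * of_real t) - G0 (z + \<i> * of_real s)) \<le> C * sqrt t" for R
  proof -
    obtain C where C: "\<And>z. 0 < Im z \<Longrightarrow> norm z \<le> R + 1 \<Longrightarrow> norm (F z) \<le> C / sqrt (Im z)"
      using bound[of "R + 1"] by metis
    have "norm (G0 (z + \<i> * of_real t) - G0 (z + \<i> * of_real s)) \<le> 2 * \<bar>C\<bar> * sqrt t"
      if z: "z \<in> X R" and st: "0 < s" "s \<le> t" "t \<le> 1" for z s t
    proof (cases "s = t")
      case False
      have pos: "0 < Im (z + \<i> * of_real r)" if "0 < r" for r using z that by (simp add: X_def)
      have "norm (G0 (z + \<i> * of_real t) - G0 (z + \<i> * of_real s)) \<le> 2 * \<bar>C\<bar> * sqrt t - 2 * \<bar>C\<bar> * sqrt s"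
      proof (rule differentiable_bound_general[where f' = "\<lambda>r. \<i> * F (z + \<i> * of_real r)" and \<phi>' = "\<lambda>r. \<bar>C\<bar> / sqrt r"])
        show "continuous_on {s..t} (\<lambda>r. G0 (z + \<i> * of_real r))"
          by (rule continuous_on_compose2[OF cG0]) (use st pos in \<open>auto intro!: continuous_intros\<close>)
        fix r assume r: "s < r" "r < t"
        have "((\<lambda>r. z + \<i> * of_real r) has_vector_derivative \<i>) (at r)"
          by (auto intro!: derivative_eq_intros)
        note 1 = field_vector_diff_chain_at[OF this]
        have "0 < r" using r st by simp
        show "((\<lambda>r. G0 (z + \<i> * of_real r)) has_vector_derivative \<i> * F (z + \<i> * of_real r)) (at r)"
          by (rule 1[OF G0[OF pos[OF \<open>0 < r\<close>]], unfolded o_def])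
        have "((\<lambda>r. 2 * \<bar>C\<bar> * sqrt r) has_real_derivative 2 * \<bar>C\<bar> * (inverse (sqrt r) / 2)) (at r)"
          by (intro DERIV_cmult DERIV_real_sqrt) (use r st in auto)
        moreover have "2 * c * (inverse q / 2) = c / q" for c q :: real by (simp add: field_simps)
        ultimately show "((\<lambda>r. 2 * \<bar>C\<bar> * sqrt r) has_vector_derivative \<bar>C\<bar> / sqrt r) (at r)"
          unfolding has_real_derivative_iff_has_vector_derivative by metis
        have "norm (z + \<i> * of_real r) \<le> norm z + r"
          using norm_triangle_ineq[of z "\<i> * of_real r"] r st by (simp add: norm_mult)
        then have "norm (z + \<i> * of_real r) \<le> R + 1" using z r st by (simp add: X_def)
        then have "norm (F (z + \<i> * of_real r)) \<le> C / sqrt (Im (z + \<i> * of_real r))"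
          using r st by (intro C pos) auto
        also have "\<dots> \<le> \<bar>C\<bar> / sqrt r"
          using z r st by (intro frac_le) (auto simp: X_def)
        finally show "norm (\<i> * F (z + \<i> * of_real r)) \<le> \<bar>C\<bar> / sqrt r" by (simp add: norm_mult)
      qed (use st False in \<open>auto intro!: continuous_intros\<close>)
      also have "\<dots> \<le> 2 * \<bar>C\<bar> * sqrt t" using st by simp
      finally show ?thesis .
    qed (use st in auto)
    then show ?thesis by (intro exI[of _ "2 * \<bar>C\<bar>"]) auto
  qed
  have ul: "uniform_limit (X R) Gs G sequentially" for R
  proof -
    obtain C where C: "0 \<le> C" "\<And>z s t. z \<in> X R \<Longrightarrow> 0 < s \<Longrightarrow> s \<le> t \<Longrightarrow> t \<le> 1 \<Longrightarrow>
      norm (G0 (z + \<i> * of_real t) - G0 (z + \<i> * of_real s)) \<le> C * sqrt t"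
      using diff[of R] by metis
    have "uniformly_Cauchy_on (X R) Gs"
      unfolding uniformly_Cauchy_on_def
    proof (intro allI impI)
      fix e :: real assume e: "0 < e"
      have "(\<lambda>m. C * sqrt (u m)) \<longlonglongrightarrow> C * sqrt 0" by (intro tendsto_intros u0)
      then have "eventually (\<lambda>m. C * sqrt (u m) < e) sequentially"
        using e by (intro order_tendstoD(2)) auto
      then obtain M where M: "\<And>m. M \<le> m \<Longrightarrow> C * sqrt (u m) < e" by (auto simp: eventually_sequentially)
      have "dist (Gs m z) (Gs k z) < e" if "z \<in> X R" "M \<le> m" "m \<le> k" for z m k
      proof -
        have "u k \<le> u m" using that by (simp add: u_def field_simps)
        then have "norm (Gs m z - Gs k z) \<le> C * sqrt (u m)"
          unfolding Gs_def by (intro C(2) that u)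
        then show ?thesis using M[OF that(2)] by (simp add: dist_norm)
      qed
      then have "dist (Gs m z) (Gs k z) < e" if "z \<in> X R" "M \<le> m" "M \<le> k" for z m k
        using that by (metis dist_commute nat_le_linear)
      then show "\<exists>M. \<forall>z\<in>X R. \<forall>m\<ge>M. \<forall>k\<ge>M. dist (Gs m z) (Gs k z) < e" by blast
    qed
    then show ?thesis
      unfolding G_def by (simp add: Cauchy_uniformly_convergent flip: uniformly_convergent_uniform_limit_iff)
  qed
  have cX: "continuous_on (X R) G" for R
  proof (rule uniform_limit_theorem[OF _ ul])
    show "\<forall>\<^sub>F m in sequentially. continuous_on (X R) (Gs m)"
      unfolding Gs_def
      by (intro always_eventually allI continuous_on_compose2[OF cG0] continuous_intros)
         (simp add: X_def image_subset_iff add_nonneg_pos[OF _ u(1)])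
  qed simp
  have "continuous_on {z. 0 \<le> Im z} G"
    unfolding continuous_on_eq_continuous_within
  proof
    fix z assume z: "z \<in> {z. 0 \<le> Im z}"
    have "continuous (at z within X (norm z + 1)) G"
      using cX[of "norm z + 1"] z by (auto simp: continuous_on_eq_continuous_within X_def)
    moreover have "at z within X (norm z + 1) = at z within {z. 0 \<le> Im z}"
      by (rule at_within_nhd[of z "ball 0 (norm z + 1)"]) (auto simp: X_def)
    ultimately show "continuous (at z within {z. 0 \<le> Im z}) G" by simp
  qed
  moreover have "(G has_field_derivative F z) (at z)" if z: "0 < Im z" for z
  proof (rule has_field_derivative_transform_within_open[OF G0[OF z] open_halfspace_Im_gt, of 0])
    fix w assume w: "w \<in> ?H"
    have "(\<lambda>m. Gs m w) \<longlonglongrightarrow> G w"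
      by (rule tendsto_uniform_limitI[OF ul[of "norm w + 1"]]) (use w in \<open>auto simp: X_def\<close>)
    moreover have "(\<lambda>m. w + \<i> * of_real (u m)) \<longlonglongrightarrow> w + \<i> * of_real 0"
      by (intro tendsto_intros u0)
    then have "(\<lambda>m. Gs m w) \<longlonglongrightarrow> G0 w"
      unfolding Gs_def using w by (intro isCont_tendsto_compose[OF DERIV_isCont[OF G0]]) auto
    ultimately show "G0 w = G w" using LIMSEQ_unique by blast
  qed (use z in auto)
  ultimately show ?thesis using that by blast
qed

text \<open>\<open>g\<close> is the even reflection of \<open>Re G\<close>. At real points off
  \<open>E\<close> it has gradient \<open>F\<close> because a local primitive of \<open>F\<close>
  has a real part that is itself even. For the last clause a horizontal segment is moved down to the
  axis: \<open>Re F\<close> becomes uniformly small on it, and so does the change of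
  \<open>g\<close> along it.\<close>

lemma potential_with_real_singularities:
  assumes E: "closed E" "E \<subseteq> \<real>"
    and F: "F holomorphic_on - E" "\<And>z. z \<notin> E \<Longrightarrow> F (cnj z) = cnj (F z)"
    and bound: "\<And>R. \<exists>C. \<forall>z. 0 < Im z \<longrightarrow> norm z \<le> R \<longrightarrow> norm (F z) \<le> C / sqrt (Im z)"
  shows "\<exists>g. continuous_on UNIV g \<and> complex_gradient g F (- E) \<and> (\<forall>z. g (cnj z) = g z) \<and>
    (\<forall>x1 x2. x1 < x2 \<longrightarrow> continuous_on {z. Re z \<in> {x1..x2} \<and> Im z \<in> {0..1}} F \<longrightarrow>
       (\<forall>x\<in>{x1..x2}. Re (F (of_real x)) = 0) \<longrightarrow> g (of_real x1) = g (of_real x2))"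
proof -
  let ?H = "{z. 0 < Im z}"
  have HE: "?H \<subseteq> - E" using E by (auto simp: complex_is_Real_iff)
  obtain G where cG: "continuous_on {z. 0 \<le> Im z} G"
    and G: "\<And>z. 0 < Im z \<Longrightarrow> (G has_field_derivative F z) (at z)"
    using upper_half_plane_primitive[OF holomorphic_on_subset[OF F(1) HE] bound] by metis
  define up where "up = (\<lambda>z. Complex (Re z) \<bar>Im z\<bar>)"
  define g where "g = (\<lambda>z. Re (G (up z)))"
  have cg: "continuous_on UNIV g"
    unfolding g_def up_def
    by (intro continuous_intros continuous_on_compose2[OF cG]) auto
  have gcnj: "g (cnj z) = g z" for z by (simp add: g_def up_def)
  have up_id: "up z = z" if "0 \<le> Im z" for z using that by (simp add: up_def complex_eq_iff)
  have upper: "(g has_derivative (\<lambda>h. Re (F z * h))) (at z)" if z: "0 < Im z" for z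
  proof (rule has_derivative_transform_within_open[OF _ open_halfspace_Im_gt])
    show "((\<lambda>z. Re (G z)) has_derivative (\<lambda>h. Re (F z * h))) (at z)"
      using G[OF z] by (intro has_derivative_Re) (simp add: has_field_derivative_def)
  qed (use z in \<open>auto simp: g_def up_id\<close>)
  have "(g has_derivative (\<lambda>h. Re (F z * h))) (at z)" if z: "z \<notin> E" for z
  proof -
    consider "0 < Im z" | "Im z < 0" | "Im z = 0" by linarith
    then show ?thesis
    proof cases
      case 1 then show ?thesis by (rule upper)
    next
      case 2
      then have "(g has_derivative (\<lambda>h. Re (F (cnj z) * h))) (at (cnj z))" by (intro upper) simp
      then have "((\<lambda>z. g (cnj z)) has_derivative (\<lambda>h. Re (F (cnj z) * cnj h))) (at z)"
        by (rule has_derivative_compose[of cnj cnj z UNIV, rotated])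
           (auto intro!: bounded_linear_imp_has_derivative bounded_linear_cnj)
      moreover have "Re (F (cnj z) * cnj h) = Re (F z * h)" for h
        by (simp add: F(2)[OF z])
      ultimately show ?thesis by (simp add: gcnj del: times_complex.sel)
    next
      case 3
      have cz: "cnj z = z" using 3 by (simp add: complex_eq_iff)
      obtain r where r: "0 < r" "ball z r \<subseteq> - E" using E(1) z openE[of "- E" z] by auto
      let ?D = "ball z r"
      have cnjD: "cnj w \<in> ?D" if "w \<in> ?D" for w
      proof -
        have "dist z (cnj w) = norm (cnj (z - w))" by (simp add: dist_norm cz)
        then show ?thesis using that by (simp add: dist_norm del: complex_cnj_diff)
      qed
      have upD: "up w \<in> ?D" if "w \<in> ?D" for w
      proof -
        have "up w = w \<or> up w = cnj w" by (auto simp: up_def complex_eq_iff abs_if)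
        then show ?thesis using cnjD[OF that] that by auto
      qed
      obtain P where "\<And>x. x \<in> ?D \<Longrightarrow> (P has_field_derivative F x) (at x within ?D)"
        using holomorphic_convex_primitive'[OF convex_ball open_ball holomorphic_on_subset[OF F(1) r(2)]] by metis
      then have P: "(P has_field_derivative F x) (at x)" if "x \<in> ?D" for x
        using that by (metis at_within_open open_ball)
      \<comment> \<open>\<open>Q\<close> is a second primitive of \<open>F\<close> by symmetry. So
        \<open>Q - P\<close> is constant, and its real part is 0 because
        \<open>Q z = cnj (P z)\<close> at the real centre \<open>z\<close>.\<close>
      define Q where "Q = (\<lambda>w. cnj (P (cnj w)))"
      have Q: "(Q has_field_derivative F x) (at x)" if "x \<in> ?D" for x
      proof -
        have "((cnj \<circ> P \<circ> cnj) has_field_derivative cnj (F (cnj x))) (at x)"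
          using P[OF cnjD[OF that]] by (simp add: has_field_derivative_cnj_cnj)
        then show ?thesis using F(2)[of x] that r(2) by (auto simp: Q_def o_def)
      qed
      have "Q w - P w = Q z - P z" if "w \<in> ?D" for w
      proof (rule has_derivative_zero_unique_connected[OF open_ball connected_ball _ that])
        fix x assume x: "x \<in> ?D"
        have "((\<lambda>w. Q w - P w) has_field_derivative F x - F x) (at x)" by (intro DERIV_diff Q P x)
        then show "((\<lambda>w. Q w - P w) has_derivative (\<lambda>h. 0)) (at x)"
          by (simp add: has_field_derivative_def lambda_zero)
      qed (use r in auto)
      then have ReQ: "Re (Q w) = Re (P w)" if "w \<in> ?D" for w
      proof -
        have "Re (Q w - P w) = Re (Q z - P z)" using \<open>\<And>w. w \<in> ?D \<Longrightarrow> Q w - P w = Q z - P z\<close>[OF that] by simp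
        then show ?thesis by (simp add: Q_def cz)
      qed
      have Rup: "Re (P (up w)) = Re (P w)" if "w \<in> ?D" for w
      proof -
        have "up w = w \<or> up w = cnj w" by (auto simp: up_def complex_eq_iff abs_if)
        then show ?thesis using ReQ[OF that] by (auto simp: Q_def)
      qed
      have DH: "open (?D \<inter> ?H)" "connected (?D \<inter> ?H)"
        by (auto intro!: convex_connected convex_Int convex_halfspace_Im_gt open_Int open_halfspace_Im_gt)
      define w0 where "w0 = z + \<i> * of_real (r / 2)"
      have w0: "w0 \<in> ?D \<inter> ?H" using r 3 by (simp add: w0_def dist_norm norm_mult)
      have const: "G w - P w = G w0 - P w0" if "w \<in> ?D \<inter> ?H" for w
      proof (rule has_derivative_zero_unique_connected[OF DH _ that w0])
        fix x assume x: "x \<in> ?D \<inter> ?H"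
        have "((\<lambda>w. G w - P w) has_field_derivative F x - F x) (at x)" by (intro DERIV_diff G P) (use x in auto)
        then show "((\<lambda>w. G w - P w) has_derivative (\<lambda>h. 0)) (at x)"
          by (simp add: has_field_derivative_def lambda_zero)
      qed
      \<comment> \<open>A limit from above carries the identity between \<open>G\<close> and
        \<open>P\<close> to the real points of the disc.\<close>
      have const': "G w - P w = G w0 - P w0" if w: "w \<in> ?D" "0 \<le> Im w" for w
      proof (rule tendsto_unique[of "at_right (0::real)"])
        have lim: "((\<lambda>t::real. w + \<i> * of_real t) \<longlongrightarrow> w) (at_right 0)"
        proof -
          have "((\<lambda>t::real. w + \<i> * of_real t) \<longlongrightarrow> w + \<i> * of_real 0) (at_right 0)" by (intro tendsto_intros)
          then show ?thesis by simp
        qed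
        have evD: "eventually (\<lambda>t::real. w + \<i> * of_real t \<in> ?D) (at_right 0)"
          using topological_tendstoD[OF lim open_ball w(1)] .
        have evp: "eventually (\<lambda>t::real. 0 < t) (at_right 0)" by (rule eventually_at_right_less)
        have "((\<lambda>t. G (w + \<i> * of_real t)) \<longlongrightarrow> G w) (at_right 0)"
          by (rule continuous_on_tendsto_compose[OF cG lim])
             (use w evp in \<open>auto elim!: eventually_mono\<close>)
        moreover have "((\<lambda>t. P (w + \<i> * of_real t)) \<longlongrightarrow> P w) (at_right 0)"
          by (rule isCont_tendsto_compose[OF DERIV_isCont[OF P[OF w(1)]] lim])
        ultimately show "((\<lambda>t. G (w + \<i> * of_real t) - P (w + \<i> * of_real t)) \<longlongrightarrow> G w - P w) (at_right 0)"
          by (rule tendsto_diff)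
        show "((\<lambda>t. G (w + \<i> * of_real t) - P (w + \<i> * of_real t)) \<longlongrightarrow> G w0 - P w0) (at_right 0)"
          by (rule tendsto_eventually) (use evD evp in \<open>eventually_elim, use w in \<open>auto intro!: const\<close>\<close>)
      qed simp
      have "((\<lambda>w. Re (P w) + Re (G w0 - P w0)) has_derivative (\<lambda>h. Re (F z * h))) (at z)"
        using P[of z] r(1) unfolding has_field_derivative_def
        by (intro has_derivative_add_const has_derivative_Re) auto
      then show ?thesis
      proof (rule has_derivative_transform_within_open[OF _ open_ball])
        fix w assume w: "w \<in> ?D"
        have "0 \<le> Im (up w)" by (simp add: up_def)
        then have "G (up w) = P (up w) + (G w0 - P w0)" using const'[OF upD[OF w]] by (simp add: algebra_simps)
        then show "Re (P w) + Re (G w0 - P w0) = g w" using Rup[OF w] by (simp add: g_def)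
      qed (use r in auto)
    qed
  qed
  then have grad: "complex_gradient g F (- E)"
    using E(1) F(1) by (auto simp: complex_gradient_def)
  have "g (of_real x1) = g (of_real x2)"
    if x: "x1 < x2" and cF: "continuous_on {z. Re z \<in> {x1..x2} \<and> Im z \<in> {0..1}} F"
      and re0: "\<And>x. x \<in> {x1..x2} \<Longrightarrow> Re (F (of_real x)) = 0" for x1 x2
  proof -
    define k where "k = (\<lambda>y. \<bar>g (Complex x2 y) - g (Complex x1 y)\<bar>)"
    have lim: "((\<lambda>y. g (Complex t y)) \<longlongrightarrow> g (of_real t)) (at_right 0)" for t
    proof (rule continuous_on_tendsto_compose[OF cg])
      have "((\<lambda>y. Complex t y) \<longlongrightarrow> Complex t 0) (at_right 0)" unfolding Complex_eq by (intro tendsto_intros)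
      then show "((\<lambda>y. Complex t y) \<longlongrightarrow> of_real t) (at_right 0)" by (simp add: Complex_eq)
    qed auto
    have "(k \<longlongrightarrow> \<bar>g (of_real x2) - g (of_real x1)\<bar>) (at_right 0)"
      unfolding k_def by (intro tendsto_intros lim)
    moreover have "(k \<longlongrightarrow> 0) (at_right 0)"
    proof (rule tendstoI)
      fix e :: real assume e: "0 < e"
      define \<eta> where "\<eta> = (e / 2) / (x2 - x1)"
      have "x2 - x1 \<noteq> 0" using x by simp
      then have "\<eta> * (x2 - x1) = e / 2"
        by (metis \<eta>_def nonzero_divide_eq_eq)
      then have \<eta>: "0 < \<eta>" "\<eta> * (x2 - x1) < e" using e x by (auto simp: \<eta>_def)
      have "eventually (\<lambda>y. \<forall>t\<in>{x1..x2}. \<bar>Re (F (Complex t y))\<bar> < \<eta>) (at_right 0)"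
        by (rule uniformly_small_near_real_axis[of _ "\<lambda>z. Re (F z)"]) (use \<eta> re0 cF in \<open>auto intro!: continuous_intros\<close>)
      then show "eventually (\<lambda>y. dist (k y) 0 < e) (at_right 0)"
        using eventually_at_right_less[of "0::real"]
      proof eventually_elim
        case (elim y)
        have "((\<lambda>t. g (Complex t y)) has_real_derivative Re (F (Complex t y))) (at t)" for t
        proof -
          have "((\<lambda>t. Complex t y) has_derivative (\<lambda>h. of_real h)) (at t)"
            unfolding Complex_eq by (auto intro!: derivative_eq_intros)
          from has_derivative_compose[OF this upper[of "Complex t y"]] elim
          show ?thesis by (simp add: has_field_derivative_def mult_commute_abs)
        qed
        then have "norm (g (Complex x2 y) - g (Complex x1 y)) \<le> \<eta> * norm (x2 - x1)"
          by (intro field_differentiable_bound[of "{x1..x2}" "\<lambda>t. g (Complex t y)" "\<lambda>t. Re (F (Complex t y))"])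
             (use elim x in \<open>auto intro: has_field_derivative_at_within less_imp_le\<close>)
        then show ?case using \<eta> x by (simp add: k_def)
      qed
    qed
    ultimately have "\<bar>g (of_real x2) - g (of_real x1)\<bar> = 0"
      by (rule tendsto_unique[rotated]) simp
    then show ?thesis by simp
  qed
  with cg grad gcnj show ?thesis by blast
qed


section \<open>Existence of the Green function of an interval system\<close>

text \<open>Gaussian elimination by induction: a nonzero entry of the last row is moved to the last
  column by a transposition and serves to eliminate the last unknown; if that row vanishes, the last
  unknown is set to 0.\<close>

lemma homogeneous_system_nontrivial:
  fixes A :: "nat \<Rightarrow> nat \<Rightarrow> real"
  shows "\<exists>c. (\<exists>j\<le>m. c j \<noteq> 0) \<and> (\<forall>k<m. (\<Sum>j\<le>m. A k j * c j) = 0)"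
proof (induction m arbitrary: A)
  case 0
  show ?case by (intro exI[of _ "\<lambda>_. 1"]) auto
next
  case (Suc m)
  have pivot: "\<exists>c. (\<exists>j\<le>Suc m. c j \<noteq> 0) \<and> (\<forall>k<Suc m. (\<Sum>j\<le>Suc m. B k j * c j) = 0)"
    if p: "B m (Suc m) \<noteq> 0" for B :: "nat \<Rightarrow> nat \<Rightarrow> real"
  proof -
    obtain c where c: "\<exists>j\<le>m. c j \<noteq> 0"
      "\<And>k. k < m \<Longrightarrow> (\<Sum>j\<le>m. (B k j - B k (Suc m) / B m (Suc m) * B m j) * c j) = 0"
      using Suc.IH[of "\<lambda>k j. B k j - B k (Suc m) / B m (Suc m) * B m j"] by blast
    define s where "s = (\<Sum>j\<le>m. B m j * c j)"
    define c' where "c' = (\<lambda>j. if j \<le> m then c j else - s / B m (Suc m))"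
    have sum: "(\<Sum>j\<le>Suc m. B k j * c' j) = (\<Sum>j\<le>m. B k j * c j) - B k (Suc m) / B m (Suc m) * s" for k
      by (simp add: c'_def)
    have "(\<Sum>j\<le>Suc m. B k j * c' j) = 0" if "k < Suc m" for k
    proof (cases "k = m")
      case True
      then show ?thesis using p unfolding sum by (simp add: s_def)
    next
      case False
      have "(\<Sum>j\<le>m. B k j * c j) - B k (Suc m) / B m (Suc m) * s
          = (\<Sum>j\<le>m. (B k j - B k (Suc m) / B m (Suc m) * B m j) * c j)"
        unfolding s_def sum_distrib_left by (simp add: left_diff_distrib sum_subtractf mult.assoc)
      then show ?thesis using c(2)[of k] False that unfolding sum by simp
    qed
    moreover have "\<exists>j\<le>Suc m. c' j \<noteq> 0" using c(1) by (auto simp: c'_def intro: le_SucI)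
    ultimately show ?thesis by (intro exI[of _ c'] conjI allI impI)
  qed
  show ?case
  proof (cases "\<exists>p\<le>Suc m. A m p \<noteq> 0")
    case True
    then obtain p where p: "p \<le> Suc m" "A m p \<noteq> 0" by blast
    define t where "t = Transposition.transpose p (Suc m)"
    obtain c where c: "\<exists>j\<le>Suc m. c j \<noteq> 0" "\<And>k. k < Suc m \<Longrightarrow> (\<Sum>j\<le>Suc m. A k (t j) * c j) = 0"
    proof -
      have "A m (t (Suc m)) \<noteq> 0" using p by (simp add: t_def)
      from pivot[of "\<lambda>k j. A k (t j)", OF this] show thesis using that by blast
    qed
    have t: "t permutes {..Suc m}" unfolding t_def using p by (intro permutes_swap_id) auto
    have tt: "t (t j) = j" for j by (simp add: t_def)
    have "(\<Sum>j\<le>Suc m. A k j * c (t j)) = 0" if "k < Suc m" for k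
      using c(2)[OF that] sum.permute[OF t, of "\<lambda>j. A k j * c (t j)"] by (simp add: o_def tt)
    moreover have "\<exists>j\<le>Suc m. c (t j) \<noteq> 0"
    proof -
      obtain j where "j \<le> Suc m" "c j \<noteq> 0" using c(1) by blast
      then show ?thesis using permutes_in_image[OF t, of j] by (intro exI[of _ "t j"]) (auto simp: tt)
    qed
    ultimately show ?thesis by (intro exI[of _ "\<lambda>j. c (t j)"] conjI allI impI)
  next
    case False
    obtain c where c: "\<exists>j\<le>m. c j \<noteq> 0" "\<And>k. k < m \<Longrightarrow> (\<Sum>j\<le>m. A k j * c j) = 0"
      using Suc.IH[of A] by blast
    define c' where "c' = (\<lambda>j. if j \<le> m then c j else 0)"
    have "(\<Sum>j\<le>Suc m. A k j * c' j) = 0" if "k < Suc m" for k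
    proof (cases "k = m")
      case True
      then show ?thesis using False by (intro sum.neutral) auto
    next
      case False
      then show ?thesis using c(2)[of k] that by (simp add: c'_def)
    qed
    moreover have "\<exists>j\<le>Suc m. c' j \<noteq> 0" using c(1) by (auto simp: c'_def intro: le_SucI)
    ultimately show ?thesis by (intro exI[of _ c'] conjI allI impI)
  qed
qed

text \<open>The points are distinct, so at most one factor can be small, and that one is at least
  \<open>Im z\<close>. Near \<open>e\<close> all other factors are at least \<open>d\<close>; away
  from \<open>e\<close> the induction hypothesis applies.\<close>

lemma prod_dist_ge_Im:
  fixes A :: "real set"
  assumes "finite A" "A \<noteq> {}"
  shows "\<exists>c>0. \<forall>z. 0 < Im z \<longrightarrow> c * Im z \<le> (\<Prod>e\<in>A. norm (z - complex_of_real e))"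
  using assms
proof (induction A rule: finite_ne_induct)
  case (singleton e)
  have "Im z \<le> norm (z - of_real e)" for z using abs_Im_le_cmod[of "z - of_real e"] by simp
  then show ?case by (intro exI[of _ 1]) auto
next
  case (insert e A)
  obtain c where c: "0 < c" "\<And>z. 0 < Im z \<Longrightarrow> c * Im z \<le> (\<Prod>e\<in>A. norm (z - complex_of_real e))"
    using insert.IH by blast
  define d where "d = Min ((\<lambda>x. \<bar>x - e\<bar>) ` A) / 2"
  have d: "0 < d" "\<And>x. x \<in> A \<Longrightarrow> 2 * d \<le> \<bar>x - e\<bar>"
    using insert.hyps by (auto simp: d_def)
  define k where "k = min (c * d) (d ^ card A)"
  have "k * Im z \<le> (\<Prod>e\<in>insert e A. norm (z - complex_of_real e))" if z: "0 < Im z" for z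
  proof (cases "d \<le> norm (z - of_real e)")
    case True
    have "k * Im z \<le> d * (c * Im z)" using z by (simp add: k_def mult.assoc mult.commute[of c] mult_right_mono)
    also have "\<dots> \<le> norm (z - of_real e) * (\<Prod>e\<in>A. norm (z - complex_of_real e))"
      using True c z d by (intro mult_mono) auto
    finally show ?thesis using insert.hyps by simp
  next
    case False
    have far: "d \<le> norm (z - of_real x)" if "x \<in> A" for x
    proof -
      have "\<bar>x - e\<bar> = norm (of_real x - of_real e :: complex)" by (metis norm_of_real of_real_diff)
      also have "\<dots> \<le> norm (z - of_real x) + norm (z - of_real e)"
        using norm_triangle_ineq4[of "z - of_real e" "z - of_real x"] by simp
      finally show ?thesis using d(2)[OF that] False by simp
    qed
    have "k * Im z \<le> Im z * (\<Prod>e\<in>A. d)" using z by (simp add: k_def mult.commute)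
    also have "\<dots> \<le> norm (z - of_real e) * (\<Prod>e\<in>A. norm (z - complex_of_real e))"
      using z d far abs_Im_le_cmod[of "z - of_real e"]
      by (intro mult_mono prod_mono) (auto intro!: prod_nonneg)
    finally show ?thesis using insert.hyps by simp
  qed
  moreover have "0 < k" using c d by (simp add: k_def)
  ultimately show ?case by blast
qed

section \<open>Branch of the square root and potentials attached to an interval system\<close>

context
  fixes n :: nat and a b :: "nat \<Rightarrow> real"
  assumes n: "1 \<le> n" and sys: "interval_system n a b"
begin

lemma interval_system_facts:
  shows "a 1 = -1" "b n = 1" "\<And>k. k \<in> {1..n} \<Longrightarrow> a k < b k" "\<And>k. k \<in> {1..<n} \<Longrightarrow> b k < a (Suc k)"
  using sys by (auto simp: interval_system_def)

lemma interval_system_less: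
  assumes "1 \<le> i" "i < j" "j \<le> n"
  shows "b i < a j"
  using assms(2,3)
proof (induction j)
  case (Suc j)
  show ?case
  proof (cases "i = j")
    case True then show ?thesis using interval_system_facts(4)[of i] Suc assms by auto
  next
    case False
    then have "b i < a j" using Suc by auto
    also have "a j < b j" using interval_system_facts(3)[of j] Suc assms by auto
    also have "b j < a (Suc j)" using interval_system_facts(4)[of j] Suc assms by auto
    finally show ?thesis .
  qed
qed simp

lemma interval_system_bounds:
  assumes "k \<in> {1..n}" shows "-1 \<le> a k" "b k \<le> 1"
proof -
  show "-1 \<le> a k"
    using interval_system_less[of 1 k] interval_system_facts(1) interval_system_facts(3)[of 1] assms n by (cases "k = 1") auto
  show "b k \<le> 1"
    using interval_system_less[of k n] interval_system_facts(2) interval_system_facts(3)[of n] assms n by (cases "k = n") auto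
qed

lemma interval_union_eq: "interval_union n a b = (\<Union>k\<in>{1..n}. real_segment (a k) (b k))"
  by (simp add: interval_union_def real_segment_def)

lemma compact_interval_union: "compact (interval_union n a b)"
  unfolding interval_union_eq by (intro compact_UN compact_real_segment) auto

lemma interval_union_subset: "interval_union n a b \<subseteq> real_segment (-1) 1"
proof
  fix z assume "z \<in> interval_union n a b"
  then obtain k x where "k \<in> {1..n}" "z = of_real x" "a k \<le> x" "x \<le> b k"
    by (auto simp: interval_union_eq real_segment_def)
  moreover from this have "-1 \<le> x" "x \<le> 1" using interval_system_bounds[of k] by auto
  ultimately show "z \<in> real_segment (-1) 1" by (auto simp: real_segment_def)
qed

lemma interval_union_real: "interval_union n a b \<subseteq> \<real>"
  by (auto simp: interval_union_def)

lemma gap_outside_intervals: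
  assumes "k \<in> {1..<n}" "b k < x" "x < a (Suc k)" "i \<in> {1..n}"
  shows "x < a i \<or> b i < x"
proof (cases "i \<le> k")
  case True
  then have "b i \<le> b k"
    using interval_system_less[of i k] interval_system_facts(3)[of k] assms by (cases "i = k") auto
  then show ?thesis using assms by auto
next
  case False
  then have "a (Suc k) \<le> a i"
    using interval_system_less[of "Suc k" i] interval_system_facts(3)[of "Suc k"] assms by (cases "i = Suc k") auto
  then show ?thesis using assms by auto
qed

lemma interior_outside_other_intervals:
  assumes "k \<in> {1..n}" "a k < x" "x < b k" "i \<in> {1..n}" "i \<noteq> k"
  shows "x < a i \<or> b i < x"
  using interval_system_less[of i k] interval_system_less[of k i] assms by (cases "i < k") auto

text \<open>The branch of the square root of the product of all \<open>(z - a k) * (z - b k)\<close>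
  that behaves like \<open>z ^ n\<close> at infinity. One branched factor per interval puts the cuts
  exactly on the intervals and makes the product real in the gaps.\<close>

definition root_product :: "complex \<Rightarrow> complex" where
  "root_product z = (\<Prod>k\<in>{1..n}. segment_root (a k) (b k) z)"

lemma root_product_eq_0: "root_product z = 0 \<Longrightarrow> \<exists>k\<in>{1..n}. z = of_real (a k) \<or> z = of_real (b k)"
  by (auto simp: root_product_def segment_root_eq_0_iff)

lemma root_product_holomorphic: "root_product holomorphic_on (- interval_union n a b)"
  unfolding root_product_def[abs_def]
proof (intro holomorphic_intros)
  fix k assume "k \<in> {1..n}"
  then show "segment_root (a k) (b k) holomorphic_on - interval_union n a b"
    by (intro holomorphic_on_subset[OF segment_root_holomorphic] interval_system_facts(3))
       (auto simp: interval_union_eq)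
qed

lemma root_product_nonzero: "z \<notin> interval_union n a b \<Longrightarrow> root_product z \<noteq> 0"
proof
  assume z: "z \<notin> interval_union n a b" and "root_product z = 0"
  then obtain k where k: "k \<in> {1..n}" "z = of_real (a k) \<or> z = of_real (b k)" using root_product_eq_0 by blast
  then have "z \<in> real_segment (a k) (b k)"
    using real_segment_endpoints[of "a k" "b k"] interval_system_facts(3)[of k] by auto
  then show False using z k by (auto simp: interval_union_eq)
qed

lemma root_product_cnj: "z \<notin> interval_union n a b \<Longrightarrow> root_product (cnj z) = cnj (root_product z)"
  unfolding root_product_def cnj_prod
  by (intro prod.cong refl segment_root_cnj interval_system_facts(3)) (auto simp: interval_union_eq)

text \<open>The \<open>2 * n\<close> endpoints are distinct and the squared modulus is the product
  of the distances to them, so the distance estimate yields the square root of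
  \<open>Im z\<close>.\<close>

lemma root_product_lower_bound: "\<exists>c>0. \<forall>z. 0 < Im z \<longrightarrow> c * sqrt (Im z) \<le> norm (root_product z)"
proof -
  let ?K = "{1..n}"
  have "a ` ?K \<union> b ` ?K \<noteq> {}" using n by auto
  then obtain c where c: "0 < c" "\<And>z. 0 < Im z \<Longrightarrow> c * Im z \<le> (\<Prod>e\<in>a ` ?K \<union> b ` ?K. norm (z - complex_of_real e))"
    using prod_dist_ge_Im[of "a ` ?K \<union> b ` ?K"] by auto
  have less: "a i < a j \<and> b i < b j" if "i \<in> ?K" "j \<in> ?K" "i < j" for i j
    using interval_system_less[of i j] interval_system_facts(3)[of i] interval_system_facts(3)[of j] that by auto
  have "i = j" if "i \<in> ?K" "j \<in> ?K" "a i = a j \<or> b i = b j" for i j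
    using less[of i j] less[of j i] that by (cases i j rule: linorder_cases) auto
  then have "inj_on a ?K" "inj_on b ?K" by (auto intro: inj_onI)
  moreover have "a i \<noteq> b j" if "i \<in> ?K" "j \<in> ?K" for i j
    using interval_system_less[of i j] interval_system_less[of j i] interval_system_facts(3)[of i]
      interval_system_facts(3)[of j] that by (cases i j rule: linorder_cases) auto
  then have "a ` ?K \<inter> b ` ?K = {}" by auto
  ultimately have eq: "(\<Prod>e\<in>a ` ?K \<union> b ` ?K. norm (z - complex_of_real e)) = (norm (root_product z))\<^sup>2" for z
  proof -
    have "(\<Prod>e\<in>a ` ?K \<union> b ` ?K. norm (z - complex_of_real e))
        = (\<Prod>k\<in>?K. norm (z - of_real (a k))) * (\<Prod>k\<in>?K. norm (z - of_real (b k)))"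
      using \<open>inj_on a ?K\<close> \<open>inj_on b ?K\<close> \<open>a ` ?K \<inter> b ` ?K = {}\<close>
      by (simp add: prod.union_disjoint prod.reindex)
    also have "\<dots> = (\<Prod>k\<in>?K. (norm (segment_root (a k) (b k) z))\<^sup>2)"
      by (simp only: prod.distrib[symmetric] norm_segment_root)
    also have "\<dots> = (norm (root_product z))\<^sup>2"
      by (simp only: prod_power_distrib[symmetric] root_product_def prod_norm)
    finally show ?thesis .
  qed
  have "sqrt c * sqrt (Im z) \<le> norm (root_product z)" if "0 < Im z" for z
  proof (rule power2_le_imp_le)
    show "(sqrt c * sqrt (Im z))\<^sup>2 \<le> (norm (root_product z))\<^sup>2"
      using c(2)[OF that] c(1) that unfolding eq by (simp add: power_mult_distrib)
  qed simp
  then show ?thesis using c(1) by (intro exI[of _ "sqrt c"]) auto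
qed

lemma root_product_continuous_upper:
  "continuous_on ({z. 0 \<le> Im z} - (\<lambda>k. of_real (a k)) ` {1..n}) root_product"
  unfolding root_product_def[abs_def]
proof (intro continuous_on_prod)
  fix k assume "k \<in> {1..n}"
  then show "continuous_on ({z. 0 \<le> Im z} - (\<lambda>k. of_real (a k)) ` {1..n}) (segment_root (a k) (b k))"
    by (intro continuous_on_subset[OF continuous_on_segment_root_upper] interval_system_facts(3)) auto
qed

lemma Im_prod_eq_0: "(\<And>i. i \<in> A \<Longrightarrow> Im (f i) = 0) \<Longrightarrow> Im (prod f A) = 0"
  unfolding complex_is_Real_iff[symmetric] by (rule prod_in_Reals)

lemma root_product_gap_real:
  assumes "k \<in> {1..<n}" "b k < x" "x < a (Suc k)"
  shows "Im (root_product (of_real x)) = 0"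
  unfolding root_product_def
  by (intro Im_prod_eq_0 segment_root_real_outside gap_outside_intervals[OF assms] interval_system_facts(3))

text \<open>Inside interval \<open>k\<close> the factor of that interval is imaginary and all others
  are real.\<close>

lemma root_product_inside_imaginary:
  assumes k: "k \<in> {1..n}" "a k < x" "x < b k"
  shows "Re (root_product (of_real x)) = 0"
proof -
  have "Im (\<Prod>i\<in>{1..n} - {k}. segment_root (a i) (b i) (of_real x)) = 0"
    using interior_outside_other_intervals[OF k] interval_system_facts(3) by (intro Im_prod_eq_0 segment_root_real_outside) auto
  moreover have "root_product (of_real x) = segment_root (a k) (b k) (of_real x) *
     (\<Prod>i\<in>{1..n} - {k}. segment_root (a i) (b i) (of_real x))"
    unfolding root_product_def using k by (intro prod.remove) auto
  ultimately show ?thesis using segment_root_real_inside[OF k(2,3)] by simp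
qed

text \<open>Over the interior of each interval \<open>z ^ j / root_product z\<close> is imaginary,
  so the potential is constant there; the singular endpoints are reached by continuity. The
  constants may differ from interval to interval, which the linear system below corrects.\<close>

lemma monomial_potential:
  obtains g where "continuous_on UNIV g"
    "complex_gradient g (\<lambda>z. z ^ j / root_product z) (- interval_union n a b)" "\<And>z. g (cnj z) = g z"
    "\<And>k x. k \<in> {1..n} \<Longrightarrow> x \<in> {a k..b k} \<Longrightarrow> g (of_real x) = g (of_real (a k))"
proof -
  let ?E = "interval_union n a b"
  define F where "F = (\<lambda>z. z ^ j / root_product z)"
  obtain c where c: "0 < c" "\<And>z. 0 < Im z \<Longrightarrow> c * sqrt (Im z) \<le> norm (root_product z)"
    using root_product_lower_bound by blast
  have bound: "\<exists>C. \<forall>z. 0 < Im z \<longrightarrow> norm z \<le> R \<longrightarrow> norm (F z) \<le> C / sqrt (Im z)" for R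
  proof (intro exI allI impI)
    fix z assume z: "0 < Im z" "norm z \<le> R"
    have "norm (F z) = norm z ^ j / norm (root_product z)" by (simp add: F_def norm_divide norm_power)
    also have "\<dots> \<le> \<bar>R\<bar> ^ j / (c * sqrt (Im z))"
      using c z by (intro frac_le power_mono) auto
    finally show "norm (F z) \<le> (\<bar>R\<bar> ^ j / c) / sqrt (Im z)" by simp
  qed
  have "\<exists>g. continuous_on UNIV g \<and> complex_gradient g F (- ?E) \<and> (\<forall>z. g (cnj z) = g z) \<and>
    (\<forall>x1 x2. x1 < x2 \<longrightarrow> continuous_on {z. Re z \<in> {x1..x2} \<and> Im z \<in> {0..1}} F \<longrightarrow>
       (\<forall>x\<in>{x1..x2}. Re (F (of_real x)) = 0) \<longrightarrow> g (of_real x1) = g (of_real x2))"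
  proof (rule potential_with_real_singularities[OF _ interval_union_real _ _ bound])
    show "closed ?E" by (rule compact_imp_closed[OF compact_interval_union])
    show "F holomorphic_on - ?E"
      unfolding F_def by (intro holomorphic_intros root_product_holomorphic) (auto dest: root_product_nonzero)
    show "F (cnj z) = cnj (F z)" if "z \<notin> ?E" for z
      using root_product_cnj[OF that] by (simp add: F_def)
  qed
  then obtain g where g: "continuous_on UNIV g" "complex_gradient g F (- ?E)" "\<forall>z. g (cnj z) = g z"
    "\<forall>x1 x2. x1 < x2 \<longrightarrow> continuous_on {z. Re z \<in> {x1..x2} \<and> Im z \<in> {0..1}} F \<longrightarrow>
       (\<forall>x\<in>{x1..x2}. Re (F (of_real x)) = 0) \<longrightarrow> g (of_real x1) = g (of_real x2)"
    by (elim exE conjE)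
  have inside: "g (of_real x1) = g (of_real x2)" if k: "k \<in> {1..n}" and x: "a k < x1" "x1 < x2" "x2 < b k" for k x1 x2
  proof (rule g(4)[THEN spec, THEN spec, THEN mp, THEN mp, THEN mp, OF x(2)])
    have ne: "Re z \<noteq> a i \<and> Re z \<noteq> b i" if "Re z \<in> {x1..x2}" "i \<in> {1..n}" for z i
    proof (cases "i = k")
      case True then show ?thesis using that x by auto
    next
      case False
      have "a k < Re z" "Re z < b k" using that(1) x by auto
      from interior_outside_other_intervals[OF k this that(2) False] show ?thesis
        using interval_system_facts(3)[OF that(2)] by linarith
    qed
    have sub: "{z. Re z \<in> {x1..x2} \<and> Im z \<in> {0..1}} \<subseteq> {z. 0 \<le> Im z} - (\<lambda>k. of_real (a k)) ` {1..n}"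
      using ne by fastforce
    have "root_product z \<noteq> 0" if "Re z \<in> {x1..x2}" for z
      using root_product_eq_0[of z] ne[OF that] by fastforce
    then show "continuous_on {z. Re z \<in> {x1..x2} \<and> Im z \<in> {0..1}} F"
      unfolding F_def
      by (intro continuous_intros continuous_on_subset[OF root_product_continuous_upper sub]) auto
    show "\<forall>t\<in>{x1..x2}. Re (F (of_real t)) = 0"
    proof
      fix t assume t: "t \<in> {x1..x2}"
      have "Re (root_product (of_real t)) = 0"
        using t x by (intro root_product_inside_imaginary[OF k]) auto
      moreover have "Im (of_real t ^ j :: complex) = 0" by (simp flip: of_real_power)
      ultimately show "Re (F (of_real t)) = 0" unfolding F_def Re_divide by simp
    qed
  qed
  have "g (of_real x) = g (of_real (a k))" if k: "k \<in> {1..n}" and x: "x \<in> {a k..b k}" for k x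
  proof -
    define m where "m = (a k + b k) / 2"
    have ab: "a k < b k" by (rule interval_system_facts(3)[OF k])
    have m: "a k < m" "m < b k" using ab by (auto simp: m_def)
    have eq: "g (of_real t) = g (of_real m)" if t: "t \<in> {a k<..<b k}" for t
    proof (cases t m rule: linorder_cases)
      case less
      then show ?thesis using t m by (intro inside[OF k]) auto
    next
      case greater
      then have "g (of_real m) = g (of_real t)" using t m by (intro inside[OF k]) auto
      then show ?thesis by (rule sym)
    qed simp
    have cont: "continuous_on (closure {a k<..<b k}) (\<lambda>t. g (of_real t))"
      by (intro continuous_on_compose2[OF g(1)] continuous_intros) auto
    have *: "g (of_real t) = g (of_real m)" if "t \<in> {a k..b k}" for t
      by (rule continuous_constant_on_closure[OF cont])
         (use eq that ab in \<open>simp_all add: closure_greaterThanLessThan\<close>)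
    have "g (of_real x) = g (of_real m)" by (rule *[OF x])
    also have "\<dots> = g (of_real (a k))" by (rule *[symmetric]) (use ab in auto)
    finally show ?thesis .
  qed
  then show ?thesis
    by (rule that[OF g(1) g(2)[unfolded F_def] g(3)[rule_format]])
qed

lemma root_product_at_infinity: "((\<lambda>z. z ^ n / root_product z) \<longlongrightarrow> 1) at_infinity"
proof -
  have "((\<lambda>z. \<Prod>k\<in>{1..n}. z / segment_root (a k) (b k) z) \<longlongrightarrow> (\<Prod>k\<in>{1..n}. 1)) at_infinity"
    by (intro tendsto_prod tendsto_segment_root_at_infinity)
  then show ?thesis by (simp add: root_product_def prod_dividef)
qed

text \<open>The \<open>n - 1\<close> gap conditions leave a nonzero solution \<open>c\<close> with \<open>n\<close> coordinates. Its leading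
  coordinate cannot vanish: by Rolle's theorem the polynomial has a root in each gap.\<close>

lemma green_data_interval_union: "\<exists>g f \<gamma>. green_data (interval_union n a b) g f \<gamma>"
proof -
  let ?E = "interval_union n a b"
  define m where "m = n - 1"
  have nm: "n = Suc m" using n by (simp add: m_def)
  have "\<forall>j. \<exists>g. continuous_on UNIV g \<and> complex_gradient g (\<lambda>z. z ^ j / root_product z) (- ?E) \<and>
     (\<forall>z. g (cnj z) = g z) \<and> (\<forall>k\<in>{1..n}. \<forall>x\<in>{a k..b k}. g (of_real x) = g (of_real (a k)))"
  proof
    fix j
    show "\<exists>g. continuous_on UNIV g \<and> complex_gradient g (\<lambda>z. z ^ j / root_product z) (- ?E) \<and>
     (\<forall>z. g (cnj z) = g z) \<and> (\<forall>k\<in>{1..n}. \<forall>x\<in>{a k..b k}. g (of_real x) = g (of_real (a k)))"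
      by (rule monomial_potential[of j]) blast
  qed
  then obtain g where "\<forall>j. continuous_on UNIV (g j) \<and> complex_gradient (g j) (\<lambda>z. z ^ j / root_product z) (- ?E) \<and>
     (\<forall>z. g j (cnj z) = g j z) \<and> (\<forall>k\<in>{1..n}. \<forall>x\<in>{a k..b k}. g j (of_real x) = g j (of_real (a k)))"
    by (rule choice[THEN exE])
  then have g: "\<And>j. continuous_on UNIV (g j)"
     "\<And>j. complex_gradient (g j) (\<lambda>z. z ^ j / root_product z) (- ?E)"
     "\<And>j z. g j (cnj z) = g j z"
     "\<And>j k x. k \<in> {1..n} \<Longrightarrow> x \<in> {a k..b k} \<Longrightarrow> g j (of_real x) = g j (of_real (a k))"
    by blast+
  \<comment> \<open>Row \<open>k\<close> stands for the gap between \<open>b (k + 1)\<close> and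
    \<open>a (k + 2)\<close>, since rows start at 0 and intervals at 1. The entry is the jump of the
    potential across this gap.\<close>
  define A where "A = (\<lambda>k j. g j (of_real (a (Suc (Suc k)))) - g j (of_real (b (Suc k))))"
  obtain c where c: "\<exists>j\<le>m. c j \<noteq> 0" "\<And>k. k < m \<Longrightarrow> (\<Sum>j\<le>m. A k j * c j) = 0"
    using homogeneous_system_nontrivial[of m A] by blast
  define G where "G = (\<lambda>z. \<Sum>j\<le>m. c j * g j z)"
  define F where "F = (\<lambda>z. (\<Sum>j\<le>m. of_real (c j) * z ^ j) / root_product z)"
  have op: "open (- ?E)" using compact_imp_closed[OF compact_interval_union] by auto
  have G': "(G has_derivative (\<lambda>h. Re (F z * h))) (at z)" if z: "z \<notin> ?E" for z
  proof -
    have "(g j has_derivative (\<lambda>h. Re (z ^ j / root_product z * h))) (at z)" for j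
      using g(2)[of j] z by (simp add: complex_gradient_def)
    then have "(G has_derivative (\<lambda>h. \<Sum>j\<le>m. c j * Re (z ^ j / root_product z * h))) (at z)"
      unfolding G_def by (intro has_derivative_sum has_derivative_mult_right)
    moreover have "(\<Sum>j\<le>m. c j * Re (z ^ j / root_product z * h)) = Re (F z * h)" for h
    proof -
      have "c j * Re (z ^ j / root_product z * h) = Re (of_real (c j) * z ^ j / root_product z * h)" for j
      proof -
        have "of_real (c j) * z ^ j / root_product z * h = of_real (c j) * (z ^ j / root_product z * h)"
          by (simp only: mult.assoc times_divide_eq_right times_divide_eq_left)
        moreover have "Re (of_real r * w) = r * Re w" for r w by simp
        ultimately show ?thesis by (simp only:)
      qed
      then have "(\<Sum>j\<le>m. c j * Re (z ^ j / root_product z * h)) = Re (\<Sum>j\<le>m. of_real (c j) * z ^ j / root_product z * h)"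
        by (simp only: Re_sum)
      also have "(\<Sum>j\<le>m. of_real (c j) * z ^ j / root_product z * h) = F z * h"
        unfolding F_def by (simp only: sum_distrib_right sum_divide_distrib)
      finally show ?thesis .
    qed
    ultimately show ?thesis by simp
  qed
  have cG: "continuous_on UNIV G" unfolding G_def by (intro continuous_intros g(1))
  have Gseg: "G (of_real x) = G (of_real (a k))" if "k \<in> {1..n}" "x \<in> {a k..b k}" for k x
    unfolding G_def using g(4)[OF that] by simp
  have Ggap: "G (of_real (a (Suc k))) = G (of_real (b k))" if k: "k \<in> {1..<n}" for k
  proof -
    obtain i where i: "k = Suc i" "i < m" using k nm by (cases k) auto
    have "G (of_real (a (Suc k))) - G (of_real (b k)) = (\<Sum>j\<le>m. A i j * c j)"
      by (simp add: G_def A_def i sum_subtractf[symmetric] algebra_simps)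
    then show ?thesis using c(2)[OF i(2)] by simp
  qed
  have lead: "c m \<noteq> 0"
  proof
    assume cm: "c m = 0"
    then obtain m' where m': "m = Suc m'" using c(1) by (cases m) auto
    have root: "\<exists>x. b k < x \<and> x < a (Suc k) \<and> (\<Sum>j\<le>m'. c j * x ^ j) = 0" if k: "k \<in> {1..<n}" for k
    proof -
      have notE: "complex_of_real x \<notin> ?E" if "b k < x" "x < a (Suc k)" for x
      proof
        assume "complex_of_real x \<in> ?E"
        then obtain i where "i \<in> {1..n}" "a i \<le> x" "x \<le> b i" by (auto simp: interval_union_def)
        then show False using gap_outside_intervals[OF k that, of i] by auto
      qed
      have "\<exists>x. b k < x \<and> x < a (Suc k) \<and> (\<lambda>h. Re (F (of_real x) * of_real h)) = (\<lambda>h. 0)"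
      proof (rule Rolle_deriv[of _ _ "\<lambda>x. G (of_real x)"])
        show "continuous_on {b k..a (Suc k)} (\<lambda>x. G (complex_of_real x))"
          by (intro continuous_on_compose2[OF cG] continuous_intros) auto
        fix x assume "b k < x" "x < a (Suc k)"
        then show "((\<lambda>x. G (complex_of_real x)) has_derivative (\<lambda>h. Re (F (of_real x) * of_real h))) (at x)"
          by (intro has_derivative_compose[OF _ G'] notE) (auto intro!: derivative_eq_intros)
      qed (use interval_system_facts(4)[OF k] Ggap[OF k] in auto)
      then obtain x where x: "b k < x" "x < a (Suc k)" "(\<lambda>h. Re (F (of_real x) * of_real h)) = (\<lambda>h. 0)" by blast
      \<comment> \<open>Rolle only yields \<open>Re F = 0\<close>. As \<open>root_product\<close> is
        real in the gap, \<open>F\<close> is real as well, and the polynomial itself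
        vanishes.\<close>
      from fun_cong[OF x(3), of 1] have re: "Re (F (of_real x)) = 0" by simp
      have "Im (root_product (of_real x)) = 0" by (rule root_product_gap_real[OF k x(1,2)])
      then obtain r where r: "root_product (of_real x) = of_real r" by (metis complex_is_Real_iff Reals_cases)
      have r0: "r \<noteq> 0" using root_product_nonzero[OF notE[OF x(1,2)]] r by auto
      have "F (of_real x) = of_real ((\<Sum>j\<le>m. c j * x ^ j) / r)" by (simp add: F_def r)
      then have "(\<Sum>j\<le>m. c j * x ^ j) = 0" using re r0 by (metis Re_complex_of_real divide_eq_0_iff)
      then show ?thesis using x cm by (auto simp: m')
    qed
    then obtain x where x: "\<And>k. k \<in> {1..<n} \<Longrightarrow> b k < x k \<and> x k < a (Suc k) \<and> (\<Sum>j\<le>m'. c j * x k ^ j) = 0"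
      by metis
    have xl: "x i < x j" if "i \<in> {1..<n}" "j \<in> {1..<n}" "i < j" for i j
    proof -
      have "a (Suc i) \<le> b j"
        using interval_system_less[of "Suc i" j] interval_system_facts(3)[of j] interval_system_facts(3)[of "Suc i"] that
        by (cases "Suc i = j") auto
      then show ?thesis using x[OF that(1)] x[OF that(2)] by linarith
    qed
    have "inj_on x {1..<n}"
      by (rule inj_onI) (metis less_irrefl nat_neq_iff xl)
    then have "card (x ` {1..<n}) = m" by (simp add: card_image nm)
    obtain j where j: "j \<le> m'" "c j \<noteq> 0" using c(1) cm m' by (auto simp: le_Suc_eq)
    then have "\<exists>k. k \<le> m' \<and> c k \<noteq> 0" by blast
    note rb = polyfun_rootbound[OF this]
    have "card (x ` {1..<n}) \<le> card {z. (\<Sum>i\<le>m'. c i * z ^ i) = 0}"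
      using rb x by (intro card_mono) auto
    then show False using rb \<open>card (x ` {1..<n}) = m\<close> m' by simp
  qed
  define x0 where "x0 = G (of_real (a 1))"
  have Gx0: "G (of_real (a k)) = x0" if "k \<in> {1..n}" for k
    using that
  proof (induction k)
    case (Suc k)
    show ?case
    proof (cases "k = 0")
      case False
      then have k: "k \<in> {1..n}" "k \<in> {1..<n}" using Suc by auto
      have "G (of_real (b k)) = G (of_real (a k))" using interval_system_facts(3)[OF k(1)] by (intro Gseg k) auto
      then show ?thesis using Ggap[OF k(2)] Suc.IH[OF k(1)] by simp
    qed (simp add: x0_def)
  qed simp
  \<comment> \<open>Division by the leading coefficient normalises the pole, and subtracting the
    common value \<open>x0\<close> gives zero boundary values.\<close>
  define gg where "gg = (\<lambda>z. (1 / c m) * (G z - x0))"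
  define ff where "ff = (\<lambda>z. of_real (1 / c m) * F z)"
  have grad: "complex_gradient gg ff (- ?E)"
  proof -
    have "F holomorphic_on - ?E" unfolding F_def
      by (intro holomorphic_intros root_product_holomorphic) (auto dest: root_product_nonzero)
    then have "complex_gradient G F (- ?E)" using G' op by (simp add: complex_gradient_def)
    from complex_gradient_cmult[OF complex_gradient_add_const[OF this, of "- x0"], of "1 / c m"]
    show ?thesis by (simp only: gg_def ff_def diff_conv_add_uminus)
  qed
  have lim: "((\<lambda>z. z * ff z) \<longlongrightarrow> 1) at_infinity"
  proof -
    have summand: "((\<lambda>z. of_real (c j / c m) * (inverse z ^ (m - j) * (z ^ n / root_product z)))
        \<longlongrightarrow> of_real (c j / c m) * ((if j = m then 1 else 0) * 1)) at_infinity" if "j \<le> m" for j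
    proof (intro tendsto_mult tendsto_const root_product_at_infinity)
      show "((\<lambda>z. inverse z ^ (m - j)) \<longlongrightarrow> (if j = m then 1 else 0 :: complex)) at_infinity"
        using tendsto_power[OF tendsto_inverse_0, of "m - j"] that by (cases "j = m") (auto simp: power_0_left)
    qed
    have "((\<lambda>z. \<Sum>j\<le>m. of_real (c j / c m) * (inverse z ^ (m - j) * (z ^ n / root_product z)))
        \<longlongrightarrow> (\<Sum>j\<le>m. of_real (c j / c m) * ((if j = m then 1 else 0) * 1))) at_infinity"
      by (intro tendsto_sum summand) auto
    moreover have "(\<Sum>j\<le>m. of_real (c j / c m) * ((if j = m then 1 else 0) * 1)) = (1 :: complex)"
      using lead by (simp add: if_distrib[of "\<lambda>x. _ * x"] sum.delta cong: if_cong)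
    ultimately have "((\<lambda>z. \<Sum>j\<le>m. of_real (c j / c m) * (inverse z ^ (m - j) * (z ^ n / root_product z))) \<longlongrightarrow> 1) at_infinity"
      by simp
    then show ?thesis
    proof (rule Lim_transform_eventually)
      show "\<forall>\<^sub>F z in at_infinity. (\<Sum>j\<le>m. of_real (c j / c m) * (inverse z ^ (m - j) * (z ^ n / root_product z))) = z * ff z"
        unfolding eventually_at_infinity
      proof (intro exI[of _ 1] allI impI)
        fix z :: complex assume "1 \<le> norm z"
        then have z0: "z \<noteq> 0" by auto
        have "of_real (c j / c m) * (inverse z ^ (m - j) * (z ^ n / root_product z))
            = z * (of_real (1 / c m) * (of_real (c j) * z ^ j / root_product z))" if "j \<le> m" for j
        proof -
          have "n = (m - j) + Suc j" using that nm by simp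
          then have "z ^ n = z ^ (m - j) * (z * z ^ j)" by (metis power_Suc power_add)
          then have "inverse z ^ (m - j) * z ^ n = z * z ^ j"
            using z0 by (simp add: power_inverse)
          have rearrange: "d * e * (i * (y / r)) = z * (d * (e * w / r))" if "i * y = z * w" for d e i y r w :: complex
          proof -
            have "d * e * (i * (y / r)) = d * e * (i * y / r)" by (simp only: times_divide_eq_right)
            also have "\<dots> = z * (d * (e * w / r))" by (simp only: that times_divide_eq_right mult_ac)
            finally show ?thesis .
          qed
          have "of_real (c j / c m) = of_real (1 / c m) * (of_real (c j) :: complex)"
            by (simp only: of_real_mult[symmetric]) simp
          then show ?thesis
            by (simp only: rearrange[OF \<open>inverse z ^ (m - j) * z ^ n = z * z ^ j\<close>])
        qed
        then have "(\<Sum>j\<le>m. of_real (c j / c m) * (inverse z ^ (m - j) * (z ^ n / root_product z)))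
            = (\<Sum>j\<le>m. z * (of_real (1 / c m) * (of_real (c j) * z ^ j / root_product z)))"
          by (intro sum.cong) auto
        also have "\<dots> = z * ff z"
          unfolding ff_def F_def by (simp only: sum_distrib_left sum_divide_distrib)
        finally show "(\<Sum>j\<le>m. of_real (c j / c m) * (inverse z ^ (m - j) * (z ^ n / root_product z))) = z * ff z" .
      qed
    qed
  qed
  have "complex_gradient gg ff {z. 1 < norm z}"
  proof (rule complex_gradient_subset[OF grad])
    have "norm z \<le> 1" if "z \<in> ?E" for z
      using that interval_union_subset by (force simp: real_segment_def)
    then show "{z. 1 < norm z} \<subseteq> - ?E" by force
  qed (auto intro!: open_Collect_less continuous_intros)
  from log_pole_expansion[OF this lim] obtain \<gamma> where \<gamma>: "((\<lambda>z. gg z - ln (norm z)) \<longlongrightarrow> \<gamma>) at_infinity" by metis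
  have zero: "gg z = 0" if z: "z \<in> ?E" for z
  proof -
    obtain k x where kx: "k \<in> {1..n}" "x \<in> {a k..b k}" "z = of_real x" using z by (auto simp: interval_union_def)
    then show ?thesis using Gseg[OF kx(1,2)] Gx0[OF kx(1)] by (simp add: gg_def)
  qed
  have "continuous_on UNIV gg" unfolding gg_def by (intro continuous_intros cG)
  moreover have "gg (cnj z) = gg z" for z by (simp add: gg_def G_def g(3))
  ultimately show ?thesis
    using compact_interval_union interval_union_subset grad zero lim \<gamma> unfolding green_data_def by blast
qed

end


section \<open>The lower bound for the capacity\<close>

lemma green_data_segment:
  assumes "-1 \<le> P" "P < Q" "Q \<le> 1"
  shows "green_data (real_segment P Q) (segment_green P Q) (\<lambda>z. 1 / segment_root P Q z) (ln (4 / (Q - P)))"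
  unfolding green_data_def
proof (intro conjI ballI allI)
  show "real_segment P Q \<subseteq> real_segment (-1) 1" using assms by (auto simp: real_segment_def)
  show "((\<lambda>z. z * (1 / segment_root P Q z)) \<longlongrightarrow> 1) at_infinity"
    using tendsto_segment_root_at_infinity[of P Q] by simp
qed (use assms in \<open>auto simp: segment_green_cnj compact_real_segment
       intro!: complex_gradient_segment_green continuous_on_segment_green segment_green_eq_0 segment_green_at_infinity\<close>)

text \<open>The Green function of \<open>[P, Q]\<close>, transplanted by \<open>cos\<close> to the half-strip over \<open>[s, s + \<alpha>]\<close> and
  normalised to grow like \<open>Im z\<close>.\<close>

definition strip_potential :: "real \<Rightarrow> real \<Rightarrow> real \<Rightarrow> real \<Rightarrow> complex \<Rightarrow> real" where
  "strip_potential s \<alpha> P Q z = \<alpha> / pi * cos_lift (segment_green P Q) ((z - of_real s) / of_real (\<alpha> / pi))"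

definition strip_potential_gradient :: "real \<Rightarrow> real \<Rightarrow> real \<Rightarrow> real \<Rightarrow> complex \<Rightarrow> complex" where
  "strip_potential_gradient s \<alpha> P Q z =
     cos_lift_gradient (\<lambda>z. 1 / segment_root P Q z) ((z - of_real s) / of_real (\<alpha> / pi))"

context
  fixes s \<alpha> P Q :: real
  assumes \<alpha>: "0 < \<alpha>" and PQ: "-1 \<le> P" "P < Q" "Q \<le> 1"
begin

lemmas segment_data = green_data_segment[OF PQ]

lemma strip_coordinate:
  "Re ((z - of_real s) / of_real (\<alpha> / pi)) = pi * (Re z - s) / \<alpha>"
  "Im ((z - of_real s) / of_real (\<alpha> / pi)) = pi * Im z / \<alpha>"
  by (simp_all only: Re_divide_of_real Im_divide_of_real minus_complex.sel Re_complex_of_real Im_complex_of_real)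
     (simp_all add: mult.commute)

lemma strip_potential_complex_gradient:
  "complex_gradient (strip_potential s \<alpha> P Q) (strip_potential_gradient s \<alpha> P Q) {z. 0 < Im z}"
proof -
  define p where "p = (\<lambda>z. (z - of_real s) / complex_of_real (\<alpha> / pi))"
  have l: "complex_of_real (\<alpha> / pi) \<noteq> 0" using \<alpha> by simp
  have d: "deriv p z = 1 / of_real (\<alpha> / pi)" for z
    unfolding p_def by (rule DERIV_imp_deriv) (use l in \<open>auto intro!: derivative_eq_intros\<close>)
  have "complex_gradient (\<lambda>z. cos_lift (segment_green P Q) (p z))
      (\<lambda>z. cos_lift_gradient (\<lambda>z. 1 / segment_root P Q z) (p z) * deriv p z) {z. 0 < Im z}"
  proof (rule complex_gradient_compose[OF cos_lift_complex_gradient_upper[OF segment_data] open_halfspace_Im_gt])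
    show "p holomorphic_on {z. 0 < Im z}" unfolding p_def using l by (intro holomorphic_intros) auto
    show "p ` {z. 0 < Im z} \<subseteq> {z. 0 < Im z}" unfolding p_def using \<alpha> strip_coordinate(2) by auto
  qed
  from complex_gradient_cmult[OF this, of "\<alpha> / pi"]
  have "complex_gradient (\<lambda>z. \<alpha> / pi * cos_lift (segment_green P Q) (p z))
    (\<lambda>z. of_real (\<alpha> / pi) * (cos_lift_gradient (\<lambda>z. 1 / segment_root P Q z) (p z) * (1 / of_real (\<alpha> / pi)))) {z. 0 < Im z}"
    unfolding d .
  moreover have "L * (w * (1 / L)) = w" if "L \<noteq> 0" for L w :: complex using that by simp
  note this[OF l]
  ultimately show ?thesis
    by (simp only: strip_potential_def[abs_def] strip_potential_gradient_def[abs_def] p_def)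
qed

lemma strip_potential_nonneg: "0 \<le> strip_potential s \<alpha> P Q z"
  unfolding strip_potential_def using \<alpha> cos_lift_nonneg[OF segment_data] by simp

lemma strip_potential_gradient_Im_nonpos:
  "0 < Im z \<Longrightarrow> Im (strip_potential_gradient s \<alpha> P Q z) \<le> 0"
  unfolding strip_potential_gradient_def
  by (rule cos_lift_gradient_Im_nonpos[OF segment_data]) (use \<alpha> strip_coordinate(2)[of z] in simp)

lemma strip_potential_gradient_on_sides:
  assumes "0 < Im z" "Re z = s \<or> Re z = s + \<alpha>"
  shows "Re (strip_potential_gradient s \<alpha> P Q z) = 0"
  unfolding strip_potential_gradient_def
proof (rule cos_lift_gradient_on_sides[OF segment_data])
  let ?w = "(z - of_real s) / of_real (\<alpha> / pi)"
  have "Re ?w = 0 \<or> Re ?w = pi" unfolding strip_coordinate using assms \<alpha> by auto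
  then show "sin (Re ?w) = 0" by auto
  have "Im ?w \<noteq> 0" unfolding strip_coordinate using assms \<alpha> by simp
  from cos_notin_unit_segment[OF this] show "cos ?w \<notin> real_segment P Q"
    using PQ by (auto simp: real_segment_def)
qed

lemma strip_coordinate_at_height_top:
  "filterlim (\<lambda>z. (z - of_real s) / of_real (\<alpha> / pi)) at_height_top at_height_top"
  unfolding filterlim_filtercomap_iff o_def strip_coordinate(2)
proof (rule filterlim_compose[of "\<lambda>y. pi * y / \<alpha>", OF _ filterlim_filtercomap])
  show "filterlim (\<lambda>y. pi * y / \<alpha>) at_top at_top" using \<alpha> by real_asymp
qed

text \<open>In a strip of width \<open>pi\<close> the constant is
  \<open>ln (4 / (Q - P)) - ln 2\<close>; stretching to width \<open>\<alpha>\<close> multiplies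
  heights, and with them the constant, by \<open>\<alpha> / pi\<close>.\<close>

lemma strip_potential_at_height_top:
  "((\<lambda>z. strip_potential s \<alpha> P Q z - Im z) \<longlongrightarrow> - (\<alpha> / pi * ln ((Q - P) / 2))) at_height_top"
proof -
  have "((\<lambda>z. \<alpha> / pi * (cos_lift (segment_green P Q) ((z - of_real s) / of_real (\<alpha> / pi)) - Im ((z - of_real s) / of_real (\<alpha> / pi))))
      \<longlongrightarrow> \<alpha> / pi * (ln (4 / (Q - P)) - ln 2)) at_height_top"
    by (intro tendsto_mult_left filterlim_compose[OF cos_lift_at_height_top[OF segment_data] strip_coordinate_at_height_top])
  moreover have "ln (4 / (Q - P)) - ln 2 = - ln ((Q - P) / 2)"
    using PQ ln_realpow[of 2 2] by (simp add: ln_div)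
  moreover have "\<alpha> / pi * (C - pi * y / \<alpha>) = \<alpha> / pi * C - y" for C y
    using \<alpha> by (simp add: field_simps)
  ultimately show ?thesis by (simp only: strip_potential_def strip_coordinate mult_minus_right)
qed

lemma strip_potential_gradient_at_height_top:
  "((\<lambda>z. of_real (Im z) * (strip_potential_gradient s \<alpha> P Q z + \<i>)) \<longlongrightarrow> 0) at_height_top"
proof -
  let ?w = "\<lambda>z. (z - of_real s) / of_real (\<alpha> / pi)"
  have "((\<lambda>z. of_real (\<alpha> / pi) * (of_real (Im (?w z)) * (cos_lift_gradient (\<lambda>z. 1 / segment_root P Q z) (?w z) + \<i>)))
     \<longlongrightarrow> of_real (\<alpha> / pi) * 0) at_height_top"
    by (intro tendsto_mult_left filterlim_compose[OF cos_lift_gradient_at_height_top[OF segment_data] strip_coordinate_at_height_top])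
  moreover have "of_real (\<alpha> / pi) * (of_real (pi * y / \<alpha>) * C) = of_real y * C" for C :: complex and y
  proof -
    have "\<alpha> / pi * (pi * y / \<alpha>) = y" using \<alpha> by simp
    then show ?thesis by (metis mult.assoc of_real_mult)
  qed
  ultimately show ?thesis
    by (simp only: strip_potential_gradient_def strip_coordinate mult_zero_right)
qed

text \<open>Away from the lifted segment the gradient is continuous down to the bottom, where
  \<open>1 / segment_root\<close> and \<open>sin\<close> are both real; so the vertical derivative
  tends to 0 uniformly on \<open>K\<close>.\<close>

lemma strip_potential_gradient_small:
  assumes K: "compact K" and out: "\<And>x. x \<in> K \<Longrightarrow> cos (pi * (x - s) / \<alpha>) < P \<or> Q < cos (pi * (x - s) / \<alpha>)"
    and \<eta>: "0 < \<eta>"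
  shows "eventually (\<lambda>y. \<forall>x\<in>K. \<bar>Im (strip_potential_gradient s \<alpha> P Q (Complex x y))\<bar> < \<eta>) (at_right 0)"
proof (rule uniformly_small_near_real_axis[OF K _ _ \<eta>])
  let ?w = "\<lambda>z::complex. (z - of_real s) / of_real (\<alpha> / pi)"
  have l: "complex_of_real (\<alpha> / pi) \<noteq> 0" using \<alpha> by simp
  have real: "?w (of_real x) = of_real (pi * (x - s) / \<alpha>)" for x
    unfolding complex_eq_iff strip_coordinate by simp
  have notin: "cos (?w (of_real x)) \<notin> real_segment P Q" if "x \<in> K" for x
    unfolding real cos_of_real real_segment_def using out[OF that] by auto
  have "cos (?w z) \<notin> real_segment P Q" if z: "Re z \<in> K" "Im z \<in> {0..1}" for z
  proof (cases "Im z = 0")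
    case True
    then have "z = of_real (Re z)" by (simp add: complex_eq_iff)
    then show ?thesis using notin[OF z(1)] by metis
  next
    case False
    then have "Im (?w z) \<noteq> 0" unfolding strip_coordinate using \<alpha> by simp
    from cos_notin_unit_segment[OF this] show ?thesis using PQ by (auto simp: real_segment_def)
  qed
  then show "continuous_on {z. Re z \<in> K \<and> Im z \<in> {0..1}} (\<lambda>z. Im (strip_potential_gradient s \<alpha> P Q z))"
    unfolding strip_potential_gradient_def
    by (intro continuous_on_Im continuous_on_compose2[OF complex_gradient_continuous_on(2)[OF cos_lift_complex_gradient[OF segment_data]]]
        continuous_intros) (use l in auto)
  fix x assume x: "x \<in> K"
  define t where "t = pi * (x - s) / \<alpha>"
  have "cos (complex_of_real t) \<in> \<real>" "cos (complex_of_real t) \<notin> real_segment P Q"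
    using notin[OF x] unfolding real t_def by (simp_all add: cos_of_real)
  then have im: "Im (1 / segment_root P Q (cos (complex_of_real t))) = 0"
    by (rule green_data_gradient_real[OF segment_data])
  have "Im (- sin (complex_of_real t)) = 0" by (simp add: sin_of_real)
  with im show "Im (strip_potential_gradient s \<alpha> P Q (of_real x)) = 0"
    unfolding strip_potential_gradient_def real t_def[symmetric] cos_lift_gradient_def[OF segment_data]
    by (simp only: times_complex.sel mult_zero_left mult_zero_right add_0)
qed

end

text \<open>In the coordinate of strip \<open>k\<close> the interval from \<open>a k\<close> to
  \<open>b k\<close> becomes the one from \<open>P0 k\<close> to \<open>Q0 k\<close>. With this very
  segment \<open>U_y\<close> could be singular at the boundary of the set where \<open>V\<close> is
  known to vanish. Shrinking both ends by \<open>\<tau>\<close> moves the singularities into the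
  interior of that set, and the inequality for all small \<open>\<tau>\<close> passes to the
  limit.\<close>

lemma green_data_le_cut_sum:
  assumes n: "1 \<le> n" and sys: "interval_system n a b" and \<delta>: "\<delta> \<in> cuts n a b"
    and G: "green_data (interval_union n a b) g f \<gamma>"
    and \<alpha>_def: "\<And>k. \<alpha> k = arccos (\<delta> (k - 1)) - arccos (\<delta> k)"
    and P0: "\<And>k. P0 k = cos (pi * (arccos (a k) - arccos (\<delta> k)) / \<alpha> k)"
    and Q0: "\<And>k. Q0 k = cos (pi * (arccos (b k) - arccos (\<delta> k)) / \<alpha> k)"
  shows "\<And>k. k \<in> {1..n} \<Longrightarrow> P0 k < Q0 k"
    "(\<Sum>k=1..n. (\<alpha> k)\<^sup>2 / pi\<^sup>2 * ln ((Q0 k - P0 k) / 2)) \<le> ln 2 - \<gamma>"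
proof -
  define s where "s = (\<lambda>k. arccos (\<delta> k))"
  have \<alpha>: "\<alpha> k = s (k - 1) - s k" for k by (simp add: \<alpha>_def s_def)
  note facts = interval_system_facts[OF n sys] and bounds = interval_system_bounds[OF n sys]
  have \<delta>0: "\<delta> 0 = -1" "\<delta> n = 1" and \<delta>k: "\<And>k. k \<in> {1..<n} \<Longrightarrow> b k < \<delta> k \<and> \<delta> k < a (Suc k)"
    using \<delta> by (auto simp: cuts_def)
  have lower: "-1 \<le> \<delta> (k - 1) \<and> \<delta> (k - 1) \<le> a k" if k: "k \<in> {1..n}" for k
  proof (cases "k = 1")
    case False
    then have k1: "k - 1 \<in> {1..<n}" "k - 1 \<in> {1..n}" "Suc (k - 1) = k" using k by auto
    show ?thesis using \<delta>k[OF k1(1)] bounds(1)[OF k1(2)] facts(3)[OF k1(2)] unfolding k1(3) by linarith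
  qed (use \<delta>0 facts in auto)
  have upper: "b k \<le> \<delta> k \<and> \<delta> k \<le> 1" if k: "k \<in> {1..n}" for k
  proof (cases "k = n")
    case False
    then have k1: "k \<in> {1..<n}" "Suc k \<in> {1..n}" using k by auto
    show ?thesis using \<delta>k[OF k1(1)] bounds(2)[OF k1(2)] facts(3)[OF k1(2)] by linarith
  qed (use \<delta>0 facts in auto)
  have ord: "0 \<le> s k" "s k \<le> arccos (b k)" "arccos (b k) < arccos (a k)" "arccos (a k) \<le> s (k - 1)" "s (k - 1) \<le> pi"
    if k: "k \<in> {1..n}" for k
    unfolding s_def using lower[OF k] upper[OF k] facts(3)[OF k] bounds[OF k]
    by (auto intro!: arccos_lbound arccos_ubound arccos_le_arccos arccos_less_arccos)
  have \<alpha>pos: "0 < \<alpha> k" if "k \<in> {1..n}" for k using ord[OF that] by (simp add: \<alpha>)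
  define T where "T = (\<lambda>k x. pi * (x - s k) / \<alpha> k)"
  have T_less: "T k x < T k y \<longleftrightarrow> x < y" if "k \<in> {1..n}" for k x y
    using \<alpha>pos[OF that] by (simp add: T_def divide_less_cancel)
  have T_range: "0 \<le> T k x" "T k x \<le> pi" if "k \<in> {1..n}" "x \<in> {s k..s (k - 1)}" for k x
    using \<alpha>pos[OF that(1)] that(2) by (auto simp: T_def \<alpha> field_simps)
  have PQ: "P0 k = cos (T k (arccos (a k)))" "Q0 k = cos (T k (arccos (b k)))" for k
    by (simp_all add: P0 Q0 T_def s_def)
  show PQ_less: "P0 k < Q0 k" if k: "k \<in> {1..n}" for k
    unfolding PQ using ord[OF k] T_range[OF k] T_less[OF k]
    by (intro cos_monotone_0_pi) auto
  have main: "(\<Sum>k=1..n. (\<alpha> k)\<^sup>2 / pi\<^sup>2 * ln ((Q0 k - P0 k) / 2 - \<tau>)) \<le> ln 2 - \<gamma>"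
    if \<tau>: "0 < \<tau>" "\<And>k. k \<in> {1..n} \<Longrightarrow> 2 * \<tau> < Q0 k - P0 k" for \<tau>
  proof -
    define P Q where "P = (\<lambda>k. P0 k + \<tau>)" and "Q = (\<lambda>k. Q0 k - \<tau>)"
    have PQ': "-1 \<le> P k" "P k < Q k" "Q k \<le> 1" if "k \<in> {1..n}" for k
    proof -
      have "-1 \<le> P0 k" "Q0 k \<le> 1" by (simp_all add: PQ)
      then show "-1 \<le> P k" "P k < Q k" "Q k \<le> 1" using \<tau>(1) \<tau>(2)[OF that] by (auto simp: P_def Q_def)
    qed
    define U where "U = (\<lambda>k. strip_potential (s k) (\<alpha> k) (P k) (Q k))"
    define \<psi> where "\<psi> = (\<lambda>k. strip_potential_gradient (s k) (\<alpha> k) (P k) (Q k))"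
    define d where "d = (\<lambda>k. - (\<alpha> k / pi * ln ((Q k - P k) / 2)))"
    define V where "V = cos_lift g"
    have cV: "continuous_on UNIV V" unfolding V_def by (rule continuous_on_cos_lift[OF G])
    \<comment> \<open>For \<open>0 < Im z \<le> 1\<close> the modulus of \<open>cos z\<close> is at
      most \<open>cosh 1\<close>; this gives one bound \<open>M\<close> for \<open>V\<close> on all
      low slices.\<close>
    have "compact (g ` cball 0 (cosh 1))"
      by (rule compact_continuous_image[OF continuous_on_subset[OF green_data_basics(4)[OF G] subset_UNIV] compact_cball])
    then have "bounded (g ` cball 0 (cosh 1))" by (rule compact_imp_bounded)
    then obtain M where M: "\<forall>v\<in>g ` cball 0 (cosh 1). norm v \<le> M"
      unfolding bounded_iff by blast
    have sides: "s 0 = pi" "s n = 0" by (simp_all add: s_def \<delta>0)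
    have "0 \<le> (\<Sum>k=1..n. (s (k - 1) - s k) * (d k - (\<gamma> - ln 2)))"
    proof (rule strip_energy_comparison[of n s V "cos_lift_gradient f" "\<gamma> - ln 2" M U \<psi> d])
      show "s k \<le> s (k - 1)" if "k \<in> {1..n}" for k using \<alpha>pos[OF that] by (simp add: \<alpha>)
      show "complex_gradient V (cos_lift_gradient f) {z. 0 < Im z}"
        unfolding V_def by (rule cos_lift_complex_gradient_upper[OF G])
      show "0 \<le> V z" for z unfolding V_def by (rule cos_lift_nonneg[OF G])
      show "Im (cos_lift_gradient f z) \<le> 0" if "0 < Im z" for z
        by (rule cos_lift_gradient_Im_nonpos[OF G that])
      show "Re (cos_lift_gradient f z) = 0" if z: "0 < Im z" "Re z = s 0 \<or> Re z = s n" for z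
      proof (rule cos_lift_gradient_on_sides[OF G])
        show "sin (Re z) = 0" using z sides by auto
        show "cos z \<notin> interval_union n a b"
          using cos_notin_unit_segment[of z] z green_data_basics(2)[OF G] by auto
      qed
      show "((\<lambda>z. V z - Im z) \<longlongrightarrow> \<gamma> - ln 2) at_height_top"
        unfolding V_def by (rule cos_lift_at_height_top[OF G])
      show "((\<lambda>z. of_real (Im z) * (cos_lift_gradient f z + \<i>)) \<longlongrightarrow> 0) at_height_top"
        by (rule cos_lift_gradient_at_height_top[OF G])
      show "V z \<le> M" if z: "0 < Im z" "Im z \<le> 1" for z
      proof -
        have "norm (cos z) \<le> (norm (exp (\<i> * z)) + norm (exp (- (\<i> * z)))) / 2"
          using norm_triangle_ineq[of "exp (\<i> * z)" "exp (- (\<i> * z))"]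
          by (simp add: cos_exp_eq norm_divide)
        also have "\<dots> = cosh (Im z)" by (simp add: norm_exp_eq_Re cosh_def)
        also have "\<dots> \<le> cosh 1" using z cosh_real_nonneg_le_iff[of "Im z" 1] by simp
        finally have "norm (V z) \<le> M" using M by (auto simp: V_def cos_lift_def[OF G])
        then show ?thesis by simp
      qed
      fix k assume k: "k \<in> {1..n}"
      have sk: "s k + \<alpha> k = s (k - 1)" by (simp add: \<alpha>)
      note strip = \<alpha>pos[OF k] PQ'[OF k]
      show "complex_gradient (U k) (\<psi> k) {z. 0 < Im z}"
        unfolding U_def \<psi>_def by (rule strip_potential_complex_gradient[OF strip])
      show "0 \<le> U k z" for z unfolding U_def by (rule strip_potential_nonneg[OF strip])
      show "Im (\<psi> k z) \<le> 0" if "0 < Im z" for z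
        unfolding \<psi>_def by (rule strip_potential_gradient_Im_nonpos[OF strip that])
      show "Re (\<psi> k z) = 0" if "0 < Im z" "Re z = s k \<or> Re z = s (k - 1)" for z
        unfolding \<psi>_def using that by (intro strip_potential_gradient_on_sides[OF strip]) (auto simp: sk)
      show "((\<lambda>z. U k z - Im z) \<longlongrightarrow> d k) at_height_top"
        unfolding U_def d_def by (rule strip_potential_at_height_top[OF strip])
      show "((\<lambda>z. of_real (Im z) * (\<psi> k z + \<i>)) \<longlongrightarrow> 0) at_height_top"
        unfolding \<psi>_def by (rule strip_potential_gradient_at_height_top[OF strip])
      fix \<eta> :: real assume \<eta>: "0 < \<eta>"
      \<comment> \<open>\<open>K1\<close> lies over the interval from \<open>a k\<close> to
        \<open>b k\<close>, where \<open>V\<close> vanishes. On \<open>K2\<close> the cosine stays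
        outside the open interval from \<open>P0 k\<close> to \<open>Q0 k\<close>, hence at distance
        at least \<open>\<tau>\<close> from the shrunk segment, so that \<open>U_y\<close> vanishes
        there. Together they cover the bottom of the strip.\<close>
      define K1 where "K1 = {arccos (b k)..arccos (a k)}"
      define K2 where "K2 = {x \<in> {s k..s (k - 1)}. cos (T k x) \<le> P0 k} \<union> {x \<in> {s k..s (k - 1)}. Q0 k \<le> cos (T k x)}"
      have cT: "continuous_on {s k..s (k - 1)} (\<lambda>x. cos (T k x))"
        unfolding T_def using strip(1) by (intro continuous_intros) auto
      have "closed K2" unfolding K2_def
        by (intro closed_Un continuous_on_closed_Collect_le cT continuous_on_const) auto
      moreover have "bounded K2" by (rule bounded_subset[OF bounded_closed_interval[of "s k" "s (k - 1)"]]) (auto simp: K2_def)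
      ultimately have K2: "compact K2" by (simp add: compact_eq_bounded_closed)
      have "eventually (\<lambda>y. \<forall>x\<in>K1. \<bar>V (Complex x y)\<bar> < \<eta>) (at_right 0)"
      proof (rule uniformly_small_near_real_axis[OF _ _ _ \<eta>])
        show "compact K1" by (simp add: K1_def)
        show "continuous_on {z. Re z \<in> K1 \<and> Im z \<in> {0..1}} V" using cV continuous_on_subset by blast
        fix x assume x: "x \<in> K1"
        have "0 \<le> arccos (b k)" "arccos (a k) \<le> pi" using ord[OF k] by linarith+
        then have "cos (arccos (a k)) \<le> cos x" "cos x \<le> cos (arccos (b k))"
          using x by (auto simp: K1_def intro!: cos_monotone_0_pi_le)
        then have "a k \<le> cos x" "cos x \<le> b k"
          using bounds[OF k] facts(3)[OF k] by (auto simp: cos_arccos)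
        then have "cos (complex_of_real x) \<in> interval_union n a b"
          unfolding interval_union_def cos_of_real using k
          by (intro UN_I[of k] imageI) auto
        then show "V (of_real x) = 0"
          by (simp add: V_def cos_lift_def[OF G] green_data_basics(5)[OF G])
      qed
      moreover have "eventually (\<lambda>y. \<forall>x\<in>K2. \<bar>Im (\<psi> k (Complex x y))\<bar> < \<eta>) (at_right 0)"
        unfolding \<psi>_def
      proof (rule strip_potential_gradient_small[OF strip K2 _ \<eta>])
        fix x assume "x \<in> K2"
        then have "cos (T k x) \<le> P0 k \<or> Q0 k \<le> cos (T k x)" by (auto simp: K2_def)
        then show "cos (pi * (x - s k) / \<alpha> k) < P k \<or> Q k < cos (pi * (x - s k) / \<alpha> k)"
          using \<tau>(1) unfolding T_def P_def Q_def by linarith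
      qed
      ultimately show "eventually (\<lambda>y. \<forall>x\<in>{s k..s (k - 1)}. V (Complex x y) \<le> \<eta> \<or> - Im (\<psi> k (Complex x y)) \<le> \<eta>) (at_right 0)"
      proof eventually_elim
        case (elim y)
        show ?case
        proof
          fix x assume x: "x \<in> {s k..s (k - 1)}"
          have "x \<in> K1 \<or> x \<in> K2"
          proof (rule ccontr)
            assume "\<not> (x \<in> K1 \<or> x \<in> K2)"
            then have "P0 k < cos (T k x)" "cos (T k x) < Q0 k" and nK: "x < arccos (b k) \<or> arccos (a k) < x"
              using x by (auto simp: K1_def K2_def)
            then have "cos (T k (arccos (a k))) < cos (T k x)" "cos (T k x) < cos (T k (arccos (b k)))"
              by (simp_all add: PQ)
            moreover have "arccos (a k) \<in> {s k..s (k - 1)}" "arccos (b k) \<in> {s k..s (k - 1)}"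
              using ord[OF k] by auto
            note r = T_range[OF k this(1)] T_range[OF k this(2)] T_range[OF k x]
            ultimately have "T k x < T k (arccos (a k))" "T k (arccos (b k)) < T k x"
              using cos_mono_less_eq r by blast+
            then show False using nK T_less[OF k] by auto
          qed
          then show "V (Complex x y) \<le> \<eta> \<or> - Im (\<psi> k (Complex x y)) \<le> \<eta>"
            using elim(1)[rule_format, of x] elim(2)[rule_format, of x] by linarith
        qed
      qed
    qed
    also have "\<dots> = (\<Sum>k=1..n. - pi * ((\<alpha> k)\<^sup>2 / pi\<^sup>2 * ln ((Q0 k - P0 k) / 2 - \<tau>)) + (s (k - 1) - s k) * (ln 2 - \<gamma>))"
    proof (intro sum.cong refl)
      fix k
      have e: "(Q k - P k) / 2 = (Q0 k - P0 k) / 2 - \<tau>" by (simp add: P_def Q_def field_simps)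
      have "A * (- (A / pi * L) - (\<gamma> - ln 2)) = - pi * (A\<^sup>2 / pi\<^sup>2 * L) + A * (ln 2 - \<gamma>)" for A L
        by (simp add: field_simps power2_eq_square)
      then show "(s (k - 1) - s k) * (d k - (\<gamma> - ln 2)) = - pi * ((\<alpha> k)\<^sup>2 / pi\<^sup>2 * ln ((Q0 k - P0 k) / 2 - \<tau>)) + (s (k - 1) - s k) * (ln 2 - \<gamma>)"
        unfolding d_def e \<alpha>[symmetric] by blast
    qed
    also have "\<dots> = - pi * (\<Sum>k=1..n. (\<alpha> k)\<^sup>2 / pi\<^sup>2 * ln ((Q0 k - P0 k) / 2 - \<tau>)) + (\<Sum>k=1..n. s (k - 1) - s k) * (ln 2 - \<gamma>)"
      unfolding sum.distrib sum_distrib_left sum_distrib_right ..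
    also have "(\<Sum>k=1..n. s (k - 1) - s k) = pi"
      using sum_telescope''[of 0 n "\<lambda>k. - s k"] by (simp add: sides)
    finally have "pi * (\<Sum>k=1..n. (\<alpha> k)\<^sup>2 / pi\<^sup>2 * ln ((Q0 k - P0 k) / 2 - \<tau>)) \<le> pi * (ln 2 - \<gamma>)" by simp
    then show ?thesis by (rule mult_left_le_imp_le) simp
  qed
  show "(\<Sum>k=1..n. (\<alpha> k)\<^sup>2 / pi\<^sup>2 * ln ((Q0 k - P0 k) / 2)) \<le> ln 2 - \<gamma>"
  proof (rule tendsto_upperbound)
    have "((\<lambda>\<tau>. \<Sum>k=1..n. (\<alpha> k)\<^sup>2 / pi\<^sup>2 * ln ((Q0 k - P0 k) / 2 - \<tau>))
        \<longlongrightarrow> (\<Sum>k=1..n. (\<alpha> k)\<^sup>2 / pi\<^sup>2 * ln ((Q0 k - P0 k) / 2 - 0))) (at_right 0)"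
    proof (intro tendsto_sum tendsto_mult tendsto_const tendsto_ln tendsto_diff tendsto_ident_at)
      fix k assume "k \<in> {1..n}"
      then show "(Q0 k - P0 k) / 2 - 0 \<noteq> 0" using PQ_less by fastforce
    qed
    then show "((\<lambda>\<tau>. \<Sum>k=1..n. (\<alpha> k)\<^sup>2 / pi\<^sup>2 * ln ((Q0 k - P0 k) / 2 - \<tau>))
        \<longlongrightarrow> (\<Sum>k=1..n. (\<alpha> k)\<^sup>2 / pi\<^sup>2 * ln ((Q0 k - P0 k) / 2))) (at_right 0)" by simp
    have "eventually (\<lambda>\<tau>. \<forall>k\<in>{1..n}. \<tau> < (Q0 k - P0 k) / 2) (at_right 0)"
      by (intro eventually_ball_finite ballI order_tendstoD(2)[OF tendsto_ident_at]) (use PQ_less in auto)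
    then show "eventually (\<lambda>\<tau>. (\<Sum>k=1..n. (\<alpha> k)\<^sup>2 / pi\<^sup>2 * ln ((Q0 k - P0 k) / 2 - \<tau>)) \<le> ln 2 - \<gamma>) (at_right 0)"
      using eventually_at_right_less[of "0::real"]
    proof eventually_elim
      case (elim \<tau>)
      show ?case
      proof (rule main)
        show "2 * \<tau> < Q0 k - P0 k" if "k \<in> {1..n}" for k using elim(1)[rule_format, OF that] by (simp add: less_divide_eq mult.commute)
      qed (rule elim(2))
    qed
  qed simp
qed

lemma cut_product_le_log_capacity:
  assumes n: "1 \<le> n" and sys: "interval_system n a b" and \<delta>: "\<delta> \<in> cuts n a b"
  shows "cut_product n a b \<delta> \<le> 2 * log_capacity (interval_union n a b)"
proof -
  obtain g f \<gamma> where G: "green_data (interval_union n a b) g f \<gamma>"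
    using green_data_interval_union[OF n sys] by blast
  define \<alpha> where "\<alpha> = (\<lambda>k. arccos (\<delta> (k - 1)) - arccos (\<delta> k))"
  define P0 where "P0 = (\<lambda>k. cos (pi * (arccos (a k) - arccos (\<delta> k)) / \<alpha> k))"
  define Q0 where "Q0 = (\<lambda>k. cos (pi * (arccos (b k) - arccos (\<delta> k)) / \<alpha> k))"
  note * = green_data_le_cut_sum[OF n sys \<delta> G, of \<alpha> P0 Q0]
  have less: "P0 k < Q0 k" if "k \<in> {1..n}" for k
    by (rule *(1)[OF _ _ _ that]) (simp_all add: \<alpha>_def P0_def Q0_def)
  have sum: "(\<Sum>k=1..n. (\<alpha> k)\<^sup>2 / pi\<^sup>2 * ln ((Q0 k - P0 k) / 2)) \<le> ln 2 - \<gamma>"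
    by (rule *(2)) (simp_all add: \<alpha>_def P0_def Q0_def)
  have "cut_product n a b \<delta> = (\<Prod>k=1..n. (1/2 * (Q0 k - P0 k)) powr ((\<alpha> k)\<^sup>2 / pi\<^sup>2))"
    unfolding cut_product_def P0_def Q0_def \<alpha>_def
    by (intro prod.cong refl arg_cong2[where f = "(powr)"]) (simp_all add: power2_commute)
  also have "\<dots> = (\<Prod>k=1..n. exp ((\<alpha> k)\<^sup>2 / pi\<^sup>2 * ln ((Q0 k - P0 k) / 2)))"
  proof (intro prod.cong refl)
    fix k assume "k \<in> {1..n}"
    then have "0 < (Q0 k - P0 k) / 2" using less by simp
    moreover have "1/2 * (Q0 k - P0 k) = (Q0 k - P0 k) / 2" by simp
    ultimately show "(1/2 * (Q0 k - P0 k)) powr ((\<alpha> k)\<^sup>2 / pi\<^sup>2) = exp ((\<alpha> k)\<^sup>2 / pi\<^sup>2 * ln ((Q0 k - P0 k) / 2))"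
      unfolding powr_def by (simp only: if_False less_imp_neq[symmetric])
  qed
  also have "\<dots> = exp (\<Sum>k=1..n. (\<alpha> k)\<^sup>2 / pi\<^sup>2 * ln ((Q0 k - P0 k) / 2))"
    by (rule exp_sum[symmetric]) simp
  also have "\<dots> \<le> exp (ln 2 - \<gamma>)" using sum by simp
  also have "\<dots> = 2 * exp (- \<gamma>)" by (simp add: exp_diff exp_minus field_simps)
  finally show ?thesis by (simp add: log_capacity_green_data[OF G])
qed


section \<open>The extremal sets\<close>

fun chebyshev :: "nat \<Rightarrow> complex \<Rightarrow> complex" where
  "chebyshev 0 z = 1"
| "chebyshev (Suc 0) z = z"
| "chebyshev (Suc (Suc n)) z = 2 * z * chebyshev (Suc n) z - chebyshev n z"

lemma chebyshev_cos: "chebyshev n (cos t) = cos (of_nat n * t)"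
proof (induction n "cos t" rule: chebyshev.induct)
  case (3 n)
  have "cos (of_nat (Suc (Suc n)) * t) + cos (of_nat n * t) = 2 * cos t * cos (of_nat (Suc n) * t)"
    using cos_times_cos[of "of_nat (Suc n) * t" t] by (simp add: algebra_simps)
  then show ?case using 3 by (simp add: algebra_simps)
qed simp_all

lemma chebyshev_of_real_cos: "chebyshev n (of_real (cos \<theta>)) = of_real (cos (real n * \<theta>))"
proof -
  have "of_nat n * of_real \<theta> = (of_real (real n * \<theta>) :: complex)" by simp
  then show ?thesis using chebyshev_cos[of n "of_real \<theta>"] by (simp only: cos_of_real)
qed

lemma eventually_nonzero_at_infinity: "eventually (\<lambda>z::complex. z \<noteq> 0) at_infinity"
  unfolding eventually_at_infinity by (intro exI[of _ 1] allI impI) auto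

lemma chebyshev_holomorphic: "chebyshev n holomorphic_on S"
proof (induction n rule: induct_nat_012)
  case 0
  have "chebyshev 0 = (\<lambda>z. 1)" by (simp add: fun_eq_iff)
  then show ?case by simp
next
  case 1
  have "chebyshev (Suc 0) = (\<lambda>z. z)" by (simp add: fun_eq_iff)
  then show ?case by (simp add: holomorphic_on_ident)
next
  case (ge2 n)
  have "chebyshev (Suc (Suc n)) = (\<lambda>z. 2 * z * chebyshev (Suc n) z - chebyshev n z)"
    by (simp add: fun_eq_iff)
  then show ?case using ge2 by (simp only:) (intro holomorphic_intros)
qed

text \<open>Dividing the recursion by \<open>z ^ (n + 2)\<close> leaves twice the previous quotient
  in the limit. The leading coefficient enters the capacity of the preimage.\<close>

lemma chebyshev_at_infinity:
  "((\<lambda>z. chebyshev n z / z ^ n) \<longlongrightarrow> (if n = 0 then 1 else 2 ^ (n - 1))) at_infinity"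
proof (induction n rule: induct_nat_012)
  case 1
  have "((\<lambda>z::complex. z / z) \<longlongrightarrow> 1) at_infinity"
    by (rule tendsto_eventually, rule eventually_mono[OF eventually_nonzero_at_infinity]) simp
  then show ?case by simp
next
  case (ge2 n)
  let ?L = "\<lambda>n. if n = 0 then 1 else 2 ^ (n - 1) :: complex"
  have "((\<lambda>z. 2 * (chebyshev (Suc n) z / z ^ Suc n) - chebyshev n z / z ^ n * (inverse z)\<^sup>2) \<longlongrightarrow>
      2 * ?L (Suc n) - ?L n * 0\<^sup>2) at_infinity"
    by (intro tendsto_intros ge2 tendsto_inverse_0)
  then have "((\<lambda>z. 2 * (chebyshev (Suc n) z / z ^ Suc n) - chebyshev n z / z ^ n * (inverse z)\<^sup>2) \<longlongrightarrow>
      ?L (Suc (Suc n))) at_infinity" by simp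
  then show ?case
  proof (rule Lim_transform_eventually)
    have "2 * (x / z ^ Suc n) - y / z ^ n * (inverse z)\<^sup>2 = (2 * z * x - y) / z ^ Suc (Suc n)"
      if "z \<noteq> 0" for x y z :: complex
      using that by (simp add: field_simps power2_eq_square)
    then show "\<forall>\<^sub>F z in at_infinity. 2 * (chebyshev (Suc n) z / z ^ Suc n) - chebyshev n z / z ^ n * (inverse z)\<^sup>2
        = chebyshev (Suc (Suc n)) z / z ^ Suc (Suc n)"
      unfolding chebyshev.simps(3) by (intro eventually_mono[OF eventually_nonzero_at_infinity])
  qed
qed simp

context
  fixes l :: real and N :: nat
  assumes l: "0 < l" "l < 2 * pi" and N: "0 < N"
begin

lemma half_cos_range: "-1 < cos (l / 2)" "cos (l / 2) < 1"
  using cos_monotone_0_pi[of 0 "l / 2"] cos_monotone_0_pi[of "l / 2" pi] l by auto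

text \<open>Both \<open>\<bar>Arg w\<bar>\<close> and \<open>l / 2\<close> lie in
  \<open>[0, pi]\<close>, where \<open>cos\<close> decreases; so the condition on the argument
  becomes one on \<open>Re w\<close>.\<close>

lemma cis_mem_arc_set_iff: "cis \<theta> \<in> arc_set l N \<longleftrightarrow> cos (l / 2) \<le> cos (real N * \<theta>)"
proof -
  define w where "w = cis \<theta> ^ N"
  have w: "w = cis (real N * \<theta>)" unfolding w_def by (rule Complex.DeMoivre)
  have "norm w = 1" by (simp add: w)
  then have "w \<noteq> 0" by auto
  then have "w = cis (Arg w)" using Arg_eq[of w] \<open>norm w = 1\<close> by (simp add: cis_conv_exp)
  then have "Re w = cos (Arg w)" by (metis cis.simps(1))
  then have "cos (real N * \<theta>) = cos \<bar>Arg w\<bar>" by (simp add: w)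
  moreover have "\<bar>Arg w\<bar> \<le> pi" using Arg_le_pi[of w] mpi_less_Arg[of w] by auto
  then have "cos (l / 2) \<le> cos \<bar>Arg w\<bar> \<longleftrightarrow> \<bar>Arg w\<bar> \<le> l / 2"
    using l by (intro cos_mono_le_eq) auto
  ultimately show ?thesis by (simp add: arc_set_def w_def)
qed

lemma arc_projection_iff:
  "z \<in> arc_projection l N \<longleftrightarrow> (\<exists>\<theta>::real. z = of_real (cos \<theta>) \<and> cos (l / 2) \<le> cos (real N * \<theta>))"
proof
  assume "z \<in> arc_projection l N"
  then obtain w where w: "w \<in> arc_set l N" "z = of_real (Re w)" unfolding arc_projection_def by blast
  have "norm w = 1" using w(1) by (simp add: arc_set_def)
  then obtain t where "w = Complex (cos t) (sin t)" by (rule complex_unimodular_polar)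
  then have t: "w = cis t" by (simp add: complex_eq_iff)
  show "\<exists>\<theta>. z = of_real (cos \<theta>) \<and> cos (l / 2) \<le> cos (real N * \<theta>)"
    using w cis_mem_arc_set_iff[of t] unfolding t by (intro exI[of _ t]) simp
next
  assume "\<exists>\<theta>. z = of_real (cos \<theta>) \<and> cos (l / 2) \<le> cos (real N * \<theta>)"
  then obtain \<theta> where \<theta>: "z = of_real (cos \<theta>)" "cis \<theta> \<in> arc_set l N"
    unfolding cis_mem_arc_set_iff by blast
  show "z \<in> arc_projection l N"
    unfolding arc_projection_def by (rule image_eqI[OF _ \<theta>(2)]) (simp add: \<theta>(1))
qed

text \<open>No non-real \<open>z\<close> is mapped into the segment: writing
  \<open>z = cos t\<close>, a value of \<open>cos (N * t)\<close> in \<open>[-1, 1]\<close> forces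
  \<open>t\<close> to be real.\<close>

lemma arc_projection_eq_vimage:
  "arc_projection l N = {z. chebyshev N z \<in> real_segment (cos (l / 2)) 1}"
proof (intro set_eqI iffI)
  fix z assume "z \<in> arc_projection l N"
  then obtain \<theta> where \<theta>: "z = of_real (cos \<theta>)" "cos (l / 2) \<le> cos (real N * \<theta>)"
    unfolding arc_projection_iff by blast
  show "z \<in> {z. chebyshev N z \<in> real_segment (cos (l / 2)) 1}"
    unfolding \<theta>(1) mem_Collect_eq chebyshev_of_real_cos real_segment_def
    using \<theta>(2) by (intro imageI) simp
next
  fix z assume "z \<in> {z. chebyshev N z \<in> real_segment (cos (l / 2)) 1}"
  then obtain x where x: "chebyshev N z = of_real x" "cos (l / 2) \<le> x" "x \<le> 1"
    by (auto simp: real_segment_def)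
  define t where "t = Arccos z"
  have zt: "z = cos t" by (simp add: t_def)
  have "cos (of_nat N * t) \<in> real_segment (-1) 1"
    using half_cos_range x by (auto simp: real_segment_def zt chebyshev_cos)
  then have "Im (of_nat N * t) = 0" using cos_notin_unit_segment by blast
  then have "Im t = 0" using N by simp
  then have "t = of_real (Re t)" by (simp add: complex_eq_iff)
  then have z: "z = of_real (cos (Re t))" unfolding zt by (metis cos_of_real)
  have "of_real (cos (real N * Re t)) = complex_of_real x"
    using x(1) unfolding z chebyshev_of_real_cos .
  then have "cos (real N * Re t) = x" by (simp only: of_real_eq_iff)
  then show "z \<in> arc_projection l N" unfolding arc_projection_iff using z x(2) by blast
qed

text \<open>For a polynomial of degree \<open>N\<close> with leading coefficient \<open>A\<close>
  the Green function of a preimage is \<open>1 / N\<close> times the pullback, so its capacity is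
  \<open>(cap / A) powr (1 / N)\<close>. Here the segment has capacity
  \<open>(1 - cos (l / 2)) / 4\<close> and \<open>A = 2 ^ (N - 1)\<close>; the powers of 2 combine
  to the factor \<open>1/2\<close> in front.\<close>

lemma log_capacity_arc_projection:
  "log_capacity (arc_projection l N) = 1/2 * ((1 - cos (l / 2)) / 2) powr (1 / real N)"
proof -
  let ?E = "arc_projection l N"
  define q where "q = cos (l / 2)"
  have q: "-1 < q" "q < 1" using half_cos_range by (simp_all add: q_def)
  define T where "T = chebyshev N"
  have E: "?E = {z. T z \<in> real_segment q 1}" by (simp add: arc_projection_eq_vimage T_def q_def)
  have cT: "continuous_on UNIV T" unfolding T_def
    by (rule holomorphic_on_imp_continuous_on[OF chebyshev_holomorphic])
  have real: "?E \<subseteq> \<real>" "?E \<subseteq> cball 0 1" by (auto simp: arc_projection_iff)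
  have "closed (T -` real_segment q 1)"
    by (rule closed_vimage[OF compact_imp_closed[OF compact_real_segment] cT])
  then have closed: "closed ?E" by (simp add: E vimage_def)
  then have compact: "compact ?E"
    using real(2) bounded_subset[OF bounded_cball] by (simp add: compact_eq_bounded_closed)
  have outside: "outside ?E = - ?E" by (rule outside_real_subset[OF real(1)])
  define g where "g = (\<lambda>z. 1 / real N * segment_green q 1 (T z))"
  have grad: "complex_gradient g (\<lambda>z. of_real (1 / real N) * (1 / segment_root q 1 (T z) * deriv T z)) (- ?E)"
    unfolding g_def
  proof (rule complex_gradient_cmult[OF complex_gradient_compose[OF complex_gradient_segment_green[OF q(2)]]])
    show "open (- ?E)" by (rule open_Compl[OF closed])
    show "T holomorphic_on - ?E" unfolding T_def by (rule chebyshev_holomorphic)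
  qed (auto simp: E)
  have N0: "N \<noteq> 0" using N by simp
  have ratio: "((\<lambda>z. T z / z ^ N) \<longlongrightarrow> 2 ^ (N - 1)) at_infinity"
    using chebyshev_at_infinity[of N] N by (simp add: T_def)
  have Tinf: "filterlim T at_infinity at_infinity"
  proof -
    have *: "filterlim (\<lambda>z. T z / z ^ N * z ^ N) at_infinity at_infinity"
      by (rule tendsto_mult_filterlim_at_infinity[OF ratio _ filterlim_power_at_infinity])
         (use N in \<open>auto simp: filterlim_ident\<close>)
    have "eventually (\<lambda>z. T z / z ^ N * z ^ N = T z) at_infinity"
      using eventually_nonzero_at_infinity by eventually_elim simp
    from iffD1[OF filterlim_cong[OF refl refl this] *] show ?thesis .
  qed
  define \<gamma> where "\<gamma> = 1 / real N * (ln (4 / (1 - q)) + ln (norm (2 ^ (N - 1) :: complex)))"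
  have "((\<lambda>z. 1 / real N * ((segment_green q 1 (T z) - ln (norm (T z))) + ln (norm (T z / z ^ N)))) \<longlongrightarrow> \<gamma>) at_infinity"
    unfolding \<gamma>_def
    by (intro tendsto_mult_left tendsto_add tendsto_ln tendsto_norm ratio
        filterlim_compose[OF segment_green_at_infinity[OF q(2)] Tinf]) simp
  then have lim: "((\<lambda>z. g z - ln (norm z)) \<longlongrightarrow> \<gamma>) at_infinity"
  proof (rule Lim_transform_eventually)
    have "eventually (\<lambda>z. T z / z ^ N \<noteq> 0) at_infinity"
      by (rule tendsto_imp_eventually_ne[OF ratio]) simp
    moreover note eventually_nonzero_at_infinity
    ultimately show "\<forall>\<^sub>F z in at_infinity. 1 / real N * ((segment_green q 1 (T z) - ln (norm (T z))) + ln (norm (T z / z ^ N)))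
        = g z - ln (norm z)"
    proof eventually_elim
      case (elim z)
      then have "ln (norm (T z / z ^ N)) = ln (norm (T z)) - real N * ln (norm z)"
        by (simp add: norm_divide norm_power ln_div ln_realpow)
      then show ?case using N by (simp add: g_def field_simps)
    qed
  qed
  have green: "is_green_at_infinity ?E g"
  proof (rule is_green_at_infinityI[OF compact outside _ _ _ _ lim])
    show "continuous_on UNIV g" unfolding g_def
      by (intro continuous_intros continuous_on_compose2[OF continuous_on_segment_green[OF q(2)] cT]) auto
    show "harmonic_on g (- ?E)" by (rule harmonic_on_complex_gradient[OF grad])
    show "g z = 0" if "z \<in> ?E" for z using that segment_green_eq_0[OF q(2)] by (simp add: g_def E)
    show "0 < g z" if "z \<notin> ?E" for z using that segment_green_pos[OF q(2)] N by (simp add: g_def E)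
  qed
  have "ln (norm (2 ^ (N - 1) :: complex)) = (real N - 1) * ln 2"
    using N by (simp add: norm_power ln_realpow of_nat_diff)
  moreover have "ln (4 / (1 - q)) = ln 2 - ln ((1 - q) / 2)"
    using q ln_realpow[of 2 2] by (simp add: ln_div)
  ultimately have "\<gamma> = ln 2 - 1 / real N * ln ((1 - q) / 2)"
    using N by (simp add: \<gamma>_def field_simps)
  then have "exp (- \<gamma>) = exp (1 / real N * ln ((1 - q) / 2)) / 2"
    by (simp add: exp_diff)
  then show ?thesis
    using log_capacity_eq_exp[OF compact outside green lim] q by (simp add: powr_def q_def)
qed

end

text \<open>In the coordinate \<open>\<theta> = arccos x\<close> the intervals of \<open>arc_projection l (2 * m)\<close> have the centres
  \<open>pi * (n - k) / m\<close> and half-length \<open>l / (4 * m)\<close>, cut off at \<open>0\<close> and \<open>pi\<close>.\<close>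

context
  fixes n m :: nat and l :: real
  assumes n: "n = Suc m" "0 < m" and l: "0 < l" "l < 2 * pi"
begin

definition arc_step :: real where "arc_step = pi / real m"

definition arc_radius :: real where "arc_radius = l / (4 * real m)"

definition arc_centre :: "nat \<Rightarrow> real" where "arc_centre k = pi * (real n - real k) / real m"

definition arc_lower :: "nat \<Rightarrow> real" where
  "arc_lower k = (if k = n then 0 else arc_centre k - arc_radius)"

definition arc_upper :: "nat \<Rightarrow> real" where
  "arc_upper k = (if k = 1 then pi else arc_centre k + arc_radius)"

lemma arc_counts: "real n = real m + 1" "0 < m" "0 < real m" "n \<noteq> Suc 0" "0 < n"
  using n by auto

lemma arc_radius: "0 < arc_radius" "2 * arc_radius < arc_step" "pi * arc_radius / arc_step = l / 4"
  using l arc_counts by (auto simp: arc_radius_def arc_step_def field_simps)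

lemma arc_step: "0 < arc_step" "arc_step \<le> pi" "arc_step\<^sup>2 / pi\<^sup>2 = 1 / (real m)\<^sup>2"
  using arc_counts by (auto simp: arc_step_def field_simps power_divide)

lemma arc_centre:
  shows "arc_centre 1 = pi" "arc_centre n = 0" "arc_centre (Suc k) = arc_centre k - arc_step"
    "k < n \<Longrightarrow> arc_step \<le> arc_centre k" "1 < k \<Longrightarrow> arc_centre k \<le> pi - arc_step"
proof -
  show "arc_centre 1 = pi" "arc_centre n = 0" "arc_centre (Suc k) = arc_centre k - arc_step"
    using arc_counts by (auto simp: arc_centre_def arc_step_def field_simps)
  show "arc_step \<le> arc_centre k" if "k < n"
    unfolding arc_step_def arc_centre_def using that arc_counts by (intro divide_right_mono) auto
  show "arc_centre k \<le> pi - arc_step" if "1 < k"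
  proof -
    have "pi * (real n - real k) \<le> pi * (real m - 1)" using that arc_counts by (intro mult_left_mono) auto
    then have "arc_centre k \<le> pi * (real m - 1) / real m"
      unfolding arc_centre_def by (intro divide_right_mono) auto
    also have "\<dots> = pi - arc_step" using arc_counts by (simp add: arc_step_def field_simps)
    finally show ?thesis .
  qed
qed

lemma arc_bounds:
  assumes k: "k \<in> {1..n}"
  shows "0 \<le> arc_lower k" "arc_lower k < arc_upper k" "arc_upper k \<le> pi"
proof -
  consider "k = 1" "k < n" | "k = n" "1 < k" | "1 < k" "k < n" using k arc_counts by fastforce
  then have "0 \<le> arc_lower k \<and> arc_lower k < arc_upper k \<and> arc_upper k \<le> pi"
  proof cases
    case 1
    then have "arc_lower k = pi - arc_radius" "arc_upper k = pi"
      using arc_centre(1) by (simp_all add: arc_lower_def arc_upper_def)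
    then show ?thesis using arc_radius arc_step by linarith
  next
    case 2
    then have "arc_lower k = 0" "arc_upper k = arc_radius"
      using arc_centre(2) by (simp_all add: arc_lower_def arc_upper_def)
    then show ?thesis using arc_radius arc_step by linarith
  next
    case 3
    then have "arc_lower k = arc_centre k - arc_radius" "arc_upper k = arc_centre k + arc_radius"
      by (simp_all add: arc_lower_def arc_upper_def)
    then show ?thesis using arc_radius arc_step arc_centre(4)[of k] arc_centre(5)[of k] 3 by linarith
  qed
  then show "0 \<le> arc_lower k" "arc_lower k < arc_upper k" "arc_upper k \<le> pi" by auto
qed

lemma extremal_cut_arc:
  assumes k: "k \<in> {1..<n}"
  shows "extremal_cut n k = cos (arc_centre k - arc_step / 2)"
proof -
  have eq: "pi * (2 * x - 1) / (2 * y) = pi * x / y - pi / y / 2" if "y \<noteq> 0" for x y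
    using that by (simp add: field_simps)
  have m: "real n - 1 = real m" "real m \<noteq> 0" using arc_counts by auto
  have "extremal_cut n k = cos (pi * (2 * (real n - real k) - 1) / (2 * (real n - 1)))"
    using k by (auto simp: extremal_cut_def)
  then show ?thesis unfolding m(1) eq[OF m(2)] arc_centre_def arc_step_def .
qed

lemma arc_gap:
  assumes k: "k \<in> {1..<n}"
  shows "arc_upper (Suc k) < arc_centre k - arc_step / 2" "arc_centre k - arc_step / 2 < arc_lower k"
proof -
  have "arc_lower k = arc_centre k - arc_radius" using k by (simp add: arc_lower_def)
  then show "arc_centre k - arc_step / 2 < arc_lower k" using arc_radius by linarith
  have "arc_upper (Suc k) = arc_centre k - arc_step + arc_radius"
    using k arc_centre(3)[of k] by (simp add: arc_upper_def)
  then show "arc_upper (Suc k) < arc_centre k - arc_step / 2" using arc_radius by linarith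
qed

text \<open>The cosine reverses the order: the upper angle yields the left endpoint, and the centres
  decrease in \<open>k\<close>.\<close>

lemma arc_interval_system: "interval_system n (\<lambda>k. cos (arc_upper k)) (\<lambda>k. cos (arc_lower k))"
  unfolding interval_system_def
proof (intro conjI ballI)
  show "cos (arc_upper k) < cos (arc_lower k)" if "k \<in> {1..n}" for k
    by (intro cos_monotone_0_pi arc_bounds that)
  show "cos (arc_lower k) < cos (arc_upper (Suc k))" if k: "k \<in> {1..<n}" for k
  proof -
    have k': "k \<in> {1..n}" "Suc k \<in> {1..n}" using k by auto
    show ?thesis
      using arc_gap[OF k] arc_bounds[OF k'(1)] arc_bounds[OF k'(2)] by (intro cos_monotone_0_pi; linarith)
  qed
qed (simp_all add: arc_lower_def arc_upper_def)

lemma extremal_cut_mem: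
  "extremal_cut n \<in> cuts n (\<lambda>k. cos (arc_upper k)) (\<lambda>k. cos (arc_lower k))"
proof -
  have "cos (arc_lower k) < extremal_cut n k \<and> extremal_cut n k < cos (arc_upper (Suc k))" if k: "k \<in> {1..<n}" for k
  proof -
    have k': "k \<in> {1..n}" "Suc k \<in> {1..n}" using k by auto
    show ?thesis
      unfolding extremal_cut_arc[OF k] using arc_gap[OF k] arc_bounds[OF k'(1)] arc_bounds[OF k'(2)]
      by (intro conjI cos_monotone_0_pi; linarith)
  qed
  then show ?thesis using arc_counts by (simp add: cuts_def extremal_cut_def[of n 0] extremal_cut_def[of n n])
qed

text \<open>Since \<open>2 * m * arc_step = 2 * pi\<close>, the condition on
  \<open>cos (2 * m * \<theta>)\<close> depends only on the distance of \<open>\<theta>\<close> from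
  the nearest multiple of \<open>arc_step\<close>, and says that this distance is at most
  \<open>arc_radius\<close>. The multiple with factor \<open>j\<close> is the centre with index
  \<open>k = n - j\<close>.\<close>

lemma arc_projection_eq_interval_union:
  "arc_projection l (2 * m) = interval_union n (\<lambda>k. cos (arc_upper k)) (\<lambda>k. cos (arc_lower k))"
proof (intro set_eqI)
  fix z
  have N: "0 < 2 * m" using arc_counts by simp
  have half: "real m * arc_step = pi" "real m * arc_radius = l / 4"
    using arc_counts by (simp_all add: arc_step_def arc_radius_def)
  have cj: "arc_centre (n - j) = real j * arc_step" if "j \<le> m" for j
  proof -
    have "real (n - j) = real n - real j" using that arc_counts by (simp add: of_nat_diff)
    then show ?thesis by (simp add: arc_centre_def arc_step_def)
  qed
  have close: "cos (l / 2) \<le> cos (real (2 * m) * \<theta>) \<longleftrightarrow> \<bar>\<theta> - real j * arc_step\<bar> \<le> arc_radius"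
    if small: "\<bar>\<theta> - real j * arc_step\<bar> \<le> arc_step / 2" for \<theta> j
  proof -
    define t where "t = \<theta> - real j * arc_step"
    have "real (2 * m) * \<theta> = 2 * real m * t + of_int (int j) * (2 * pi)"
      unfolding t_def half(1)[symmetric] by (simp add: algebra_simps)
    then have "cos (real (2 * m) * \<theta>) = cos (2 * real m * t)"
      using cos.plus_of_int[of "2 * real m * t" "int j"] by simp
    also have "\<dots> = cos \<bar>2 * real m * t\<bar>" by simp
    also have "\<bar>2 * real m * t\<bar> = 2 * (real m * \<bar>t\<bar>)" by (simp add: abs_mult)
    finally have eq: "cos (real (2 * m) * \<theta>) = cos (2 * (real m * \<bar>t\<bar>))" .
    have "real m * \<bar>t\<bar> \<le> real m * (arc_step / 2)" using small by (intro mult_left_mono) (auto simp: t_def)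
    then have "2 * (real m * \<bar>t\<bar>) \<le> pi" using half(1) by simp
    then have "cos (l / 2) \<le> cos (2 * (real m * \<bar>t\<bar>)) \<longleftrightarrow> 2 * (real m * \<bar>t\<bar>) \<le> l / 2"
      using l by (intro cos_mono_le_eq) auto
    also have "\<dots> \<longleftrightarrow> real m * \<bar>t\<bar> \<le> real m * arc_radius" using half(2) by auto
    also have "\<dots> \<longleftrightarrow> \<bar>t\<bar> \<le> arc_radius" using arc_counts(3) by (rule mult_le_cancel_left_pos)
    finally show ?thesis unfolding eq t_def .
  qed
  have mem: "cos \<theta> \<in> {cos (arc_upper k)..cos (arc_lower k)} \<longleftrightarrow> \<bar>\<theta> - arc_centre k\<bar> \<le> arc_radius"
    if \<theta>: "0 \<le> \<theta>" "\<theta> \<le> pi" and k: "k \<in> {1..n}" for \<theta> k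
  proof -
    have "cos \<theta> \<in> {cos (arc_upper k)..cos (arc_lower k)} \<longleftrightarrow> arc_lower k \<le> \<theta> \<and> \<theta> \<le> arc_upper k"
      using cos_mono_le_eq[of "arc_upper k" \<theta>] cos_mono_le_eq[of \<theta> "arc_lower k"] arc_bounds[OF k] \<theta> by auto
    moreover have "arc_lower k \<le> \<theta> \<longleftrightarrow> arc_centre k - arc_radius \<le> \<theta>"
      using \<theta> arc_radius arc_centre(2) by (cases "k = n") (simp_all add: arc_lower_def)
    moreover have "\<theta> \<le> arc_upper k \<longleftrightarrow> \<theta> \<le> arc_centre k + arc_radius"
      using \<theta> arc_radius arc_centre(1) by (cases "k = 1") (simp_all add: arc_upper_def)
    ultimately show ?thesis by (simp add: abs_le_iff) linarith
  qed
  show "z \<in> arc_projection l (2 * m) \<longleftrightarrow> z \<in> interval_union n (\<lambda>k. cos (arc_upper k)) (\<lambda>k. cos (arc_lower k))"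
  proof
    assume "z \<in> arc_projection l (2 * m)"
    then obtain \<phi> where \<phi>: "z = of_real (cos \<phi>)" "cos (l / 2) \<le> cos (real (2 * m) * \<phi>)"
      unfolding arc_projection_iff[OF l N] by blast
    \<comment> \<open>\<open>cos (2 * m * \<phi>)\<close> is a polynomial in
      \<open>cos \<phi>\<close>, so \<open>\<phi>\<close> may be replaced by its representative in
      \<open>[0, pi]\<close>.\<close>
    define \<theta> where "\<theta> = arccos (cos \<phi>)"
    have \<theta>: "0 \<le> \<theta>" "\<theta> \<le> pi" "cos \<theta> = cos \<phi>" by (auto simp: \<theta>_def cos_arccos arccos_lbound arccos_ubound)
    have "complex_of_real (cos (real (2 * m) * \<theta>)) = of_real (cos (real (2 * m) * \<phi>))"
      unfolding chebyshev_of_real_cos[symmetric] \<theta>(3) ..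
    then have "cos (real (2 * m) * \<theta>) = cos (real (2 * m) * \<phi>)" by (simp only: of_real_eq_iff)
    then have c: "cos (l / 2) \<le> cos (real (2 * m) * \<theta>)" using \<phi>(2) by simp
    \<comment> \<open>Rounding selects the nearest centre; being within half a step of it is the
      range in which \<open>close\<close> applies.\<close>
    define j where "j = nat (round (\<theta> / arc_step))"
    have "0 \<le> \<theta> / arc_step" using \<theta> arc_step by simp
    moreover have "\<theta> / arc_step \<le> real m" using \<theta> arc_step half(1) by (simp add: divide_le_eq)
    ultimately have "0 \<le> round (\<theta> / arc_step)" "round (\<theta> / arc_step) \<le> int m"
      using round_mono[of 0 "\<theta> / arc_step"] round_mono[of "\<theta> / arc_step" "real m"] by auto
    then have j: "j \<le> m" "real j = of_int (round (\<theta> / arc_step))" by (auto simp: j_def)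
    have "\<bar>\<theta> / arc_step - real j\<bar> \<le> 1 / 2"
      using of_int_round_abs_le[of "\<theta> / arc_step"] by (simp add: j abs_minus_commute)
    then have "\<bar>\<theta> / arc_step - real j\<bar> * arc_step \<le> 1 / 2 * arc_step"
      using arc_step by (intro mult_right_mono) auto
    moreover have "\<bar>\<theta> / arc_step - real j\<bar> * arc_step = \<bar>(\<theta> / arc_step - real j) * arc_step\<bar>"
      using arc_step by (simp add: abs_mult)
    moreover have "(\<theta> / arc_step - real j) * arc_step = \<theta> - real j * arc_step"
      using arc_step by (simp add: left_diff_distrib)
    ultimately have "\<bar>\<theta> - real j * arc_step\<bar> \<le> arc_step / 2" by simp
    from close[OF this] c have cl: "\<bar>\<theta> - arc_centre (n - j)\<bar> \<le> arc_radius" unfolding cj[OF j(1)] by blast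
    have k: "n - j \<in> {1..n}" using j n by auto
    have "cos \<theta> \<in> {cos (arc_upper (n - j))..cos (arc_lower (n - j))}"
      using mem[OF \<theta>(1,2) k] cl by blast
    then show "z \<in> interval_union n (\<lambda>k. cos (arc_upper k)) (\<lambda>k. cos (arc_lower k))"
      unfolding interval_union_def \<phi>(1) \<theta>(3)[symmetric] using k by blast
  next
    assume "z \<in> interval_union n (\<lambda>k. cos (arc_upper k)) (\<lambda>k. cos (arc_lower k))"
    then obtain k x where k: "k \<in> {1..n}" "z = of_real x" "x \<in> {cos (arc_upper k)..cos (arc_lower k)}"
      by (auto simp: interval_union_def)
    then have x: "-1 \<le> x" "x \<le> 1"
      using cos_ge_minus_one[of "arc_upper k"] cos_le_one[of "arc_lower k"] by (auto simp del: cos_ge_minus_one cos_le_one)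
    define \<theta> where "\<theta> = arccos x"
    have \<theta>: "0 \<le> \<theta>" "\<theta> \<le> pi" "cos \<theta> = x" using x by (auto simp: \<theta>_def cos_arccos arccos_lbound arccos_ubound)
    have cl: "\<bar>\<theta> - arc_centre k\<bar> \<le> arc_radius"
      using mem[OF \<theta>(1,2) k(1)] k(3) unfolding \<theta>(3) by blast
    define j where "j = n - k"
    have j: "j \<le> m" "n - j = k" using k(1) n by (auto simp: j_def)
    have cl': "\<bar>\<theta> - real j * arc_step\<bar> \<le> arc_radius" using cl unfolding cj[OF j(1), symmetric] j(2) .
    then have "\<bar>\<theta> - real j * arc_step\<bar> \<le> arc_step / 2" using arc_radius by linarith
    from close[OF this] cl' have "cos (l / 2) \<le> cos (real (2 * m) * \<theta>)" by blast
    then show "z \<in> arc_projection l (2 * m)"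
      unfolding arc_projection_iff[OF l N] k(2) \<theta>(3)[symmetric] by blast
  qed
qed

text \<open>The two end strips have width \<open>arc_step / 2\<close> and base \<open>u\<close>,
  hence contribute \<open>u powr (1 / (4 * m^2))\<close> each. The \<open>m - 1\<close> inner strips
  have base \<open>sin (l / 4) = sqrt u\<close> and exponent \<open>1 / m^2\<close>. The exponents
  of \<open>u\<close> add up to \<open>1 / (2 * m)\<close>, as in the capacity of the set.\<close>

lemma cut_product_extremal:
  "cut_product n (\<lambda>k. cos (arc_upper k)) (\<lambda>k. cos (arc_lower k)) (extremal_cut n)
     = ((1 - cos (l / 2)) / 2) powr (1 / (2 * real m))"
proof -
  define u where "u = (1 - cos (l / 2)) / 2"
  have u: "u = (sin (l / 4))\<^sup>2" using cos_double_sin[of "l / 4"] by (simp add: u_def)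
  have sin_pos: "0 < sin (l / 4)" using l by (intro sin_gt_zero) auto
  then have u0: "0 < u" by (simp add: u)
  have sin_u: "sin (l / 4) = u powr (1 / 2)" using sin_pos by (simp add: u powr_half_sqrt)
  have m: "0 < real m" by (rule arc_counts)
  define s where "s = (\<lambda>k. arccos (extremal_cut n k))"
  have s0: "s 0 = pi" "s n = 0" using arc_counts by (auto simp: s_def extremal_cut_def)
  have s: "s k = arc_centre k - arc_step / 2" if k: "k \<in> {1..<n}" for k
  proof -
    have k': "k \<in> {1..n}" "Suc k \<in> {1..n}" using k by auto
    show ?thesis
      unfolding s_def extremal_cut_arc[OF k]
      using arc_gap[OF k] arc_bounds[OF k'(1)] arc_bounds[OF k'(2)] by (intro arccos_cos; linarith)
  qed
  have AB: "arccos (cos (arc_upper k)) = arc_upper k" "arccos (cos (arc_lower k)) = arc_lower k" if "k \<in> {1..n}" for k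
    using arc_bounds[OF that] by (auto intro!: arccos_cos)
  define e where "e = (\<lambda>k. if k = 1 \<or> k = n then 1 / (4 * (real m)\<^sup>2) else 1 / (2 * (real m)\<^sup>2))"
  have "(1/2 * (cos (pi * (arc_lower k - s k) / (s (k - 1) - s k)) - cos (pi * (arc_upper k - s k) / (s (k - 1) - s k))))
      powr ((s k - s (k - 1))\<^sup>2 / pi\<^sup>2) = u powr e k" if k: "k \<in> {1..n}" for k
  proof -
    have half: "pi * (arc_step / 2 - arc_radius) / (arc_step / 2) = pi - l / 2"
      "pi * arc_radius / (arc_step / 2) = l / 2" "pi * (arc_step / 2 - arc_radius) / arc_step = pi / 2 - l / 4"
      "pi * (arc_step / 2 + arc_radius) / arc_step = pi / 2 + l / 4"
    proof -
      have t0: "arc_step \<noteq> 0" using arc_step by simp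
      have "pi * (t / 2 - r) / (t / 2) = pi - 2 * (pi * r / t)" "pi * r / (t / 2) = 2 * (pi * r / t)"
        "pi * (t / 2 - r) / t = pi / 2 - pi * r / t" "pi * (t / 2 + r) / t = pi / 2 + pi * r / t"
        if "t \<noteq> 0" for t r :: real
        using that by (auto simp: field_simps)
      from this[OF t0, of arc_radius] show "pi * (arc_step / 2 - arc_radius) / (arc_step / 2) = pi - l / 2"
      "pi * arc_radius / (arc_step / 2) = l / 2" "pi * (arc_step / 2 - arc_radius) / arc_step = pi / 2 - l / 4"
      "pi * (arc_step / 2 + arc_radius) / arc_step = pi / 2 + l / 4"
        unfolding arc_radius(3) by auto
    qed
    have quarter: "(arc_step / 2)\<^sup>2 / pi\<^sup>2 = 1 / (4 * (real m)\<^sup>2)"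
      using arc_step(3) by (simp add: power_divide)
    consider "k = 1" "k < n" | "k = n" "1 < k" | "1 < k" "k < n" using k arc_counts by fastforce
    then show ?thesis
    proof cases
      case 1
      have k1: "k - 1 = 0" using 1 by simp
      have d: "s (k - 1) - s k = arc_step / 2" using s[of k] 1 arc_centre(1) unfolding k1 s0 by simp
      have A: "arc_lower k - s k = arc_step / 2 - arc_radius" "arc_upper k - s k = arc_step / 2"
        using s[of k] 1 arc_centre(1) by (simp_all add: arc_lower_def arc_upper_def)
      have "(s k - s (k - 1))\<^sup>2 = (arc_step / 2)\<^sup>2" unfolding d[symmetric] by (rule power2_commute)
      moreover have "pi * (arc_step / 2) / (arc_step / 2) = pi" using arc_step by simp
      moreover have "1/2 * (cos (pi - l / 2) - cos pi) = u" by (simp add: u_def)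
      ultimately show ?thesis unfolding d A half using 1 by (simp only: quarter e_def) simp
    next
      case 2
      have k1: "k - 1 \<in> {1..<n}" "Suc (k - 1) = k" using 2 by auto
      have "s (k - 1) = arc_step / 2"
        using s[OF k1(1)] arc_centre(3)[of "k - 1"] arc_centre(2) 2(1) unfolding k1(2) by simp
      then have d: "s (k - 1) - s k = arc_step / 2" using s0 2 by simp
      have A: "arc_lower k - s k = 0" "arc_upper k - s k = arc_radius"
        using s0 2 arc_centre(2) by (simp_all add: arc_lower_def arc_upper_def)
      have "(s k - s (k - 1))\<^sup>2 = (arc_step / 2)\<^sup>2" unfolding d[symmetric] by (rule power2_commute)
      moreover have "1/2 * (cos (pi * 0 / (arc_step / 2)) - cos (l / 2)) = u" by (simp add: u_def)
      ultimately show ?thesis unfolding d A half using 2 by (simp only: quarter e_def) simp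
    next
      case 3
      have d: "s (k - 1) - s k = arc_step"
      proof -
        have k1: "k - 1 \<in> {1..<n}" "Suc (k - 1) = k" using 3 by auto
        have "s k = arc_centre k - arc_step / 2" using s[of k] 3 by simp
        then show ?thesis using s[OF k1(1)] arc_centre(3)[of "k - 1"] unfolding k1(2) by linarith
      qed
      have A: "arc_lower k - s k = arc_step / 2 - arc_radius" "arc_upper k - s k = arc_step / 2 + arc_radius"
        using s[of k] 3 by (simp_all add: arc_lower_def arc_upper_def)
      have "(s k - s (k - 1))\<^sup>2 = arc_step\<^sup>2" unfolding d[symmetric] by (rule power2_commute)
      moreover have "1/2 * (cos (pi / 2 - l / 4) - cos (pi / 2 + l / 4)) = u powr (1 / 2)"
        by (simp add: cos_diff cos_add sin_u[symmetric])
      moreover have "(u powr (1 / 2)) powr (1 / (real m)\<^sup>2) = u powr e k" using 3 by (simp add: powr_powr e_def)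
      ultimately show ?thesis unfolding d A half by (simp only: arc_step(3))
    qed
  qed
  then have "cut_product n (\<lambda>k. cos (arc_upper k)) (\<lambda>k. cos (arc_lower k)) (extremal_cut n) = (\<Prod>k=1..n. u powr e k)"
    unfolding cut_product_def s_def[symmetric] by (intro prod.cong refl) (simp add: AB s_def)
  also have "\<dots> = u powr (\<Sum>k=1..n. e k)" using u0 by (intro powr_sum[symmetric]) auto
  also have "(\<Sum>k=1..n. e k) = 1 / (2 * real m)"
  proof -
    have "{1..n} = insert 1 (insert n {2..m})" using n by auto
    then have "(\<Sum>k=1..n. e k) = e 1 + (e n + (\<Sum>k=2..m. e k))" using n by simp
    also have "(\<Sum>k=2..m. e k) = (\<Sum>k=2..m. 1 / (2 * (real m)\<^sup>2))" using n by (intro sum.cong) (auto simp: e_def)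
    also have "\<dots> = (real m - 1) / (2 * (real m)\<^sup>2)" using arc_counts by (simp add: of_nat_diff)
    finally show ?thesis using m by (simp add: e_def field_simps power2_eq_square)
  qed
  finally show ?thesis by (simp add: u_def)
qed

end

text \<open>The strict inequalities for cuts provide no compactness, so the maximum is expressed as
  a supremum. Boundedness is part of the claim because \<open>SUP\<close> of an unbounded set of
  reals carries no information.\<close>

theorem theorem2:
  fixes n :: nat
  assumes "2 \<le> n"
  shows "(\<forall>a b. interval_system n a b \<longrightarrow>
            bdd_above (cut_product n a b ` cuts n a b) \<and>
            log_capacity (interval_union n a b)
              \<ge> 1/2 * (SUP \<delta>\<in>cuts n a b. cut_product n a b \<delta>))
       \<and> (\<forall>l::real. 0 < l \<and> l < 2 * pi \<longrightarrow>
            (\<exists>a b. interval_system n a b \<and>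
               arc_projection l (2 * (n - 1)) = interval_union n a b \<and>
               extremal_cut n \<in> cuts n a b \<and>
               cut_product n a b (extremal_cut n) = (SUP \<delta>\<in>cuts n a b. cut_product n a b \<delta>) \<and>
               log_capacity (arc_projection l (2 * (n - 1)))
                 = 1/2 * cut_product n a b (extremal_cut n)))"
proof -
  have le: "cut_product n a b \<delta> \<le> 2 * log_capacity (interval_union n a b)"
    if "interval_system n a b" "\<delta> \<in> cuts n a b" for a b \<delta>
    using cut_product_le_log_capacity[OF _ that] assms by simp
  have bdd: "bdd_above (cut_product n a b ` cuts n a b)" if "interval_system n a b" for a b
    using le[OF that] by (intro bdd_aboveI2) auto
  have sup: "(SUP \<delta>\<in>cuts n a b. cut_product n a b \<delta>) \<le> 2 * log_capacity (interval_union n a b)"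
    if sys: "interval_system n a b" for a b
  proof (rule cSUP_least)
    \<comment> \<open>The midpoints of the gaps form a cut, so the supremum is over a nonempty
      set.\<close>
    have "(\<lambda>k. if k = 0 then -1 else if k < n then (b k + a (Suc k)) / 2 else 1) \<in> cuts n a b"
      using sys assms by (auto simp: cuts_def interval_system_def field_simps)
    then show "cuts n a b \<noteq> {}" by blast
  qed (rule le[OF sys])
  show ?thesis
  proof (intro conjI allI impI)
    fix a b assume sys: "interval_system n a b"
    show "bdd_above (cut_product n a b ` cuts n a b)" by (rule bdd[OF sys])
    show "1/2 * (SUP \<delta>\<in>cuts n a b. cut_product n a b \<delta>) \<le> log_capacity (interval_union n a b)"
      using sup[OF sys] by simp
  next
    fix l :: real assume l: "0 < l \<and> l < 2 * pi"
    define m where "m = n - 1"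
    have nm: "n = Suc m" "0 < m" using assms by (auto simp: m_def)
    have l': "0 < l" "l < 2 * pi" using l by auto
    define a b where "a = (\<lambda>k. cos (arc_upper n m l k))" and "b = (\<lambda>k. cos (arc_lower n m l k))"
    have sys: "interval_system n a b" unfolding a_def b_def by (rule arc_interval_system[OF nm l'])
    have arc: "arc_projection l (2 * m) = interval_union n a b"
      unfolding a_def b_def by (rule arc_projection_eq_interval_union[OF nm l'])
    have cut: "extremal_cut n \<in> cuts n a b" unfolding a_def b_def by (rule extremal_cut_mem[OF nm l'])
    have prod: "cut_product n a b (extremal_cut n) = ((1 - cos (l / 2)) / 2) powr (1 / (2 * real m))"
      unfolding a_def b_def by (rule cut_product_extremal[OF nm l'])
    have cap: "log_capacity (arc_projection l (2 * m)) = 1/2 * cut_product n a b (extremal_cut n)"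
      using log_capacity_arc_projection[OF l', of "2 * m"] nm(2) by (simp add: prod)
    have "cut_product n a b (extremal_cut n) \<le> (SUP \<delta>\<in>cuts n a b. cut_product n a b \<delta>)"
      by (rule cSUP_upper[OF cut bdd[OF sys]])
    \<comment> \<open>The supremum is squeezed: it is at most twice the capacity, and the capacity
      is half the value at the extremal cut.\<close>
    moreover have "(SUP \<delta>\<in>cuts n a b. cut_product n a b \<delta>) \<le> cut_product n a b (extremal_cut n)"
      using sup[OF sys] cap unfolding arc by simp
    ultimately have "cut_product n a b (extremal_cut n) = (SUP \<delta>\<in>cuts n a b. cut_product n a b \<delta>)" by simp
    then show "\<exists>a b. interval_system n a b \<and>
               arc_projection l (2 * (n - 1)) = interval_union n a b \<and>
               extremal_cut n \<in> cuts n a b \<and>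
               cut_product n a b (extremal_cut n) = (SUP \<delta>\<in>cuts n a b. cut_product n a b \<delta>) \<and>
               log_capacity (arc_projection l (2 * (n - 1)))
                 = 1/2 * cut_product n a b (extremal_cut n)"
      using sys arc cut cap unfolding m_def by blast
  qed
qed

end
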